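(* Let $n\ge 3$ and let $C$ be a real symmetric positive definite $n\times n$ matrix with distinct eigenvalues. For generic $G\in so(n)$, i.e. for all $G$ in some open dense subset of $so(n)$, the control system on $so(n)$ $$\dot\Omega=\mathcal I_C^{-1}[C,\Omega^2]+G\,u(t)$$ with scalar control $u$ is globally controllable; moreover, for every $b>0$ it is globally controllable also when the control is subject to the bound $|u(t)|\le b$.
   Context: $so(n)$ is the space of real skew-symmetric $n\times n$ matrices and $[\cdot,\cdot]$ is the matrix commutator. For $C$ symmetric positive definite, the inertia operator $\mathcal I_C: so(n)\to so(n)$, $\mathcal I_C\Omega=\Omega C+C\Omega$, is an invertible linear map; for $\Omega\in so(n)$ the matrix $[C,\Omega^2]$ is skew-symmetric, so $\mathcal I_C^{-1}[C,\Omega^2]$ is well defined. Controls are (essentially) bounded measurable functions of time with values in $\mathbb R$ (with values in $[-b,b]$ in the bounded-control case). Global controllability means: for any $\tilde\Omega,\hat\Omega\in so(n)$ there exist $T\ge 0$ and an admissible control on $[0,T]$ such that the solution of the system starting at $\Omega(0)=\tilde\Omega$ satisfies $\Omega(T)=\hat\Omega$. *)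

theory Defs
  imports "HOL-Analysis.Analysis"
begin

definition so :: "(real ^ 'n ^ 'n) set"
  where "so = {A. transpose A = - A}"

definition commutator :: "real ^ 'n ^ 'n \<Rightarrow> real ^ 'n ^ 'n \<Rightarrow> real ^ 'n ^ 'n"
  where "commutator A B = A ** B - B ** A"

definition sym_posdef :: "real ^ 'n ^ 'n \<Rightarrow> bool"
  where "sym_posdef C \<longleftrightarrow> transpose C = C \<and> (\<forall>x. x \<noteq> 0 \<longrightarrow> x \<bullet> (C *v x) > 0)"

definition eigenvalues :: "real ^ 'n ^ 'n \<Rightarrow> real set"
  where "eigenvalues C = {l. \<exists>v. v \<noteq> 0 \<and> C *v v = l *\<^sub>R v}"

text \<open>The eigenvalues of an \<open>n \<times> n\<close> matrix, counted with multiplicity, are pairwise distinct and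
  real iff there are \<open>n\<close> of them as a set (for symmetric matrices realness is automatic).\<close>

definition distinct_eigenvalues :: "real ^ 'n ^ 'n \<Rightarrow> bool"
  where "distinct_eigenvalues C \<longleftrightarrow> card (eigenvalues C) = CARD('n)"

definition inertia :: "real ^ 'n ^ 'n \<Rightarrow> real ^ 'n ^ 'n \<Rightarrow> real ^ 'n ^ 'n"
  where "inertia C W = W ** C + C ** W"

text \<open>The inverse of the inertia operator as a map on \<open>so\<close>; see \<open>inertia_bij\<close> and
  \<open>commutator_square_so\<close> below for why its use in \<open>euler_field\<close> is meaningful.\<close>

definition inertia_inv :: "real ^ 'n ^ 'n \<Rightarrow> real ^ 'n ^ 'n \<Rightarrow> real ^ 'n ^ 'n"
  where "inertia_inv C = inv_into so (inertia C)"

definition euler_field :: "real ^ 'n ^ 'n \<Rightarrow> real ^ 'n ^ 'n \<Rightarrow> real ^ 'n ^ 'n"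
  where "euler_field C W = inertia_inv C (commutator C (W ** W))"

definition admissible_control :: "real set \<Rightarrow> real \<Rightarrow> (real \<Rightarrow> real) \<Rightarrow> bool"
  where "admissible_control U T u \<longleftrightarrow>
    u \<in> borel_measurable (lebesgue_on {0..T}) \<and>
    (\<exists>M. AE t in lebesgue_on {0..T}. \<bar>u t\<bar> \<le> M) \<and>
    (\<forall>t\<in>{0..T}. u t \<in> U)"

text \<open>Since controls are merely measurable, solutions are meant in the sense of Caratheodory, i.e.
  continuous solutions of the integral form of the equation. As the right-hand side is locally
  Lipschitz in the state, a solution on \<open>[0,T]\<close> is determined by its initial value.\<close>

definition solution :: "real ^ 'n ^ 'n \<Rightarrow> real ^ 'n ^ 'n \<Rightarrow> real \<Rightarrow> (real \<Rightarrow> real)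
    \<Rightarrow> (real \<Rightarrow> real ^ 'n ^ 'n) \<Rightarrow> bool"
  where "solution C G T u W \<longleftrightarrow>
    continuous_on {0..T} W \<and>
    (\<forall>t\<in>{0..T}. W t \<in> so) \<and>
    (\<forall>t\<in>{0..T}. ((\<lambda>s. euler_field C (W s) + u s *\<^sub>R G) has_integral (W t - W 0)) {0..t})"

definition globally_controllable :: "real ^ 'n ^ 'n \<Rightarrow> real ^ 'n ^ 'n \<Rightarrow> real set \<Rightarrow> bool"
  where "globally_controllable C G U \<longleftrightarrow>
    (\<forall>X\<in>so. \<forall>Y\<in>so. \<exists>T\<ge>0. \<exists>u W.
       admissible_control U T u \<and> solution C G T u W \<and> W 0 = X \<and> W T = Y)"

lemma matrix_uminus_left: "(- A) ** B = - (A ** (B :: real ^ 'n ^ 'n))"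
  by (simp add: matrix_matrix_mult_def vec_eq_iff sum_negf)

lemma matrix_uminus_right: "A ** (- B) = - (A ** (B :: real ^ 'n ^ 'n))"
  by (simp add: matrix_matrix_mult_def vec_eq_iff sum_negf)

lemma transpose_plus: "transpose (A + B) = transpose A + transpose (B :: real ^ 'n ^ 'n)"
  by (simp add: transpose_def vec_eq_iff)

lemma transpose_minus: "transpose (A - B) = transpose A - transpose (B :: real ^ 'n ^ 'n)"
  by (simp add: transpose_def vec_eq_iff)

lemma transpose_scaleR: "transpose (r *\<^sub>R A) = r *\<^sub>R transpose (A :: real ^ 'n ^ 'n)"
  by (simp add: transpose_def vec_eq_iff)

lemma subspace_so: "subspace (so :: (real ^ 'n ^ 'n) set)"
proof -
  have "transpose (0 :: real ^ 'n ^ 'n) = 0"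
    by (simp add: transpose_def vec_eq_iff)
  then show ?thesis
    unfolding subspace_def so_def by (simp add: transpose_plus transpose_scaleR)
qed

lemma commutator_square_so:
  assumes "transpose C = C" "W \<in> so"
  shows "commutator C (W ** W) \<in> so"
  using assms unfolding so_def commutator_def
  by (simp add: transpose_minus matrix_transpose_mul matrix_uminus_left matrix_uminus_right)

lemma inertia_in_so:
  assumes "transpose C = C" "W \<in> so"
  shows "inertia C W \<in> so"
  using assms unfolding so_def inertia_def
  by (simp add: transpose_plus matrix_transpose_mul matrix_uminus_left matrix_uminus_right)

lemma linear_inertia: "linear (inertia C)"
proof (rule linearI)
  show "inertia C (A + B) = inertia C A + inertia C B" for A B
    by (simp add: inertia_def matrix_matrix_mult_def vec_eq_iff sum.distrib algebra_simps)
  show "inertia C (r *\<^sub>R A) = r *\<^sub>R inertia C A" for r A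
    by (simp add: inertia_def matrix_matrix_mult_def vec_eq_iff sum_distrib_left algebra_simps)
qed

lemma trace_congruence:
  fixes A C :: "real ^ 'n ^ 'n"
  shows "trace (transpose A ** (C ** A)) = (\<Sum>i\<in>UNIV. column i A \<bullet> (C *v column i A))"
  unfolding trace_def transpose_def matrix_matrix_mult_def matrix_vector_mult_def column_def
  by (simp add: inner_vec_def)

lemma inertia_kernel:
  assumes C: "sym_posdef C" and W: "W \<in> so" and z: "inertia C W = 0"
  shows "W = 0"
proof -
  have nonneg: "x \<bullet> (C *v x) \<ge> 0" for x
    using C unfolding sym_posdef_def by (cases "x = 0") (auto intro: less_imp_le)
  have t: "transpose W = - W" using W by (simp add: so_def)
  have "0 = trace (transpose W ** inertia C W)"
    by (simp add: z trace_def)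
  also have "\<dots> = trace ((transpose W ** W) ** C) + trace (transpose W ** (C ** W))"
    by (simp add: inertia_def matrix_add_ldistrib trace_add matrix_mul_assoc)
  also have "trace ((transpose W ** W) ** C) = trace (transpose (transpose W) ** (C ** transpose W))"
    by (metis matrix_mul_assoc trace_mul_sym transpose_transpose)
  finally have "(\<Sum>i\<in>UNIV. column i W \<bullet> (C *v column i W)) \<le> 0"
    unfolding trace_congruence using nonneg by (smt (verit) sum_nonneg)
  then have "column i W \<bullet> (C *v column i W) = 0" for i
    using nonneg by (smt (verit) UNIV_I finite sum_nonneg sum_nonneg_eq_0_iff)
  then have "column i W = 0" for i
    using C unfolding sym_posdef_def by (metis less_irrefl)
  then show ?thesis by (simp add: column_def vec_eq_iff)
qed

lemma inertia_bij:
  assumes "sym_posdef C"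
  shows "bij_betw (inertia C) so so"
proof -
  have inj: "inj_on (inertia C) so"
    using linear_inj_on_iff_eq_0[OF linear_inertia subspace_so] inertia_kernel[OF assms] by blast
  moreover have "inertia C ` so = so"
  proof (rule subspace_dim_equal)
    show "subspace (inertia C ` so)"
      by (rule linear_subspace_image[OF linear_inertia subspace_so])
    show "inertia C ` so \<subseteq> so"
      using assms inertia_in_so by (auto simp: sym_posdef_def)
    have "dim (inertia C ` so) = dim (so :: (real ^ 'a ^ 'a) set)"
      using dim_image_eq[OF linear_inertia] inj subspace_so span_eq_iff by metis
    then show "dim (so :: (real ^ 'a ^ 'a) set) \<le> dim (inertia C ` so)" by simp
  qed (rule subspace_so)
  ultimately show ?thesis by (simp add: bij_betw_def)
qed

end

theory Submission
  imports Defs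
begin

text \<open>
  In an eigenbasis of \<open>C\<close> the Euler field becomes \<open>W \<mapsto> B W W\<close> with \<open>B\<close> a symmetric bilinear map whose
  component along each matrix entry does not involve that entry. Hence its flow preserves volume (it is a
  limit of compositions of shears), and it conserves energy, so by a recurrence argument the closure of the
  set attainable from an open set is invariant under the drift in both time directions. Conjugating the
  drift with translations then makes this closed set invariant under translation by \<open>G\<close> and, with \<open>w\<close>, by
  \<open>\<plusminus> B w w\<close>; for generic \<open>G\<close> these directions generate everything, and the attainable set is dense.
  A maximal rank argument in the style of Krener shows that the set attainable from a single point has
  interior, and \<open>B (- W) (- W) = B W W\<close> exchanges forward and backward attainability. An attainable open
  set from \<open>X\<close> is thus steered into the open set from which \<open>Y\<close> is attainable.
\<close>

section \<open>Ordinary differential equations\<close>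

text \<open>The control bound \<open>b\<close> may be arbitrarily small, so the control cannot
  overpower the drift; the drift has to be undone by recurrence. The bounded case is therefore the
  real one, and unrestricted controls inherit it. Recurrence only speaks about closed sets, hence it
  yields density of attainable sets. Exact steering needs the interior of the set attainable from
  one point in addition. A second obstacle is that \<open>so\<close> is a subspace of a matrix type,
  while flows, Lebesgue measure and ranks are handled on a whole Euclidean space. The system is
  therefore extended to all matrices by a product that ignores symmetric parts, and reachability
  admits free jumps along symmetric matrices. Taking skew parts turns an extended path into a
  genuine one. Genericity is algebraic: \<open>G\<close> generates the whole space under the
  product. A nonzero determinant certifies this, which makes the condition open. The determinant is
  polynomial along lines, so a single generating \<open>G\<close> makes the condition dense. Such a
  \<open>G\<close> is found as a perturbation of a rotation in the plane of the two smallest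
  moments.\<close>

lemma gronwall:
  fixes q :: "real \<Rightarrow> real"
  assumes der: "\<And>t. 0 \<le> t \<Longrightarrow> t \<le> T \<Longrightarrow> (q has_real_derivative q' t) (at t)"
    and le: "\<And>t. 0 \<le> t \<Longrightarrow> t \<le> T \<Longrightarrow> q' t \<le> K * q t + c"
    and "0 \<le> c" "0 \<le> K" "0 \<le> t" "t \<le> T"
  shows "q t \<le> (q 0 + c * t) * exp (K * t)"
proof -
  define r where "r s = exp (- K * s) * q s - c * s" for s
  have "r t \<le> r 0"
  proof (rule DERIV_nonpos_imp_nonincreasing[OF \<open>0 \<le> t\<close>])
    fix s assume s: "0 \<le> s" "s \<le> t"
    then have s': "0 \<le> s" "s \<le> T" using assms by auto
    have "(r has_real_derivative (exp (- K * s) * (q' s - K * q s) - c)) (at s)"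
      unfolding r_def by (rule derivative_eq_intros der s' refl)+ (simp add: algebra_simps)
    moreover have "exp (- K * s) * (q' s - K * q s) \<le> exp (- K * s) * c"
      using le[OF s'] by (intro mult_left_mono) auto
    moreover have "exp (- K * s) * c \<le> 1 * c"
      using s assms by (intro mult_right_mono) auto
    ultimately show "\<exists>y. (r has_real_derivative y) (at s) \<and> y \<le> 0"
      by (intro exI[of _ "exp (- K * s) * (q' s - K * q s) - c"] conjI) linarith+
  qed
  then have "exp (- K * t) * q t \<le> q 0 + c * t" by (simp add: r_def)
  then have "exp (K * t) * (exp (- K * t) * q t) \<le> exp (K * t) * (q 0 + c * t)"
    by (intro mult_left_mono) auto
  then show ?thesis by (simp add: exp_minus field_simps)
qed

text \<open>Successive iterates differ by at most \<open>M * (L * t) ^ k / fact k\<close>, which is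
  summable on every \<open>{0..T}\<close>. Convergence holds on each of these intervals at once,
  with no gluing of short-time solutions.\<close>

lemma picard_forward:
  fixes F :: "real \<Rightarrow> 'a::banach \<Rightarrow> 'a"
  assumes cont: "continuous_on UNIV (\<lambda>(t, x). F t x)"
    and lip: "\<And>T. \<exists>L. \<forall>t\<in>{0..T}. \<forall>x y. norm (F t x - F t y) \<le> L * norm (x - y)"
  shows "\<exists>X. X 0 = x0 \<and> (\<forall>t\<ge>0. (X has_vector_derivative F t (X t)) (at t within {0..}))"
proof -
  define P where "P = rec_nat (\<lambda>t. x0) (\<lambda>_ p t. x0 + integral {0..t} (\<lambda>s. F s (p s)))"
  have P0: "P 0 = (\<lambda>t. x0)" and PS: "P (Suc k) t = x0 + integral {0..t} (\<lambda>s. F s (P k s))" for k t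
    by (simp_all add: P_def)
  have comp: "continuous_on S (\<lambda>s. F s (p s))" if "continuous_on S p" for p :: "real \<Rightarrow> 'a" and S
  proof -
    have "continuous_on S (\<lambda>s. (s, p s))" using that by (intro continuous_intros)
    from continuous_on_compose2[OF cont this] show ?thesis by simp
  qed
  have contP: "continuous_on {0..T} (P k)" for k T
  proof (induction k)
    case (Suc k)
    have "continuous_on {0..T} (\<lambda>t. integral {0..t} (\<lambda>s. F s (P k s)))"
      by (intro indefinite_integral_continuous_1 integrable_continuous_interval comp Suc)
    then show ?case unfolding PS by (intro continuous_intros)
  qed (simp add: P0)
  have int: "(\<lambda>s. F s (P k s)) integrable_on {0..T}" for k T
    by (intro integrable_continuous_interval comp contP)
  have "\<exists>X. uniform_limit {0..T} P X sequentially" for T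
  proof -
    obtain L0 where L0: "\<forall>t\<in>{0..T}. \<forall>x y. norm (F t x - F t y) \<le> L0 * norm (x - y)" using lip by blast
    define L where "L = max L0 0"
    have L: "norm (F t x - F t y) \<le> L * norm (x - y)" if "t \<in> {0..T}" for t x y
      by (rule order_trans[OF L0[rule_format, OF that]]) (auto simp: L_def intro!: mult_right_mono)
    have "L \<ge> 0" by (simp add: L_def)
    obtain M where M: "\<And>t. t \<in> {0..T} \<Longrightarrow> norm (P 1 t - P 0 t) \<le> M"
    proof -
      have "bounded ((\<lambda>t. P 1 t - P 0 t) ` {0..T})"
        by (intro compact_imp_bounded compact_continuous_image continuous_on_diff contP compact_Icc)
      then obtain a where "\<forall>t\<in>{0..T}. norm (P 1 t - P 0 t) \<le> a" by (auto simp: bounded_iff)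
      then show ?thesis using that[of a] by blast
    qed
    have bd: "norm (P (Suc k) t - P k t) \<le> M * (L * t) ^ k / fact k" if "t \<in> {0..T}" for k t
      using that
    proof (induction k arbitrary: t)
      case 0
      then show ?case using M by simp
    next
      case (Suc k)
      have sub: "{0..t} \<subseteq> {0..T}" using Suc.prems by auto
      have "P (Suc (Suc k)) t - P (Suc k) t = integral {0..t} (\<lambda>s. F s (P (Suc k) s) - F s (P k s))"
        unfolding PS[of _ t] by (subst integral_diff[OF int int]) (simp add: algebra_simps)
      also have "norm \<dots> \<le> integral {0..t} (\<lambda>s. M * L * (L * s) ^ k / fact k)"
      proof (rule integral_norm_bound_integral)
        show "(\<lambda>s. F s (P (Suc k) s) - F s (P k s)) integrable_on {0..t}"
          by (intro integrable_diff int)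
        show "(\<lambda>s. M * L * (L * s) ^ k / fact k) integrable_on {0..t}"
          by (intro integrable_continuous_interval continuous_intros) simp
        fix s assume s: "s \<in> {0..t}"
        have "norm (F s (P (Suc k) s) - F s (P k s)) \<le> L * norm (P (Suc k) s - P k s)"
          using L s sub by blast
        also have "\<dots> \<le> L * (M * (L * s) ^ k / fact k)"
          using Suc.IH s sub \<open>L \<ge> 0\<close> by (intro mult_left_mono) auto
        finally show "norm (F s (P (Suc k) s) - F s (P k s)) \<le> M * L * (L * s) ^ k / fact k"
          by (simp add: mult_ac)
      qed
      also have "\<dots> = M * (L * t) ^ Suc k / fact (Suc k)"
      proof (rule integral_unique)
        have "((\<lambda>s. M * L * (L * s) ^ k / fact k) has_integral
           (M * (L * t) ^ Suc k / fact (Suc k) - M * (L * 0) ^ Suc k / fact (Suc k))) {0..t}"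
        proof (rule fundamental_theorem_of_calculus)
          fix s
          have "((\<lambda>s. M * (L * s) ^ Suc k / fact (Suc k)) has_real_derivative
            (M * (real (Suc k) * (L * s) ^ k * L) / fact (Suc k))) (at s within {0..t})"
            by (auto intro!: derivative_eq_intros simp del: power_Suc fact_Suc)
          moreover have "M * (real (Suc k) * (L * s) ^ k * L) / fact (Suc k) = M * L * (L * s) ^ k / fact k"
            unfolding fact_Suc by (simp del: of_nat_Suc fact_Suc)
          ultimately show "((\<lambda>s. M * (L * s) ^ Suc k / fact (Suc k)) has_vector_derivative
            M * L * (L * s) ^ k / fact k) (at s within {0..t})"
            by (simp only: has_real_derivative_iff_has_vector_derivative)
        qed (use Suc.prems in auto)
        then show "((\<lambda>s. M * L * (L * s) ^ k / fact k) has_integral M * (L * t) ^ Suc k / fact (Suc k)) {0..t}"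
          by simp
      qed
      finally show ?case .
    qed
    have "uniform_limit {0..T} (\<lambda>n t. \<Sum>k<n. (P (Suc k) t - P k t)) (\<lambda>t. \<Sum>k. (P (Suc k) t - P k t)) sequentially"
    proof (rule Weierstrass_m_test)
      show "summable (\<lambda>k. \<bar>M\<bar> * ((L * \<bar>T\<bar>) ^ k / fact k))"
        using summable_exp_generic[of "L * \<bar>T\<bar>"] by (intro summable_mult) (simp add: divide_inverse mult.commute)
      fix k t assume t: "t \<in> {0..T}"
      have "M * (L * t) ^ k / fact k \<le> \<bar>M\<bar> * (L * \<bar>T\<bar>) ^ k / fact k"
        using t \<open>L \<ge> 0\<close> by (intro divide_right_mono mult_mono power_mono mult_left_mono) auto
      then show "norm (P (Suc k) t - P k t) \<le> \<bar>M\<bar> * ((L * \<bar>T\<bar>) ^ k / fact k)"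
        using bd[OF t, of k] by simp
    qed
    moreover have "(\<Sum>k<n. (P (Suc k) t - P k t)) = P n t - x0" for n t
      using sum_lessThan_telescope[of "\<lambda>k. P k t" n] by (simp add: P0)
    ultimately have "uniform_limit {0..T} (\<lambda>n t. P n t - x0) (\<lambda>t. \<Sum>k. (P (Suc k) t - P k t)) sequentially"
      by simp
    then have "uniform_limit {0..T} (\<lambda>n t. P n t - x0 + x0) (\<lambda>t. (\<Sum>k. (P (Suc k) t - P k t)) + x0) sequentially"
      by (intro uniform_limit_intros)
    then show ?thesis by auto
  qed
  then obtain Y where Y: "\<And>T. uniform_limit {0..T} P (Y T) sequentially" by metis
  \<comment> \<open>The limits on different intervals agree wherever both apply, so this diagonal
    choice is the limit on every interval.\<close>
  define X where "X t = Y t t" for t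
  have XY: "Y T t = X t" if "t \<in> {0..T}" for t T
    using tendsto_uniform_limitI[OF Y[of T] that] tendsto_uniform_limitI[OF Y[of t], of t] that
    unfolding X_def by (intro LIMSEQ_unique) auto
  have ul: "uniform_limit {0..T} P X sequentially" for T
    using Y[of T] XY by (subst uniform_limit_cong'[of _ P P X "Y T"]) auto
  have contX: "continuous_on {0..T} X" for T
    by (rule uniform_limit_theorem[OF _ ul]) (auto intro!: always_eventually contP)
  have XI: "X t = x0 + integral {0..t} (\<lambda>s. F s (X s))" if "t \<ge> 0" for t
  proof (rule LIMSEQ_unique)
    show "(\<lambda>n. P (Suc n) t) \<longlonglongrightarrow> X t"
      using tendsto_uniform_limitI[OF ul[of t], of t] that by (intro LIMSEQ_Suc) auto
    obtain L where L: "\<forall>s\<in>{0..t}. \<forall>x y. norm (F s x - F s y) \<le> L * norm (x - y)" using lip by blast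
    have uF: "uniform_limit {0..t} (\<lambda>n s. F s (P n s)) (\<lambda>s. F s (X s)) sequentially"
    proof (rule uniform_limitI)
      fix e :: real assume "e > 0"
      then have e': "e / (\<bar>L\<bar> + 1) > 0" by simp
      from uniform_limitD[OF ul[of t] e']
      show "\<forall>\<^sub>F n in sequentially. \<forall>s\<in>{0..t}. dist (F s (P n s)) (F s (X s)) < e"
      proof eventually_elim
        case (elim n)
        show ?case
        proof
          fix s assume s: "s \<in> {0..t}"
          then have "dist (F s (P n s)) (F s (X s)) \<le> L * norm (P n s - X s)"
            using L by (simp add: dist_norm)
          also have "\<dots> \<le> (\<bar>L\<bar> + 1) * norm (P n s - X s)" by (intro mult_right_mono) auto
          also have "\<dots> < (\<bar>L\<bar> + 1) * (e / (\<bar>L\<bar> + 1))"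
            using elim s by (intro mult_strict_left_mono) (auto simp: dist_norm)
          finally show "dist (F s (P n s)) (F s (X s)) < e" by simp
        qed
      qed
    qed
    have "(\<lambda>n. integral {0..t} (\<lambda>s. F s (P n s))) \<longlonglongrightarrow> integral {0..t} (\<lambda>s. F s (X s))"
    proof -
      obtain I J where IJ: "\<And>n. ((\<lambda>s. F s (P n s)) has_integral I n) {0..t}"
        "((\<lambda>s. F s (X s)) has_integral J) {0..t}" "I \<longlonglongrightarrow> J"
        by (rule uniform_limit_integral[OF uF]) (auto intro: comp contP)
      then show ?thesis using integral_unique[OF IJ(1)] integral_unique[OF IJ(2)] by simp
    qed
    then show "(\<lambda>n. P (Suc n) t) \<longlonglongrightarrow> x0 + integral {0..t} (\<lambda>s. F s (X s))"
      unfolding PS by (intro tendsto_intros)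
  qed
  have "(X has_vector_derivative F t (X t)) (at t within {0..})" if t: "t \<ge> 0" for t
  proof -
    have "((\<lambda>u. integral {0..u} (\<lambda>s. F s (X s))) has_vector_derivative F t (X t)) (at t within {0..t+1})"
      using t by (intro integral_has_vector_derivative comp contX) auto
    then have "((\<lambda>u. x0 + integral {0..u} (\<lambda>s. F s (X s))) has_vector_derivative F t (X t)) (at t within {0..t+1})"
      by (auto intro!: derivative_eq_intros)
    then have "(X has_vector_derivative F t (X t)) (at t within {0..t+1})"
      by (rule has_vector_derivative_transform_within[where d=1]) (use t XI in auto)
    moreover have "at t within {0..t+1} = at t within {0..}"
      by (rule at_within_nhd[of _ "{..<t+1}"]) auto
    ultimately show ?thesis by simp
  qed
  moreover have "X 0 = x0" using XI[of 0] by simp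
  ultimately show ?thesis by blast
qed

text \<open>Negative times come from the time-reversed equation, solved forwards. At 0 both halves
  have value \<open>x0\<close> and derivative \<open>F 0 x0\<close>, so they glue
  differentiably.\<close>

lemma picard:
  fixes F :: "real \<Rightarrow> 'a::banach \<Rightarrow> 'a"
  assumes cont: "continuous_on UNIV (\<lambda>(t, x). F t x)"
    and lip: "\<And>T. \<exists>L. \<forall>t\<in>{-T..T}. \<forall>x y. norm (F t x - F t y) \<le> L * norm (x - y)"
  obtains X where "X 0 = x0" "\<And>t. (X has_vector_derivative F t (X t)) (at t)"
proof -
  have "\<exists>X. X 0 = x0 \<and> (\<forall>t\<ge>0. (X has_vector_derivative F t (X t)) (at t within {0..}))"
  proof (rule picard_forward[OF cont])
    show "\<exists>L. \<forall>t\<in>{0..T}. \<forall>x y. norm (F t x - F t y) \<le> L * norm (x - y)" for T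
      using lip[of T] by fastforce
  qed
  then obtain X where X0: "X 0 = x0" and X: "\<And>t. t \<ge> 0 \<Longrightarrow> (X has_vector_derivative F t (X t)) (at t within {0..})"
    by blast
  have "\<exists>Y. Y 0 = x0 \<and> (\<forall>t\<ge>0. (Y has_vector_derivative - F (- t) (Y t)) (at t within {0..}))"
  proof (rule picard_forward)
    have "continuous_on UNIV (\<lambda>p. - (\<lambda>(t, x). F t x) (- fst p, snd p))"
      by (intro continuous_on_minus continuous_on_compose2[OF cont]) (auto intro!: continuous_intros)
    then show "continuous_on UNIV (\<lambda>(t, x). - F (- t) x)"
      by (simp add: case_prod_beta)
    show "\<exists>L. \<forall>t\<in>{0..T}. \<forall>x y. norm (- F (- t) x - - F (- t) y) \<le> L * norm (x - y)" for T
    proof -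
      obtain L where L: "\<forall>t\<in>{-T..T}. \<forall>x y. norm (F t x - F t y) \<le> L * norm (x - y)" using lip by blast
      have "norm (- F (- t) x - - F (- t) y) \<le> L * norm (x - y)" if "t \<in> {0..T}" for t x y
        using L[rule_format, of "-t" x y] that by (simp add: norm_minus_commute)
      then show ?thesis by blast
    qed
  qed
  then obtain Y where Y0: "Y 0 = x0"
    and Y: "\<And>t. t \<ge> 0 \<Longrightarrow> (Y has_vector_derivative - F (- t) (Y t)) (at t within {0..})"
    by blast
  define Z where "Z t = (if t \<in> {0..} then X t else Y (- t))" for t
  have Y': "((\<lambda>s. Y (- s)) has_vector_derivative F t (Y (- t))) (at t within {..0})" if "t \<le> 0" for t
  proof -
    have "((Y \<circ> uminus) has_vector_derivative (- 1) *\<^sub>R (- F (- (- t)) (Y (- t)))) (at t within {..0})"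
    proof (rule vector_diff_chain_within)
      show "(uminus has_vector_derivative - 1) (at t within {..0::real})"
        by (auto intro!: derivative_eq_intros)
      have "uminus ` {..0::real} = {0..}" by (auto intro: image_eqI[of _ _ "- x" for x])
      then show "(Y has_vector_derivative - F (- (- t)) (Y (- t))) (at (- t) within uminus ` {..0})"
        using Y[of "-t"] that by simp
    qed
    then show ?thesis by (simp add: o_def)
  qed
  have "(Z has_vector_derivative (if t \<in> {0..} then F t (X t) else F t (Y (- t)))) (at t within ({0..} \<union> {..0}))" for t
    unfolding Z_def has_vector_derivative_def
  proof -
    have "((\<lambda>t. if t \<in> {0..} then X t else Y (- t)) has_derivative
      (if t \<in> {0..} then (\<lambda>x. x *\<^sub>R F t (X t)) else (\<lambda>x. x *\<^sub>R F t (Y (- t))))) (at t within ({0..} \<union> {..0}))"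
    proof (rule has_derivative_If_within_closures)
      have c: "closure {0::real..} = {0..}" "closure {..0::real} = {..0}" by auto
      show "(X has_derivative (\<lambda>x. x *\<^sub>R F t (X t))) (at t within {0..} \<union> (closure {0..} \<inter> closure {..0}))"
        if "t \<in> {0..} \<union> (closure {0..} \<inter> closure {..0})"
      proof -
        have "{0..} \<union> (closure {0..} \<inter> closure {..0}) = {0::real..}" unfolding c by auto
        then show ?thesis using X[of t] that unfolding has_vector_derivative_def by (auto simp: c)
      qed
      show "((\<lambda>t. Y (- t)) has_derivative (\<lambda>x. x *\<^sub>R F t (Y (- t)))) (at t within {..0} \<union> (closure {0..} \<inter> closure {..0}))"
        if "t \<in> {..0} \<union> (closure {0..} \<inter> closure {..0})"
      proof -
        have "{..0} \<union> (closure {0..} \<inter> closure {..0}) = {..0::real}" unfolding c by auto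
        then show ?thesis using Y'[of t] that unfolding has_vector_derivative_def by (auto simp: c)
      qed
      show "X t = Y (- t)" if "t \<in> closure {0..}" "t \<in> closure {..0}"
        using that X0 Y0 unfolding c by auto
      show "(\<lambda>x. x *\<^sub>R F t (X t)) = (\<lambda>x. x *\<^sub>R F t (Y (- t)))" if "t \<in> closure {0..}" "t \<in> closure {..0}"
        using that X0 Y0 unfolding c by auto
      show "t \<in> {0..} \<union> {..0}" by auto
    qed
    then show "((\<lambda>t. if t \<in> {0..} then X t else Y (- t)) has_derivative
      (\<lambda>x. x *\<^sub>R (if t \<in> {0..} then F t (X t) else F t (Y (- t))))) (at t within ({0..} \<union> {..0}))"
      by (auto split: if_splits)
  qed
  moreover have "{0..} \<union> {..0::real} = UNIV" by auto
  ultimately have "(Z has_vector_derivative F t (Z t)) (at t)" for t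
    unfolding Z_def by (smt (verit) has_vector_derivative_def)
  moreover have "Z 0 = x0" by (simp add: Z_def X0)
  ultimately show ?thesis using that by blast
qed

text \<open>The radial retraction onto the closed ball of radius \<open>r > 0\<close>. Being a
  scalar multiple of \<open>x\<close>, it turns a homogeneous quadratic field into a scalar multiple
  of itself, and so respects the energy balance.\<close>

definition clamp :: "real \<Rightarrow> 'a::real_normed_vector \<Rightarrow> 'a"
  where "clamp r x = (r / max r (norm x)) *\<^sub>R x"

lemma clamp_eq: "0 < r \<Longrightarrow> norm x \<le> r \<Longrightarrow> clamp r x = x"
  by (simp add: clamp_def max_def)

lemma norm_clamp_le:
  assumes "0 < r"
  shows "norm (clamp r x) \<le> r"
proof -
  have "r * norm x \<le> r * max r (norm x)" using assms by (intro mult_left_mono) auto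
  then show ?thesis using assms by (simp add: clamp_def divide_le_eq)
qed

lemma clamp_lipschitz:
  assumes "0 < r"
  shows "norm (clamp r x - clamp r y) \<le> 2 * norm (x - y)"
proof -
  define a where "a = max r (norm x)"
  define c where "c = max r (norm y)"
  have a: "a > 0" "r \<le> a" and c: "c > 0" "norm y \<le> c" using assms by (auto simp: a_def c_def)
  have ac: "\<bar>c - a\<bar> \<le> norm (x - y)"
    using norm_triangle_ineq3[of x y] by (auto simp: a_def c_def max_def)
  \<comment> \<open>Moving the point at a fixed factor and changing the factor each cost at most
    \<open>norm (x - y)\<close>; hence the constant 2.\<close>
  have split: "clamp r x - clamp r y = (r / a) *\<^sub>R (x - y) + (r / a - r / c) *\<^sub>R y"
    by (simp add: clamp_def a_def c_def algebra_simps)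
  have "norm (clamp r x - clamp r y) \<le> norm ((r / a) *\<^sub>R (x - y)) + norm ((r / a - r / c) *\<^sub>R y)"
    unfolding split by (rule norm_triangle_ineq)
  also have "\<dots> = (r / a) * norm (x - y) + \<bar>c - a\<bar> * ((r / a) * (norm y / c))"
  proof -
    have "r / a - r / c = (c - a) * (r / (a * c))" using a c by (simp add: field_simps)
    then show ?thesis using a c assms by (simp add: abs_mult)
  qed
  also have "\<dots> \<le> 1 * norm (x - y) + norm (x - y) * (1 * 1)"
    using a c ac assms by (intro add_mono mult_mono) auto
  finally show ?thesis by simp
qed

section \<open>Shears and one-step methods\<close>

text \<open>Fubini along the coordinate \<open>e\<close> reduces this to translation invariance on the line.\<close>

lemma emeasure_lborel_shear_vimage:
  fixes \<phi> :: "'a::euclidean_space \<Rightarrow> real"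
  assumes e: "e \<in> Basis" and \<phi>: "continuous_on UNIV \<phi>"
    and inv: "\<And>x s. \<phi> (x + s *\<^sub>R e) = \<phi> x" and A: "A \<in> sets borel"
  shows "emeasure lborel ((\<lambda>x. x + \<phi> x *\<^sub>R e) -` A) = emeasure lborel A"
proof -
  interpret product_sigma_finite "\<lambda>_::'a. lborel :: real measure" by standard
  define T where "T x = x + \<phi> x *\<^sub>R e" for x
  have T[measurable]: "T \<in> borel_measurable borel"
    unfolding T_def by (intro borel_measurable_continuous_onI continuous_intros \<phi>)
  define S where "S f = (\<Sum>b\<in>Basis. f b *\<^sub>R b)" for f :: "'a \<Rightarrow> real"
  have S[measurable]: "S \<in> borel_measurable (\<Pi>\<^sub>M b\<in>Basis. lborel)"
    unfolding S_def by measurable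
  let ?J = "Basis - {e}"
  have Bi: "insert e ?J = Basis" using e by auto
  have upd: "S (x(e := y)) = S (x(e := 0)) + y *\<^sub>R e" for x y
  proof -
    have "S (x(e := y)) = y *\<^sub>R e + (\<Sum>b\<in>?J. x b *\<^sub>R b)" for y
      unfolding S_def by (subst sum.remove[OF _ e]) (auto intro!: sum.cong)
    then show ?thesis by simp
  qed
  have lb: "lborel = distr (\<Pi>\<^sub>M b\<in>Basis. lborel) borel S"
    using lborel_eq unfolding S_def[abs_def] .
  have key: "emeasure lborel B = (\<integral>\<^sup>+x. \<integral>\<^sup>+y. indicator B (S (x(e := 0)) + y *\<^sub>R e) \<partial>lborel \<partial>(\<Pi>\<^sub>M b\<in>?J. lborel))"
    if B[measurable]: "B \<in> sets borel" for B
  proof -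
    have "emeasure lborel B = (\<integral>\<^sup>+x. indicator B x \<partial>lborel)" using B by simp
    also have "\<dots> = (\<integral>\<^sup>+x. indicator B (S x) \<partial>(\<Pi>\<^sub>M b\<in>Basis. lborel))"
      unfolding lb by (rule nn_integral_distr[OF S]) simp
    also have "\<dots> = (\<integral>\<^sup>+x. indicator B (S x) \<partial>(\<Pi>\<^sub>M b\<in>insert e ?J. lborel))"
      unfolding Bi ..
    also have "\<dots> = (\<integral>\<^sup>+x. \<integral>\<^sup>+y. indicator B (S (x(e := y))) \<partial>lborel \<partial>(\<Pi>\<^sub>M b\<in>?J. lborel))"
      by (rule product_nn_integral_insert) (auto simp: Bi insert_absorb[OF e])
    also have "\<dots> = (\<integral>\<^sup>+x. \<integral>\<^sup>+y. indicator B (S (x(e := 0)) + y *\<^sub>R e) \<partial>lborel \<partial>(\<Pi>\<^sub>M b\<in>?J. lborel))"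
      by (intro nn_integral_cong arg_cong[where f = "indicator B"] upd)
    finally show ?thesis .
  qed
  \<comment> \<open>\<open>\<phi>\<close> is constant along \<open>e\<close>, so on each line
    parallel to \<open>e\<close> the shear is a translation. The factor in \<open>1 * y\<close>
    matches the affine substitution rule used below.\<close>
  have Teq: "T (z + y *\<^sub>R e) = z + (\<phi> z + 1 * y) *\<^sub>R e" for z y
    by (simp add: T_def inv scaleR_add_left)
  have ind: "indicator (T -` A) u = (indicator A (T u) :: ennreal)" for u
    by (simp add: indicator_def)
  have TA: "T -` A \<in> sets borel" using measurable_sets[OF T A] by simp
  have "emeasure lborel (T -` A) =
     (\<integral>\<^sup>+x. \<integral>\<^sup>+y. indicator A (S (x(e := 0)) + (\<phi> (S (x(e := 0))) + 1 * y) *\<^sub>R e) \<partial>lborel \<partial>(\<Pi>\<^sub>M b\<in>?J. lborel))"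
    unfolding key[OF TA] ind Teq ..
  also have "\<dots> = (\<integral>\<^sup>+x. \<integral>\<^sup>+y. indicator A (S (x(e := 0)) + y *\<^sub>R e) \<partial>lborel \<partial>(\<Pi>\<^sub>M b\<in>?J. lborel))"
  proof (rule nn_integral_cong)
    fix x
    have [measurable]: "(\<lambda>y::real. S (x(e := 0)) + y *\<^sub>R e) \<in> borel_measurable borel"
      by (intro borel_measurable_continuous_onI continuous_intros)
    note A[measurable]
    have m: "(\<lambda>y::real. indicator A (S (x(e := 0)) + y *\<^sub>R e) :: ennreal) \<in> borel_measurable borel"
      by measurable
    show "(\<integral>\<^sup>+y. indicator A (S (x(e := 0)) + (\<phi> (S (x(e := 0))) + 1 * y) *\<^sub>R e) \<partial>lborel) =
      (\<integral>\<^sup>+y. indicator A (S (x(e := 0)) + y *\<^sub>R e) \<partial>lborel)"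
      using nn_integral_real_affine[OF m, of 1 "\<phi> (S (x(e := 0)))"] by simp
  qed
  also have "\<dots> = emeasure lborel A" by (rule key[OF A, symmetric])
  finally show ?thesis unfolding T_def[abs_def] .
qed

text \<open>A shear is undone by the shear with \<open>- \<phi>\<close>, because
  \<open>\<phi>\<close> does not change along \<open>e\<close>; images are thus preimages under
  another shear.\<close>

lemma emeasure_lborel_shear_image:
  fixes \<phi> :: "'a::euclidean_space \<Rightarrow> real"
  assumes e: "e \<in> Basis" and \<phi>: "continuous_on UNIV \<phi>"
    and inv: "\<And>x s. \<phi> (x + s *\<^sub>R e) = \<phi> x" and A: "A \<in> sets borel"
  shows "emeasure lborel ((\<lambda>x. x + \<phi> x *\<^sub>R e) ` A) = emeasure lborel A"
proof -
  have "(\<lambda>x. x + \<phi> x *\<^sub>R e) ` A = (\<lambda>x. x + (- \<phi> x) *\<^sub>R e) -` A"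
  proof (intro equalityI subsetI)
    fix y assume "y \<in> (\<lambda>x. x + (- \<phi> x) *\<^sub>R e) -` A"
    then show "y \<in> (\<lambda>x. x + \<phi> x *\<^sub>R e) ` A"
      using inv[of y "- \<phi> y"] by (intro image_eqI[of _ _ "y + (- \<phi> y) *\<^sub>R e"]) auto
  qed (auto simp: inv)
  also have "emeasure lborel \<dots> = emeasure lborel A"
    by (rule emeasure_lborel_shear_vimage[OF e _ _ A]) (auto intro!: continuous_intros \<phi> simp: inv)
  finally show ?thesis .
qed

section \<open>Consistent one-step methods\<close>

definition local_lipschitz :: "('a::real_normed_vector \<Rightarrow> 'a) \<Rightarrow> bool"
  where "local_lipschitz v \<longleftrightarrow>
    (\<forall>r. \<exists>L\<ge>0. \<forall>x y. norm x \<le> r \<longrightarrow> norm y \<le> r \<longrightarrow> norm (v x - v y) \<le> L * norm (x - y))"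

text \<open>First-order consistency as in numerical analysis, locally uniform in the point. Steps
  \<open>h\<close> of either sign are covered, so flows run backwards can be composed as
  well.\<close>

definition one_step_method :: "(real \<Rightarrow> 'a \<Rightarrow> 'a) \<Rightarrow> ('a::real_normed_vector \<Rightarrow> 'a) \<Rightarrow> bool"
  where "one_step_method P v \<longleftrightarrow> (\<forall>r. \<exists>C\<ge>0. \<exists>\<eta>>0. \<forall>x h. norm x \<le> r \<longrightarrow> \<bar>h\<bar> \<le> \<eta> \<longrightarrow>
    norm (P h x - x - h *\<^sub>R v x) \<le> C * h\<^sup>2)"

lemma local_lipschitz_bound:
  assumes "local_lipschitz v"
  obtains V where "0 \<le> V" "\<And>x. norm x \<le> r \<Longrightarrow> norm (v x) \<le> V"
proof -
  obtain L where L: "L \<ge> 0" "\<And>x y. norm x \<le> \<bar>r\<bar> \<Longrightarrow> norm y \<le> \<bar>r\<bar> \<Longrightarrow> norm (v x - v y) \<le> L * norm (x - y)"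
    using assms unfolding local_lipschitz_def by blast
  have "norm (v x) \<le> norm (v 0) + L * \<bar>r\<bar>" if "norm x \<le> r" for x
  proof -
    have "norm (v x) \<le> norm (v 0) + norm (v x - v 0)" using norm_triangle_ineq[of "v 0" "v x - v 0"] by simp
    also have "norm (v x - v 0) \<le> L * norm (x - 0)" using L(2)[of x 0] that by auto
    also have "L * norm (x - 0) \<le> L * \<bar>r\<bar>" using that L(1) by (intro mult_left_mono) auto
    finally show ?thesis by simp
  qed
  then show ?thesis using L(1) by (intro that[of "norm (v 0) + L * \<bar>r\<bar>"]) auto
qed

lemma local_lipschitz_add:
  assumes "local_lipschitz v" "local_lipschitz w"
  shows "local_lipschitz (\<lambda>x. v x + w x)"
  unfolding local_lipschitz_def
proof
  fix r
  obtain L where L: "L \<ge> 0" "\<And>x y. norm x \<le> r \<Longrightarrow> norm y \<le> r \<Longrightarrow> norm (v x - v y) \<le> L * norm (x - y)"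
    using assms unfolding local_lipschitz_def by blast
  obtain L' where L': "L' \<ge> 0" "\<And>x y. norm x \<le> r \<Longrightarrow> norm y \<le> r \<Longrightarrow> norm (w x - w y) \<le> L' * norm (x - y)"
    using assms unfolding local_lipschitz_def by blast
  have "norm (v x + w x - (v y + w y)) \<le> (L + L') * norm (x - y)" if "norm x \<le> r" "norm y \<le> r" for x y
    using norm_triangle_ineq[of "v x - v y" "w x - w y"] L(2)[OF that] L'(2)[OF that] by (simp add: algebra_simps)
  then show "\<exists>L\<ge>0. \<forall>x y. norm x \<le> r \<longrightarrow> norm y \<le> r \<longrightarrow> norm (v x + w x - (v y + w y)) \<le> L * norm (x - y)"
    using L(1) L'(1) by (intro exI[of _ "L + L'"]) auto
qed

lemma local_lipschitz_linear:
  assumes "local_lipschitz v" "bounded_linear A"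
  shows "local_lipschitz (\<lambda>x. A (v x))"
  unfolding local_lipschitz_def
proof
  fix r
  obtain L where L: "L \<ge> 0" "\<And>x y. norm x \<le> r \<Longrightarrow> norm y \<le> r \<Longrightarrow> norm (v x - v y) \<le> L * norm (x - y)"
    using assms unfolding local_lipschitz_def by blast
  have "norm (A (v x) - A (v y)) \<le> (onorm A * L) * norm (x - y)" if "norm x \<le> r" "norm y \<le> r" for x y
  proof -
    have "norm (A (v x) - A (v y)) = norm (A (v x - v y))"
      by (simp add: linear_diff[OF bounded_linear.linear[OF assms(2)]])
    also have "\<dots> \<le> onorm A * norm (v x - v y)" by (rule onorm[OF assms(2)])
    also have "\<dots> \<le> onorm A * (L * norm (x - y))"
      using L(2)[OF that] onorm_pos_le[OF assms(2)] by (intro mult_left_mono) auto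
    finally show ?thesis by (simp add: mult_ac)
  qed
  then show "\<exists>L\<ge>0. \<forall>x y. norm x \<le> r \<longrightarrow> norm y \<le> r \<longrightarrow> norm (A (v x) - A (v y)) \<le> L * norm (x - y)"
    using L(1) onorm_pos_le[OF assms(2)] by (intro exI[of _ "onorm A * L"]) auto
qed

lemma local_lipschitz_const: "local_lipschitz (\<lambda>x. w)"
  unfolding local_lipschitz_def by (auto intro!: exI[of _ 0])

lemma local_lipschitz_translate:
  assumes "local_lipschitz v"
  shows "local_lipschitz (\<lambda>x. v (x + w))"
  unfolding local_lipschitz_def
proof
  fix r
  obtain L where L: "L \<ge> 0" "\<And>x y. norm x \<le> r + norm w \<Longrightarrow> norm y \<le> r + norm w \<Longrightarrow> norm (v x - v y) \<le> L * norm (x - y)"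
    using assms unfolding local_lipschitz_def by blast
  have "norm (v (x + w) - v (y + w)) \<le> L * norm (x - y)" if "norm x \<le> r" "norm y \<le> r" for x y
    using L(2)[of "x + w" "y + w"] that norm_triangle_ineq[of x w] norm_triangle_ineq[of y w] by simp
  then show "\<exists>L\<ge>0. \<forall>x y. norm x \<le> r \<longrightarrow> norm y \<le> r \<longrightarrow> norm (v (x + w) - v (y + w)) \<le> L * norm (x - y)"
    using L(1) by blast
qed

text \<open>The consistency half of the Lie product formula. The second method sees the field
  \<open>w\<close> at a point moved by a multiple of \<open>\<bar>h\<bar>\<close>; by the Lipschitz
  bound this costs another term quadratic in \<open>h\<close>.\<close>

lemma one_step_method_compose:
  assumes P: "one_step_method P v" and Q: "one_step_method Q w"
    and v: "local_lipschitz v" and w: "local_lipschitz w"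
  shows "one_step_method (\<lambda>h x. Q h (P h x)) (\<lambda>x. v x + w x)"
  unfolding one_step_method_def
proof
  fix r
  obtain C \<eta> where C: "C \<ge> 0" "\<eta> > 0" "\<And>x h. norm x \<le> r \<Longrightarrow> \<bar>h\<bar> \<le> \<eta> \<Longrightarrow> norm (P h x - x - h *\<^sub>R v x) \<le> C * h\<^sup>2"
    using P unfolding one_step_method_def by blast
  obtain V where V: "V \<ge> 0" "\<And>x. norm x \<le> r \<Longrightarrow> norm (v x) \<le> V"
    using local_lipschitz_bound[OF v] by blast
  define r' where "r' = r + V + C"
  obtain C' \<eta>' where C': "C' \<ge> 0" "\<eta>' > 0" "\<And>x h. norm x \<le> r' \<Longrightarrow> \<bar>h\<bar> \<le> \<eta>' \<Longrightarrow> norm (Q h x - x - h *\<^sub>R w x) \<le> C' * h\<^sup>2"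
    using Q unfolding one_step_method_def by blast
  obtain L where L: "L \<ge> 0" "\<And>x y. norm x \<le> r' \<Longrightarrow> norm y \<le> r' \<Longrightarrow> norm (w x - w y) \<le> L * norm (x - y)"
    using w unfolding local_lipschitz_def by blast
  have "norm (Q h (P h x) - x - h *\<^sub>R (v x + w x)) \<le> (C' + L * (V + C) + C) * h\<^sup>2"
    if x: "norm x \<le> r" and h: "\<bar>h\<bar> \<le> min 1 (min \<eta> \<eta>')" for x h
  proof -
    have h1: "\<bar>h\<bar> \<le> 1" "\<bar>h\<bar> \<le> \<eta>" "\<bar>h\<bar> \<le> \<eta>'" using h by auto
    have hh: "h\<^sup>2 \<le> \<bar>h\<bar>" using h1(1) by (metis abs_ge_zero mult_left_le power2_abs power2_eq_square)
    have a: "norm (P h x - x - h *\<^sub>R v x) \<le> C * h\<^sup>2" using C x h1 by blast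
    have "norm (P h x - x) \<le> norm (P h x - x - h *\<^sub>R v x) + norm (h *\<^sub>R v x)"
      using norm_triangle_ineq[of "P h x - x - h *\<^sub>R v x" "h *\<^sub>R v x"] by simp
    also have "\<dots> \<le> C * \<bar>h\<bar> + \<bar>h\<bar> * V"
    proof (rule add_mono)
      show "norm (P h x - x - h *\<^sub>R v x) \<le> C * \<bar>h\<bar>"
        using a mult_left_mono[OF hh C(1)] by linarith
      show "norm (h *\<^sub>R v x) \<le> \<bar>h\<bar> * V" using V(2)[OF x] by (simp add: mult_left_mono)
    qed
    finally have Pd: "norm (P h x - x) \<le> (V + C) * \<bar>h\<bar>" by (simp add: algebra_simps)
    also have "\<dots> \<le> (V + C) * 1" using h1 V(1) C(1) by (intro mult_left_mono) auto
    finally have Pr: "norm (P h x) \<le> r'"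
      using norm_triangle_ineq[of x "P h x - x"] x by (simp add: r'_def)
    have xr: "norm x \<le> r'" using x V(1) C(1) by (simp add: r'_def)
    have b: "norm (Q h (P h x) - P h x - h *\<^sub>R w (P h x)) \<le> C' * h\<^sup>2" using C'(3)[OF Pr h1(3)] .
    have c: "norm (h *\<^sub>R (w (P h x) - w x)) \<le> L * (V + C) * h\<^sup>2"
    proof -
      have "norm (h *\<^sub>R (w (P h x) - w x)) \<le> \<bar>h\<bar> * (L * norm (P h x - x))"
        using L(2)[OF Pr xr] by (simp add: mult_left_mono)
      also have "\<dots> \<le> \<bar>h\<bar> * (L * ((V + C) * \<bar>h\<bar>))"
        using Pd L(1) by (intro mult_left_mono) auto
      also have "\<dots> = L * (V + C) * (\<bar>h\<bar> * \<bar>h\<bar>)" by simp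
      finally show ?thesis by (simp only: abs_mult_self_eq power2_eq_square)
    qed
    have "Q h (P h x) - x - h *\<^sub>R (v x + w x) = (Q h (P h x) - P h x - h *\<^sub>R w (P h x))
        + (h *\<^sub>R (w (P h x) - w x)) + (P h x - x - h *\<^sub>R v x)"
      by (simp add: algebra_simps)
    also have "norm \<dots> \<le> C' * h\<^sup>2 + L * (V + C) * h\<^sup>2 + C * h\<^sup>2"
      by (intro order_trans[OF norm_triangle_ineq] add_mono a b c)
    finally show ?thesis by (simp add: algebra_simps)
  qed
  moreover have "0 \<le> C' + L * (V + C) + C" using C(1) C'(1) V(1) L(1) by simp
  ultimately show "\<exists>C\<ge>0. \<exists>\<eta>>0. \<forall>x h. norm x \<le> r \<longrightarrow> \<bar>h\<bar> \<le> \<eta> \<longrightarrow>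
      norm (Q h (P h x) - x - h *\<^sub>R (v x + w x)) \<le> C * h\<^sup>2"
    using C(2) C'(2) by (intro exI[of _ "C' + L * (V + C) + C"] conjI exI[of _ "min 1 (min \<eta> \<eta>')"]) auto
qed

lemma one_step_method_rescale:
  assumes "one_step_method P v"
  shows "one_step_method (\<lambda>h. P (a * h)) (\<lambda>x. a *\<^sub>R v x)"
  unfolding one_step_method_def
proof
  fix r
  obtain C \<eta> where C: "C \<ge> 0" "\<eta> > 0" "\<And>x h. norm x \<le> r \<Longrightarrow> \<bar>h\<bar> \<le> \<eta> \<Longrightarrow> norm (P h x - x - h *\<^sub>R v x) \<le> C * h\<^sup>2"
    using assms unfolding one_step_method_def by blast
  have "norm (P (a * h) x - x - h *\<^sub>R a *\<^sub>R v x) \<le> (C * a\<^sup>2) * h\<^sup>2" if "norm x \<le> r" "\<bar>h\<bar> \<le> \<eta> / (\<bar>a\<bar> + 1)" for x h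
  proof -
    have "\<bar>a * h\<bar> \<le> (\<bar>a\<bar> + 1) * \<bar>h\<bar>" by (simp add: abs_mult mult_right_mono)
    also have "\<dots> \<le> (\<bar>a\<bar> + 1) * (\<eta> / (\<bar>a\<bar> + 1))" using that by (intro mult_left_mono) auto
    also have "\<dots> = \<eta>" by (simp add: add_nonneg_eq_0_iff)
    finally show ?thesis using C(3)[OF that(1), of "a * h"] by (simp add: power_mult_distrib mult_ac)
  qed
  then show "\<exists>C\<ge>0. \<exists>\<eta>>0. \<forall>x h. norm x \<le> r \<longrightarrow> \<bar>h\<bar> \<le> \<eta> \<longrightarrow> norm (P (a * h) x - x - h *\<^sub>R a *\<^sub>R v x) \<le> C * h\<^sup>2"
    using C by (intro exI[of _ "C * a\<^sup>2"] conjI exI[of _ "\<eta> / (\<bar>a\<bar> + 1)"]) auto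
qed

lemma one_step_method_translate:
  assumes "one_step_method P v"
  shows "one_step_method (\<lambda>h x. P h (x + w) - w) (\<lambda>x. v (x + w))"
  unfolding one_step_method_def
proof
  fix r
  obtain C \<eta> where C: "C \<ge> 0" "\<eta> > 0" "\<And>x h. norm x \<le> r + norm w \<Longrightarrow> \<bar>h\<bar> \<le> \<eta> \<Longrightarrow> norm (P h x - x - h *\<^sub>R v x) \<le> C * h\<^sup>2"
    using assms unfolding one_step_method_def by blast
  have "norm (P h (x + w) - w - x - h *\<^sub>R v (x + w)) \<le> C * h\<^sup>2" if "norm x \<le> r" "\<bar>h\<bar> \<le> \<eta>" for x h
    using C(3)[of "x + w" h] that norm_triangle_ineq[of x w] by (simp add: algebra_simps)
  then show "\<exists>C\<ge>0. \<exists>\<eta>>0. \<forall>x h. norm x \<le> r \<longrightarrow> \<bar>h\<bar> \<le> \<eta> \<longrightarrow> norm (P h (x + w) - w - x - h *\<^sub>R v (x + w)) \<le> C * h\<^sup>2"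
    using C by blast
qed

text \<open>\<open>n\<close> steps of length \<open>s / n\<close> accumulate an error of at most
  \<open>C * s\<^sup>2 / n\<close>, so points of \<open>K\<close> come arbitrarily near
  \<open>x + s *\<^sub>R w\<close>.\<close>

lemma closed_invariant_translation:
  assumes P: "one_step_method P (\<lambda>_. w)" and K: "closed K"
    and inv: "\<And>h x. 0 \<le> h \<Longrightarrow> x \<in> K \<Longrightarrow> P h x \<in> K" and x: "x \<in> K" and s: "0 \<le> s"
  shows "x + s *\<^sub>R w \<in> K"
proof -
  define r where "r = norm x + s * norm w + 1"
  obtain C \<eta> where C: "C \<ge> 0" "\<eta> > 0" "\<And>x h. norm x \<le> r \<Longrightarrow> \<bar>h\<bar> \<le> \<eta> \<Longrightarrow> norm (P h x - x - h *\<^sub>R w) \<le> C * h\<^sup>2"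
    using P unfolding one_step_method_def by blast
  have "x + s *\<^sub>R w \<in> closure K"
    unfolding closure_approachable
  proof (intro allI impI)
    fix \<epsilon> :: real assume \<epsilon>: "\<epsilon> > 0"
    obtain n :: nat where n: "real n > max (s / \<eta>) (max (C * s\<^sup>2) (C * s\<^sup>2 / \<epsilon>))" using reals_Archimedean2 by blast
    define h where "h = s / n"
    have n0: "real n > 0" using n s C by (smt (verit) divide_nonneg_pos)
    have h: "0 \<le> h" "h \<le> \<eta>" "C * s * h \<le> 1" "C * s * h < \<epsilon>"
      using n n0 s C \<epsilon> by (auto simp: h_def field_simps power2_eq_square)
    have "\<exists>y\<in>K. norm (y - x - (real j * h) *\<^sub>R w) \<le> real j * (C * h\<^sup>2)" if "j \<le> n" for j
      using that
    proof (induction j)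
      case 0
      then show ?case using x by (intro bexI[of _ x]) auto
    next
      case (Suc j)
      then obtain y where y: "y \<in> K" "norm (y - x - (real j * h) *\<^sub>R w) \<le> real j * (C * h\<^sup>2)" by auto
      have jn: "real j * h \<le> s"
      proof -
        have "real j * h \<le> real n * h" using Suc.prems h(1) by (intro mult_right_mono) auto
        also have "\<dots> = s" using n0 by (simp add: h_def)
        finally show ?thesis .
      qed
      have "norm y \<le> r"
      proof -
        have "norm y \<le> norm (y - x - (real j * h) *\<^sub>R w) + norm (x + (real j * h) *\<^sub>R w)"
          using norm_triangle_ineq[of "y - x - (real j * h) *\<^sub>R w" "x + (real j * h) *\<^sub>R w"] by simp
        also have "\<dots> \<le> real j * (C * h\<^sup>2) + (norm x + norm ((real j * h) *\<^sub>R w))"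
          by (intro add_mono y norm_triangle_ineq)
        also have "real j * (C * h\<^sup>2) = (real j * h) * (C * h)" by (simp add: power2_eq_square)
        also have "\<dots> \<le> s * (C * h)" using jn C(1) h(1) by (intro mult_right_mono) auto
        also have "\<dots> \<le> 1" using h(3) by (simp add: mult_ac)
        also have "norm ((real j * h) *\<^sub>R w) \<le> s * norm w" using jn h(1) by (simp add: mult_right_mono)
        finally show ?thesis by (simp add: r_def)
      qed
      then have "norm (P h y - y - h *\<^sub>R w) \<le> C * h\<^sup>2" using C(3) h by simp
      moreover have split: "P h y - x - (real (Suc j) * h) *\<^sub>R w = (P h y - y - h *\<^sub>R w) + (y - x - (real j * h) *\<^sub>R w)"
        by (simp add: algebra_simps)
      ultimately have "norm (P h y - x - (real (Suc j) * h) *\<^sub>R w) \<le> C * h\<^sup>2 + real j * (C * h\<^sup>2)"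
        unfolding split by (intro norm_triangle_le add_mono y(2))
      then show ?case using inv[OF h(1) y(1)] by (intro bexI[of _ "P h y"]) (auto simp: algebra_simps)
    qed
    from this[of n] obtain y where y: "y \<in> K" "norm (y - x - (real n * h) *\<^sub>R w) \<le> real n * (C * h\<^sup>2)" by auto
    have nh: "real n * h = s" using n0 by (simp add: h_def)
    have "real n * (C * h\<^sup>2) = C * s * h" unfolding nh[symmetric] by (simp add: power2_eq_square)
    then have "norm (y - x - s *\<^sub>R w) < \<epsilon>" using y(2) h(4) unfolding nh by linarith
    then show "\<exists>y\<in>K. dist y (x + s *\<^sub>R w) < \<epsilon>"
      using y(1) by (intro bexI[of _ y]) (auto simp: dist_norm diff_diff_eq)
  qed
  then show ?thesis using K by simp
qed

section \<open>Quadratic control systems with conserved energy\<close>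

text \<open>Polynomial vector fields as syntax: derivatives stay inside the class, and identities
  between them can be proved by induction. \<open>Prod\<close> will be interpreted by the bilinear
  drift.\<close>

datatype 'a pexp = Ident | Const 'a | Plus "'a pexp" "'a pexp" | Scale real "'a pexp" | Prod "'a pexp" "'a pexp"

text \<open>The direction is itself an expression, so this is the derivative along a vector field.
  The inner direction of an iterated derivative may therefore vary with the point, as Lie brackets
  require.\<close>

primrec pderiv :: "'a::real_vector pexp \<Rightarrow> 'a pexp \<Rightarrow> 'a pexp" where
  "pderiv Ident d = d"
| "pderiv (Const w) d = Const 0"
| "pderiv (Plus p q) d = Plus (pderiv p d) (pderiv q d)"
| "pderiv (Scale r p) d = Scale r (pderiv p d)"
| "pderiv (Prod p q) d = Plus (Prod (pderiv p d) q) (Prod p (pderiv q d))"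

text \<open>Domain and codomain have the same dimension, so a direction missing from the range
  leaves a kernel direction \<open>k\<close>, which can be spent on \<open>v\<close>. The rank of a
  parametrised family thus rises without adding parameters.\<close>

lemma linear_range_insert:
  fixes h :: "'a::euclidean_space \<Rightarrow> 'a"
  assumes h: "linear h" and v: "v \<notin> range h"
  obtains k where "h k = 0" "dim (range (\<lambda>s. h s + (k \<bullet> s) *\<^sub>R v)) > dim (range h)"
proof -
  have "\<not> surj h" using v by auto
  then have "\<not> inj h" using linear_injective_imp_surjective[OF h] by blast
  then obtain k where k: "h k = 0" "k \<noteq> 0" using linear_injective_0[OF h] by blast
  have sub: "subspace (range h)" by (rule linear_subspace_image[OF h subspace_UNIV])
  let ?h = "\<lambda>s. h s + (k \<bullet> s) *\<^sub>R v"
  have "insert v (range h) \<subseteq> range ?h"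
  proof
    fix z assume "z \<in> insert v (range h)"
    then consider "z = v" | a where "z = h a" by auto
    then show "z \<in> range ?h"
    proof cases
      case 1
      have "?h ((1 / (k \<bullet> k)) *\<^sub>R k) = z"
        using k by (simp add: linear_scale[OF h] 1)
      then show ?thesis by (rule range_eqI[OF sym])
    next
      case 2
      have "?h (a - ((k \<bullet> a) / (k \<bullet> k)) *\<^sub>R k) = z"
        using k by (simp add: linear_diff[OF h] linear_scale[OF h] 2 inner_diff_right)
      then show ?thesis by (rule range_eqI[OF sym])
    qed
  qed
  then have "dim (insert v (range h)) \<le> dim (range ?h)" by (rule dim_subset)
  moreover have "dim (insert v (range h)) = dim (range h) + 1"
    using v span_eq_iff[THEN iffD2, OF sub] by (simp only: dim_insert) simp
  ultimately show ?thesis using that k by auto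
qed

lemma difference_quotient_tendsto:
  assumes "(q has_vector_derivative w) (at 0 within S)"
  shows "((\<lambda>t. (1 / t) *\<^sub>R (q t - q 0)) \<longlongrightarrow> w) (at (0::real) within S)"
proof -
  have "((\<lambda>t. norm ((1 / norm (t - 0)) *\<^sub>R (q t - (q 0 + (t - 0) *\<^sub>R w)))) \<longlongrightarrow> 0) (at 0 within S)"
    by (rule tendsto_norm_zero[OF conjunct2[OF assms[unfolded has_vector_derivative_def has_derivative_within]]])
  moreover have "\<forall>\<^sub>F t in at 0 within S. norm ((1 / norm (t - 0)) *\<^sub>R (q t - (q 0 + (t - 0) *\<^sub>R w)))
      = norm ((1 / t) *\<^sub>R (q t - q 0) - w)"
    unfolding eventually_at_filter
  proof (intro always_eventually allI impI)
    fix t :: real assume t: "t \<noteq> 0"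
    then have "(1 / t) *\<^sub>R (q t - q 0) - w = (1 / t) *\<^sub>R (q t - (q 0 + (t - 0) *\<^sub>R w))"
      by (simp add: algebra_simps)
    then show "norm ((1 / norm (t - 0)) *\<^sub>R (q t - (q 0 + (t - 0) *\<^sub>R w))) = norm ((1 / t) *\<^sub>R (q t - q 0) - w)"
      by simp
  qed
  ultimately have "((\<lambda>t. norm ((1 / t) *\<^sub>R (q t - q 0) - w)) \<longlongrightarrow> 0) (at 0 within S)"
    by (rule Lim_transform_eventually)
  then show ?thesis by (simp add: tendsto_norm_zero_iff LIM_zero_iff)
qed

text \<open>\<open>B\<close> is the polarised drift, \<open>M\<close> the inertia operator, and
  \<open>x \<bullet> M x\<close> twice the kinetic energy up to normalisation. \<open>N\<close>
  collects the directions of free jumps. \<open>shear\<close> says that the component of the drift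
  along a basis vector ignores that coordinate. \<open>generating\<close> is the algebraic rank
  condition; it mentions squares only, since polarisation recovers products.\<close>

locale quadratic_system =
  fixes B :: "'v::euclidean_space \<Rightarrow> 'v \<Rightarrow> 'v"
    and M :: "'v \<Rightarrow> 'v" and m :: real and N :: "'v set" and g :: 'v and b :: real
  assumes bil: "bounded_bilinear B" and B_sym: "B x y = B y x"
    and M_lin: "bounded_linear M" and M_sym: "x \<bullet> M y = M x \<bullet> y"
    and m_pos: "0 < m" and M_pos: "m * (x \<bullet> x) \<le> x \<bullet> M x"
    and conserved: "M x \<bullet> B x x = 0"
    and shear: "e \<in> Basis \<Longrightarrow> B (x + s *\<^sub>R e) (x + s *\<^sub>R e) \<bullet> e = B x x \<bullet> e"
    and N_sub: "subspace N"
    and b_pos: "0 < b"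
    and generating: "subspace S \<Longrightarrow> N \<subseteq> S \<Longrightarrow> g \<in> S \<Longrightarrow> (\<And>w. w \<in> S \<Longrightarrow> B w w \<in> S) \<Longrightarrow> S = UNIV"
begin

interpretation B: bounded_bilinear B by (rule bil)
interpretation M: bounded_linear M by (rule M_lin)

section \<open>Drift and energy estimates\<close>

definition f :: "'v \<Rightarrow> 'v" where "f x = B x x"

definition energy :: "'v \<Rightarrow> real" where "energy x = x \<bullet> M x"

lemma f_minus: "f (- x) = f x"
  by (simp add: f_def B.minus_left B.minus_right)

lemma f_scale: "f (r *\<^sub>R x) = (r * r) *\<^sub>R f x"
  by (simp add: f_def B.scaleR_left B.scaleR_right)

lemma f_add: "f (x + y) = f x + 2 *\<^sub>R B x y + f y"
  by (simp add: f_def B.add_left B.add_right B_sym[of y x] scaleR_2)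

lemma f_diff: "f x - f y = B (x + y) (x - y)"
  by (simp add: f_def B.add_left B.diff_right B_sym[of y x])

definition KB :: real where "KB = (SOME K. 0 < K \<and> (\<forall>x y. norm (B x y) \<le> norm x * norm y * K))"

lemma KB: "0 < KB" "norm (B x y) \<le> norm x * norm y * KB"
  using someI_ex[OF B.pos_bounded] unfolding KB_def by blast+

lemma f_lip:
  assumes "norm x \<le> r" "norm y \<le> r"
  shows "norm (f x - f y) \<le> (2 * r * KB) * norm (x - y)"
proof -
  have "norm (f x - f y) \<le> norm (x + y) * norm (x - y) * KB"
    unfolding f_diff by (rule KB)
  also have "\<dots> \<le> (2 * r) * norm (x - y) * KB"
    using assms KB(1) norm_triangle_ineq[of x y] by (intro mult_right_mono) auto
  finally show ?thesis by (simp add: mult_ac)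
qed

lemma f_bound:
  assumes "norm x \<le> r"
  shows "norm (f x) \<le> r * r * KB"
proof -
  have "0 \<le> r" using assms norm_ge_zero order_trans by blast
  then show ?thesis
    unfolding f_def using assms KB(1) by (intro order_trans[OF KB(2)] mult_mono) auto
qed

lemma f_has_derivative: "(f has_derivative (\<lambda>h. 2 *\<^sub>R B x h)) (at x within S)"
  unfolding f_def using B.FDERIV[OF has_derivative_ident has_derivative_ident, of x S]
  by (simp add: B_sym[of _ x] scaleR_2)

lemma continuous_on_f: "continuous_on S f"
  by (rule has_derivative_continuous_on) (rule f_has_derivative)

lemma energy_lower: "m * (norm x)\<^sup>2 \<le> energy x"
  using M_pos[of x] by (simp add: energy_def power2_norm_eq_inner)

lemma energy_nonneg: "0 \<le> energy x"
  using energy_lower[of x] m_pos by (intro order_trans[OF _ energy_lower]) simp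

lemma energy_derivative:
  assumes "(X has_vector_derivative v) (at t within S)"
  shows "((\<lambda>s. energy (X s)) has_real_derivative 2 * (M (X t) \<bullet> v)) (at t within S)"
proof -
  have "((\<lambda>s. X s \<bullet> M (X s)) has_derivative (\<lambda>h. X t \<bullet> M (h *\<^sub>R v) + (h *\<^sub>R v) \<bullet> M (X t))) (at t within S)"
    using assms unfolding has_vector_derivative_def
    by (intro has_derivative_inner M.has_derivative)
  moreover have "X t \<bullet> M (h *\<^sub>R v) + (h *\<^sub>R v) \<bullet> M (X t) = 2 * (M (X t) \<bullet> v) * h" for h
    by (simp add: M.scaleR M_sym inner_commute)
  ultimately show ?thesis
    unfolding has_field_derivative_def energy_def by simp
qed

text \<open>The drift does no work, and the control \<open>c\<close> changes the energy at the rate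
  \<open>2 * c * (M x \<bullet> g)\<close>, which is at most \<open>kE c * norm x\<close>.\<close>

definition kE :: "real \<Rightarrow> real"
  where "kE c = 2 * \<bar>c\<bar> * onorm M * norm g"

lemma kE_nonneg: "0 \<le> kE c"
  by (simp add: kE_def onorm_pos_le[OF M_lin])

lemma kE_mono: "\<bar>c\<bar> \<le> d \<Longrightarrow> kE c \<le> kE d"
  unfolding kE_def using onorm_pos_le[OF M_lin] by (intro mult_right_mono) auto

text \<open>A field that rescales the drift by a scalar factor has the same energy balance, so that cutting off
  the drift radially does not affect this a priori bound.\<close>

lemma energy_bound:
  assumes X: "\<And>t. (X has_vector_derivative (r t *\<^sub>R f (X t) + c *\<^sub>R g)) (at t)" and t: "0 \<le> t"
  shows "energy (X t) \<le> (energy (X 0) + kE c * t) * exp (kE c / m * t)"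
proof (rule gronwall[where T = t])
  fix s
  show "((\<lambda>s. energy (X s)) has_real_derivative 2 * (M (X s) \<bullet> (r s *\<^sub>R f (X s) + c *\<^sub>R g))) (at s)"
    by (rule energy_derivative[OF X])
  have "2 * (M (X s) \<bullet> (r s *\<^sub>R f (X s) + c *\<^sub>R g)) = 2 * c * (M (X s) \<bullet> g)"
    by (simp add: inner_add_right f_def conserved)
  also have "\<dots> \<le> 2 * \<bar>c\<bar> * (onorm M * norm (X s) * norm g)"
  proof -
    have "\<bar>M (X s) \<bullet> g\<bar> \<le> norm (M (X s)) * norm g" by (rule Cauchy_Schwarz_ineq2)
    also have "\<dots> \<le> onorm M * norm (X s) * norm g" by (intro mult_right_mono onorm M_lin) auto
    finally have "\<bar>c\<bar> * \<bar>M (X s) \<bullet> g\<bar> \<le> \<bar>c\<bar> * (onorm M * norm (X s) * norm g)"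
      by (intro mult_left_mono) auto
    then show ?thesis by (simp add: abs_mult[symmetric])
  qed
  also have "\<dots> = kE c * norm (X s)" by (simp add: kE_def)
  \<comment> \<open>A norm is at most one plus its square; this makes the bound affine in the
    energy, as Gronwall requires.\<close>
  also have "\<dots> \<le> kE c * (1 + energy (X s) / m)"
  proof (intro mult_left_mono kE_nonneg)
    have "0 \<le> (norm (X s) - 1)\<^sup>2" by simp
    then have "2 * norm (X s) \<le> 1 + (norm (X s))\<^sup>2" by (simp add: power2_eq_square algebra_simps)
    then have "norm (X s) \<le> 1 + (norm (X s))\<^sup>2" using norm_ge_zero[of "X s"] by linarith
    also have "(norm (X s))\<^sup>2 \<le> energy (X s) / m"
      using energy_lower[of "X s"] m_pos by (simp add: field_simps)
    finally show "norm (X s) \<le> 1 + energy (X s) / m" by simp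
  qed
  finally show "2 * (M (X s) \<bullet> (r s *\<^sub>R f (X s) + c *\<^sub>R g)) \<le> kE c / m * energy (X s) + kE c"
    by (simp add: algebra_simps)
qed (use t m_pos kE_nonneg in auto)

text \<open>Reversal of time and reflection of the point each contribute a sign to the derivative,
  and the two cancel; \<open>f\<close> is even. The control keeps its sign, so the reversed curve
  solves the same system.\<close>

lemma reverse_solution:
  assumes "\<And>t. (X has_vector_derivative (r t *\<^sub>R f (X t) + c *\<^sub>R g)) (at t)"
  shows "((\<lambda>t. - X (- t)) has_vector_derivative (r (- t) *\<^sub>R f (- X (- t)) + c *\<^sub>R g)) (at t)"
proof -
  have "((X \<circ> uminus) has_vector_derivative (- 1) *\<^sub>R (r (- t) *\<^sub>R f (X (- t)) + c *\<^sub>R g)) (at t)"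
    by (rule vector_diff_chain_at) (use assms[of "- t"] in \<open>auto intro!: derivative_eq_intros\<close>)
  from has_vector_derivative_minus[OF this] show ?thesis by (simp add: o_def f_minus add.commute)
qed

lemma energy_bound_abs:
  assumes X: "\<And>t. (X has_vector_derivative (r t *\<^sub>R f (X t) + c *\<^sub>R g)) (at t)"
  shows "energy (X t) \<le> (energy (X 0) + kE c * \<bar>t\<bar>) * exp (kE c / m * \<bar>t\<bar>)"
proof (cases "0 \<le> t")
  case True
  then show ?thesis using energy_bound[OF X] by simp
next
  case False
  have "energy (- x) = energy x" for x by (simp add: energy_def M.neg)
  then show ?thesis using energy_bound[OF reverse_solution[OF X], of "- t"] False by simp
qed

section \<open>Existence, uniqueness and regularity of the flow for constant controls\<close>

definition trajectory :: "real \<Rightarrow> (real \<Rightarrow> 'v) \<Rightarrow> bool"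
  where "trajectory c X \<longleftrightarrow> (\<forall>t. (X has_vector_derivative (f (X t) + c *\<^sub>R g)) (at t))"

lemma trajectoryD: "trajectory c X \<Longrightarrow> (X has_vector_derivative (f (X t) + c *\<^sub>R g)) (at t within S)"
  unfolding trajectory_def by (blast intro: has_vector_derivative_at_within)

lemma trajectory_reverse:
  assumes "trajectory c X"
  shows "trajectory c (\<lambda>t. - X (- t))"
  using reverse_solution[of X "\<lambda>_. 1" c] trajectoryD[OF assms] by (simp add: trajectory_def)

text \<open>The drift is only locally Lipschitz, so it is cut off outside a time-dependent ball. The
  energy estimate holds for the cut-off equation too and confines its solution to that ball, where
  nothing has been changed.\<close>

lemma trajectory_exists: "\<exists>X. X 0 = x \<and> trajectory c X"
proof -
  \<comment> \<open>The radius that the energy estimate allows at time \<open>t\<close>, plus one to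
    keep it positive.\<close>
  define R where "R t = 1 + sqrt ((energy x + kE c * \<bar>t\<bar>) * exp (kE c / m * \<bar>t\<bar>) / m)" for t
  have R: "R t \<ge> 1" for t
    unfolding R_def using energy_nonneg kE_nonneg m_pos by simp
  have contR: "continuous_on S R" for S
    unfolding R_def by (intro continuous_intros) (use m_pos in auto)
  define F where "F t y = f (clamp (R t) y) + c *\<^sub>R g" for t y
  have Rp: "R t > 0" for t using R[of t] by linarith
  then have Rmax: "max (R t) a \<noteq> 0" for t a by (metis less_max_iff_disj less_irrefl)
  obtain X where X0: "X 0 = x" and X: "\<And>t. (X has_vector_derivative F t (X t)) (at t)"
  proof (rule picard[of F x])
    have "continuous_on UNIV (\<lambda>p. F (fst p) (snd p))"
      unfolding F_def clamp_def
      by (intro continuous_intros continuous_on_compose2[OF continuous_on_f[of UNIV]]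
          continuous_on_compose2[OF contR[of UNIV]])
         (auto simp: Rmax)
    then show "continuous_on UNIV (\<lambda>(t, x). F t x)" by (simp add: case_prod_beta)
    fix T :: real
    have "bounded (R ` {-T..T})"
      by (intro compact_imp_bounded compact_continuous_image contR compact_Icc)
    then obtain r where "\<forall>t\<in>{-T..T}. norm (R t) \<le> r" by (auto simp: bounded_iff)
    then have r: "\<And>t. t \<in> {-T..T} \<Longrightarrow> R t \<le> r" by fastforce
    have "norm (F t x - F t y) \<le> (2 * r * KB * 2) * norm (x - y)" if t: "t \<in> {-T..T}" for t x y
    proof -
      have "norm (F t x - F t y) \<le> (2 * r * KB) * norm (clamp (R t) x - clamp (R t) y)"
        unfolding F_def using f_lip[of "clamp (R t) x" r "clamp (R t) y"] norm_clamp_le[OF Rp] r[OF t]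
        by (simp add: order_trans[OF norm_clamp_le[OF Rp]])
      also have "\<dots> \<le> (2 * r * KB) * (2 * norm (x - y))"
        using r[OF t] R[of t] KB(1) by (intro mult_left_mono clamp_lipschitz Rp) auto
      finally show ?thesis by simp
    qed
    then show "\<exists>L. \<forall>t\<in>{-T..T}. \<forall>x y. norm (F t x - F t y) \<le> L * norm (x - y)" by blast
  next
    fix X assume "X 0 = x" "\<And>t. (X has_vector_derivative F t (X t)) (at t)"
    then show thesis by (rule that)
  qed
  \<comment> \<open>Homogeneity of degree two pulls the clamping factor out as its square, which is
    the form \<open>energy_bound_abs\<close> accepts.\<close>
  have "(X has_vector_derivative ((R t / max (R t) (norm (X t)))\<^sup>2 *\<^sub>R f (X t) + c *\<^sub>R g)) (at t)" for t
    using X[of t] by (simp add: F_def clamp_def f_scale power2_eq_square)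
  from energy_bound_abs[OF this] have E: "energy (X t) \<le> (energy x + kE c * \<bar>t\<bar>) * exp (kE c / m * \<bar>t\<bar>)" for t
    by (simp add: X0)
  have "norm (X t) \<le> R t" for t
  proof -
    have "(norm (X t))\<^sup>2 \<le> (energy x + kE c * \<bar>t\<bar>) * exp (kE c / m * \<bar>t\<bar>) / m"
      using order_trans[OF energy_lower E, of t] m_pos by (simp add: field_simps)
    then have "norm (X t) \<le> sqrt ((energy x + kE c * \<bar>t\<bar>) * exp (kE c / m * \<bar>t\<bar>) / m)"
      by (rule real_le_rsqrt)
    then show ?thesis by (simp add: R_def)
  qed
  then have "F t (X t) = f (X t) + c *\<^sub>R g" for t
    by (simp add: F_def clamp_eq[OF Rp])
  then have "trajectory c X" unfolding trajectory_def using X by simp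
  then show ?thesis using X0 by blast
qed

text \<open>For \<open>\<bar>c\<bar> \<le> b\<close> the choice is unambiguous by
  \<open>trajectory_unique\<close> below.\<close>

definition flow :: "real \<Rightarrow> real \<Rightarrow> 'v \<Rightarrow> 'v"
  where "flow c t x = (SOME X. X 0 = x \<and> trajectory c X) t"

lemma flow_0 [simp]: "flow c 0 x = x"
  and trajectory_flow: "trajectory c (\<lambda>t. flow c t x)"
  using someI_ex[OF trajectory_exists[of x c]] unfolding flow_def by auto

lemmas flow_deriv = trajectoryD[OF trajectory_flow]

lemma trajectory_bound: "\<exists>\<rho>>0. \<forall>c X t. trajectory c X \<longrightarrow> \<bar>c\<bar> \<le> b \<longrightarrow> norm (X 0) \<le> r \<longrightarrow> \<bar>t\<bar> \<le> T \<longrightarrow>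
  norm (X t) \<le> \<rho>"
proof -
  define S where "S = (onorm M * r\<^sup>2 + kE b * T) * exp (kE b / m * T) / m"
  \<comment> \<open>The absolute value and the added one keep the bound positive even when
    \<open>r\<close> or \<open>T\<close> is negative and the claim is vacuous.\<close>
  have "norm (X t) \<le> sqrt \<bar>S\<bar> + 1" if H: "\<bar>c\<bar> \<le> b" "norm (X 0) \<le> r" "\<bar>t\<bar> \<le> T"
    "trajectory c X" for c X t
  proof -
    have r: "r \<ge> 0" using H(2) norm_ge_zero order_trans by blast
    have "energy (X t) \<le> (energy (X 0) + kE c * \<bar>t\<bar>) * exp (kE c / m * \<bar>t\<bar>)"
      using energy_bound_abs[of X "\<lambda>_. 1" c t] trajectoryD[OF H(4)] by simp
    also have "\<dots> \<le> (onorm M * r\<^sup>2 + kE b * T) * exp (kE b / m * T)"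
    proof (rule mult_mono)
      have "energy (X 0) \<le> norm (X 0) * norm (M (X 0))"
        unfolding energy_def by (rule norm_cauchy_schwarz)
      also have "\<dots> \<le> norm (X 0) * (onorm M * norm (X 0))" by (intro mult_left_mono onorm M_lin) auto
      also have "\<dots> \<le> r * (onorm M * r)"
        using H(2) r onorm_pos_le[OF M_lin] by (intro mult_mono) auto
      finally have "energy (X 0) \<le> onorm M * r\<^sup>2" by (simp add: power2_eq_square mult_ac)
      moreover have "kE c * \<bar>t\<bar> \<le> kE b * T"
        by (rule mult_mono[OF kE_mono[OF H(1)] H(3) kE_nonneg]) simp
      ultimately show "energy (X 0) + kE c * \<bar>t\<bar> \<le> onorm M * r\<^sup>2 + kE b * T" by (rule add_mono)
      have "kE c / m * \<bar>t\<bar> \<le> kE b / m * T"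
        using kE_mono[OF H(1)] kE_nonneg m_pos by (intro mult_mono[OF _ H(3)] divide_right_mono) auto
      then show "exp (kE c / m * \<bar>t\<bar>) \<le> exp (kE b / m * T)" by simp
      have "0 \<le> onorm M * r\<^sup>2" using onorm_pos_le[OF M_lin] by simp
      moreover have "0 \<le> kE b * T" using H(3) kE_nonneg by (intro mult_nonneg_nonneg) auto
      ultimately show "0 \<le> onorm M * r\<^sup>2 + kE b * T" by (rule add_nonneg_nonneg)
    qed simp
    finally have "(norm (X t))\<^sup>2 \<le> S"
      using energy_lower[of "X t"] m_pos unfolding S_def by (simp add: field_simps)
    then have "norm (X t) \<le> sqrt S" by (rule real_le_rsqrt)
    also have "sqrt S \<le> sqrt \<bar>S\<bar>" by simp
    finally show ?thesis by linarith
  qed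
  moreover have "sqrt \<bar>S\<bar> + 1 > 0" by (simp add: add_nonneg_pos)
  ultimately show ?thesis by (intro exI[of _ "sqrt \<bar>S\<bar> + 1"] conjI allI impI) auto
qed

text \<open>Gronwall is applied to the squared distance, which is differentiable even where the
  curves meet. Both curves use the same control, so its contribution cancels.\<close>

lemma trajectories_close:
  assumes bd: "\<And>s. 0 \<le> s \<Longrightarrow> s \<le> t \<Longrightarrow> norm (X s) \<le> \<rho> \<and> norm (Y s) \<le> \<rho>"
    and X: "trajectory c X" and Y: "trajectory c Y"
    and t: "0 \<le> t" and \<rho>: "0 < \<rho>"
  shows "norm (X t - Y t) \<le> exp (2 * \<rho> * KB * t) * norm (X 0 - Y 0)"
proof -
  have "(norm (X t - Y t))\<^sup>2 \<le> ((norm (X 0 - Y 0))\<^sup>2 + 0 * t) * exp (4 * \<rho> * KB * t)"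
  proof (rule gronwall[where T = t and q = "\<lambda>s. (norm (X s - Y s))\<^sup>2"])
    fix s assume s: "0 \<le> s" "s \<le> t"
    have "((\<lambda>s. (X s - Y s) \<bullet> (X s - Y s)) has_derivative 
      (\<lambda>h. (X s - Y s) \<bullet> (h *\<^sub>R (f (X s) - f (Y s))) + (h *\<^sub>R (f (X s) - f (Y s))) \<bullet> (X s - Y s))) (at s)"
    proof -
      have "((\<lambda>s. X s - Y s) has_vector_derivative (f (X s) + c *\<^sub>R g - (f (Y s) + c *\<^sub>R g))) (at s)"
        by (intro has_vector_derivative_diff trajectoryD X Y)
      then show ?thesis unfolding has_vector_derivative_def
        by (intro has_derivative_inner) (simp_all)
    qed
    then show "((\<lambda>s. (norm (X s - Y s))\<^sup>2) has_real_derivative 2 * ((X s - Y s) \<bullet> (f (X s) - f (Y s)))) (at s)"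
      unfolding has_field_derivative_def power2_norm_eq_inner
      by (rule has_derivative_eq_rhs) (auto simp: inner_commute)
    have "(X s - Y s) \<bullet> (f (X s) - f (Y s)) \<le> norm (X s - Y s) * norm (f (X s) - f (Y s))"
      by (rule norm_cauchy_schwarz)
    also have "\<dots> \<le> norm (X s - Y s) * (2 * \<rho> * KB * norm (X s - Y s))"
      using bd[OF s] by (intro mult_left_mono f_lip) auto
    finally show "2 * ((X s - Y s) \<bullet> (f (X s) - f (Y s))) \<le> 4 * \<rho> * KB * (norm (X s - Y s))\<^sup>2 + 0"
      by (simp add: power2_eq_square mult_ac)
  qed (use t \<rho> KB in auto)
  also have "\<dots> = (exp (2 * \<rho> * KB * t) * norm (X 0 - Y 0))\<^sup>2"
    by (simp add: power_mult_distrib exp_of_nat_mult[symmetric] mult_ac)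
  finally show ?thesis
    by (rule power2_le_imp_le) auto
qed

lemma flow_bound: "\<exists>\<rho>>0. \<forall>c x t. \<bar>c\<bar> \<le> b \<longrightarrow> norm x \<le> r \<longrightarrow> \<bar>t\<bar> \<le> T \<longrightarrow> norm (flow c t x) \<le> \<rho>"
proof -
  obtain \<rho> where "\<rho> > 0" and \<rho>: "\<And>c X t. trajectory c X \<Longrightarrow> \<bar>c\<bar> \<le> b \<Longrightarrow> norm (X 0) \<le> r \<Longrightarrow> \<bar>t\<bar> \<le> T \<Longrightarrow>
    norm (X t) \<le> \<rho>"
    using trajectory_bound[of r T] by blast
  have "norm (flow c t x) \<le> \<rho>" if "\<bar>c\<bar> \<le> b" "norm x \<le> r" "\<bar>t\<bar> \<le> T" for c x t
    using \<rho>[OF trajectory_flow, of c x t] that by simp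
  then show ?thesis using \<open>\<rho> > 0\<close> by blast
qed

lemma trajectory_unique:
  assumes X: "trajectory c X" and c: "\<bar>c\<bar> \<le> b"
  shows "X t = flow c t (X 0)"
proof -
  have pos: "X t = Y t" if t: "0 \<le> t" and X: "trajectory c X" and Y: "trajectory c Y" and eq: "X 0 = Y 0" for X Y t
  proof -
    obtain \<rho> where "\<rho> > 0" and \<rho>: "\<And>c Z s. trajectory c Z \<Longrightarrow> \<bar>c\<bar> \<le> b \<Longrightarrow> norm (Z 0) \<le> norm (X 0) \<Longrightarrow>
        \<bar>s\<bar> \<le> t \<Longrightarrow> norm (Z s) \<le> \<rho>"
      using trajectory_bound[of "norm (X 0)" t] by blast
    have "norm (X t - Y t) \<le> exp (2 * \<rho> * KB * t) * norm (X 0 - Y 0)"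
      by (rule trajectories_close[OF _ X Y t \<open>\<rho> > 0\<close>])
         (use \<rho>[OF X c] \<rho>[OF Y c] eq in auto)
    then show ?thesis by (simp add: eq)
  qed
  show ?thesis
  proof (cases "0 \<le> t")
    case True
    then show ?thesis using pos[OF True X trajectory_flow, of "X 0"] by simp
  next
    case False
    then show ?thesis
      using pos[OF _ trajectory_reverse[OF X] trajectory_reverse[OF trajectory_flow], of "- t" "X 0"] by simp
  qed
qed

lemma flow_neg:
  assumes "\<bar>c\<bar> \<le> b"
  shows "flow c (- t) x = - flow c t (- x)"
proof -
  from trajectory_unique[OF trajectory_reverse[OF trajectory_flow[of c x]] assms, of t]
  have "- flow c (- t) x = flow c t (- x)" by simp
  from arg_cong[OF this, of uminus] show ?thesis by simp
qed

lemma flow_add: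
  assumes "\<bar>c\<bar> \<le> b"
  shows "flow c (s + t) x = flow c s (flow c t x)"
proof -
  have "trajectory c (\<lambda>s. flow c (s + t) x)"
    unfolding trajectory_def
  proof
    fix s
    have "(((\<lambda>t. flow c t x) \<circ> (\<lambda>s. s + t)) has_vector_derivative 1 *\<^sub>R (f (flow c (s + t) x) + c *\<^sub>R g)) (at s)"
    proof (rule vector_diff_chain_at)
      show "((\<lambda>s. s + t) has_vector_derivative 1) (at s)" by (auto intro!: derivative_eq_intros)
    qed (rule flow_deriv)
    then show "((\<lambda>s. flow c (s + t) x) has_vector_derivative (f (flow c (s + t) x) + c *\<^sub>R g)) (at s)"
      by (simp add: o_def)
  qed
  from trajectory_unique[OF this assms, of s] show ?thesis by simp
qed

lemma flow_inverse:
  assumes "\<bar>c\<bar> \<le> b"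
  shows "flow c (- t) (flow c t x) = x" "flow c t (flow c (- t) x) = x"
  using flow_add[OF assms, of "- t" t x] flow_add[OF assms, of t "- t" x] by simp_all

lemma flow_lipschitz: "\<exists>L\<ge>0. \<forall>c x y t. \<bar>c\<bar> \<le> b \<longrightarrow> norm x \<le> r \<longrightarrow> norm y \<le> r \<longrightarrow> \<bar>t\<bar> \<le> T \<longrightarrow>
   norm (flow c t x - flow c t y) \<le> L * norm (x - y)"
proof -
  obtain \<rho> where "\<rho> > 0" and \<rho>: "\<forall>c x t. \<bar>c\<bar> \<le> b \<longrightarrow> norm x \<le> r \<longrightarrow> \<bar>t\<bar> \<le> T \<longrightarrow> norm (flow c t x) \<le> \<rho>"
    using flow_bound[of r T] by blast
  define L where "L = exp (2 * \<rho> * KB * T)"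
  have pos: "norm (flow c t x - flow c t y) \<le> L * norm (x - y)"
    if "\<bar>c\<bar> \<le> b" "norm x \<le> r" "norm y \<le> r" "0 \<le> t" "t \<le> T" for c x y t
  proof -
    have "norm (flow c t x - flow c t y) \<le> exp (2 * \<rho> * KB * t) * norm (flow c 0 x - flow c 0 y)"
      by (rule trajectories_close[OF _ trajectory_flow trajectory_flow]) (use that \<rho> \<open>\<rho> > 0\<close> in auto)
    also have "\<dots> \<le> L * norm (x - y)"
      unfolding L_def using that \<open>\<rho> > 0\<close> KB(1) by (intro mult_mono) auto
    finally show ?thesis .
  qed
  have "norm (flow c t x - flow c t y) \<le> L * norm (x - y)"
    if "\<bar>c\<bar> \<le> b" "norm x \<le> r" "norm y \<le> r" "\<bar>t\<bar> \<le> T" for c x y t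
  proof (cases "0 \<le> t")
    case True
    then show ?thesis using that pos by simp
  next
    case False
    then show ?thesis
      using pos[of c "- x" "- y" "- t"] flow_neg[of c "- t"] that by (simp add: norm_minus_commute)
  qed
  moreover have "L \<ge> 0" by (simp add: L_def)
  ultimately show ?thesis by blast
qed

lemma flow_lipschitz_time: "\<exists>C\<ge>0. \<forall>c x t s. \<bar>c\<bar> \<le> b \<longrightarrow> norm x \<le> r \<longrightarrow> \<bar>t\<bar> \<le> T \<longrightarrow> \<bar>s\<bar> \<le> T \<longrightarrow>
   norm (flow c t x - flow c s x) \<le> C * \<bar>t - s\<bar>"
proof -
  obtain \<rho> where "\<rho> > 0" and \<rho>: "\<forall>c x t. \<bar>c\<bar> \<le> b \<longrightarrow> norm x \<le> r \<longrightarrow> \<bar>t\<bar> \<le> T \<longrightarrow> norm (flow c t x) \<le> \<rho>"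
    using flow_bound[of r T] by blast
  define C where "C = \<rho> * \<rho> * KB + b * norm g"
  have "C \<ge> 0" using KB(1) b_pos by (simp add: C_def)
  have "norm (flow c t x - flow c s x) \<le> C * norm (t - s)"
    if H: "\<bar>c\<bar> \<le> b" "norm x \<le> r" "\<bar>t\<bar> \<le> T" "\<bar>s\<bar> \<le> T" for c x t s
  proof (rule differentiable_bound[of "{-T..T}" "\<lambda>t. flow c t x" "\<lambda>t h. h *\<^sub>R (f (flow c t x) + c *\<^sub>R g)"])
    fix u assume u: "u \<in> {-T..T}"
    then have uT: "\<bar>u\<bar> \<le> T" by auto
    show "((\<lambda>t. flow c t x) has_derivative (\<lambda>h. h *\<^sub>R (f (flow c u x) + c *\<^sub>R g))) (at u within {-T..T})"
      using flow_deriv[of c x u "{-T..T}"] by (simp add: has_vector_derivative_def)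
    have "norm (f (flow c u x) + c *\<^sub>R g) \<le> C"
      unfolding C_def
      by (rule order_trans[OF norm_triangle_ineq add_mono[OF f_bound]]) (use \<rho> H u uT in \<open>simp_all add: mult_right_mono\<close>)
    then show "onorm (\<lambda>h. h *\<^sub>R (f (flow c u x) + c *\<^sub>R g)) \<le> C"
      by (simp add: onorm_scaleR_left onorm_id bounded_linear_ident)
  qed (use H in auto)
  then show ?thesis using \<open>C \<ge> 0\<close> by auto
qed

text \<open>The flow minus its tangent line has derivative \<open>f (flow c u x) - f x\<close>,
  which is of order \<open>\<bar>h\<bar>\<close> for
  \<open>\<bar>u\<bar> \<le> \<bar>h\<bar>\<close>; the mean value inequality supplies the second
  factor.\<close>

lemma flow_second_order: "\<exists>C\<ge>0. \<forall>c x h. \<bar>c\<bar> \<le> b \<longrightarrow> norm x \<le> r \<longrightarrow> \<bar>h\<bar> \<le> 1 \<longrightarrow>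
   norm (flow c h x - x - h *\<^sub>R (f x + c *\<^sub>R g)) \<le> C * h\<^sup>2"
proof -
  obtain \<rho> where "\<rho> > 0" and \<rho>: "\<forall>c x t. \<bar>c\<bar> \<le> b \<longrightarrow> norm x \<le> r \<longrightarrow> \<bar>t\<bar> \<le> 1 \<longrightarrow> norm (flow c t x) \<le> \<rho>"
    using flow_bound[of r 1] by blast
  obtain C where "C \<ge> 0" and C: "\<forall>c x t s. \<bar>c\<bar> \<le> b \<longrightarrow> norm x \<le> r \<longrightarrow> \<bar>t\<bar> \<le> 1 \<longrightarrow> \<bar>s\<bar> \<le> 1 \<longrightarrow>
   norm (flow c t x - flow c s x) \<le> C * \<bar>t - s\<bar>"
    using flow_lipschitz_time[of r 1] by blast
  have "norm (flow c h x - x - h *\<^sub>R (f x + c *\<^sub>R g)) \<le> (2 * \<rho> * KB * C) * h\<^sup>2"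
    if H: "\<bar>c\<bar> \<le> b" "norm x \<le> r" "\<bar>h\<bar> \<le> 1" for c x h
  proof -
    have "norm ((flow c h x - h *\<^sub>R (f x + c *\<^sub>R g)) - (flow c 0 x - 0 *\<^sub>R (f x + c *\<^sub>R g))) \<le> (2 * \<rho> * KB * (C * \<bar>h\<bar>)) * norm (h - 0)"
    proof (rule differentiable_bound[of "{-\<bar>h\<bar>..\<bar>h\<bar>}" "\<lambda>t. flow c t x - t *\<^sub>R (f x + c *\<^sub>R g)"
          "\<lambda>t h. h *\<^sub>R (f (flow c t x) + c *\<^sub>R g - (f x + c *\<^sub>R g))"])
      fix u assume u: "u \<in> {-\<bar>h\<bar>..\<bar>h\<bar>}"
      have "((\<lambda>t. flow c t x - t *\<^sub>R (f x + c *\<^sub>R g)) has_vector_derivative 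
        (f (flow c u x) + c *\<^sub>R g - (f x + c *\<^sub>R g))) (at u within {-\<bar>h\<bar>..\<bar>h\<bar>})"
        using flow_deriv[of c x u "{-\<bar>h\<bar>..\<bar>h\<bar>}"] by (auto intro!: derivative_eq_intros)
      then show "((\<lambda>t. flow c t x - t *\<^sub>R (f x + c *\<^sub>R g)) has_derivative 
        (\<lambda>h. h *\<^sub>R (f (flow c u x) + c *\<^sub>R g - (f x + c *\<^sub>R g)))) (at u within {-\<bar>h\<bar>..\<bar>h\<bar>})"
        by (simp add: has_vector_derivative_def)
      have u1: "\<bar>u\<bar> \<le> 1" "\<bar>u\<bar> \<le> \<bar>h\<bar>" using u H by auto
      have "norm x \<le> \<rho>" using \<rho>[rule_format, of c x 0] H by simp
      then have "norm (f (flow c u x) - f x) \<le> (2 * \<rho> * KB) * norm (flow c u x - x)"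
        using \<rho> H u1 by (intro f_lip) auto
      also have "\<dots> \<le> (2 * \<rho> * KB) * (C * \<bar>u\<bar>)"
        using C[rule_format, of c x u 0] H u1 \<open>\<rho> > 0\<close> KB(1) by (intro mult_left_mono) auto
      also have "\<dots> \<le> (2 * \<rho> * KB) * (C * \<bar>h\<bar>)"
        using u1 \<open>C \<ge> 0\<close> \<open>\<rho> > 0\<close> KB(1) by (intro mult_left_mono) auto
      finally show "onorm (\<lambda>h. h *\<^sub>R (f (flow c u x) + c *\<^sub>R g - (f x + c *\<^sub>R g))) \<le> 2 * \<rho> * KB * (C * \<bar>h\<bar>)"
        by (simp add: onorm_scaleR_left onorm_id bounded_linear_ident)
    qed auto
    also have "2 * \<rho> * KB * (C * \<bar>h\<bar>) * norm (h - 0) = (2 * \<rho> * KB * C) * (\<bar>h\<bar> * \<bar>h\<bar>)"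
      by simp
    also have "\<dots> = (2 * \<rho> * KB * C) * h\<^sup>2" by (simp only: abs_mult_self_eq power2_eq_square)
    finally show ?thesis by (simp add: algebra_simps)
  qed
  moreover have "2 * \<rho> * KB * C \<ge> 0" using \<open>C \<ge> 0\<close> \<open>\<rho> > 0\<close> KB(1) by simp
  ultimately show ?thesis by blast
qed

lemma flow_continuous:
  assumes "\<bar>c\<bar> \<le> b"
  shows "continuous_on S (\<lambda>(t, x). flow c t x)"
proof -
  have "isCont (\<lambda>p. flow c (fst p) (snd p)) (t0, x0)" for t0 x0
  proof -
    define r T where "r = norm x0 + 1" and "T = \<bar>t0\<bar> + 1"
    obtain L where L: "\<And>x y t. norm x \<le> r \<Longrightarrow> norm y \<le> r \<Longrightarrow> \<bar>t\<bar> \<le> T \<Longrightarrow> norm (flow c t x - flow c t y) \<le> L * norm (x - y)"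
      using flow_lipschitz[of r T] assms by blast
    obtain C where C: "\<And>x t s. norm x \<le> r \<Longrightarrow> \<bar>t\<bar> \<le> T \<Longrightarrow> \<bar>s\<bar> \<le> T \<Longrightarrow> norm (flow c t x - flow c s x) \<le> C * \<bar>t - s\<bar>"
      using flow_lipschitz_time[of r T] assms by blast
    have "((\<lambda>p. flow c (fst p) (snd p) - flow c t0 x0) \<longlongrightarrow> 0) (at (t0, x0))"
    proof (rule Lim_null_comparison)
      have "\<forall>\<^sub>F p in at (t0, x0). p \<in> ball t0 1 \<times> ball x0 1"
        by (rule eventually_at_in_open') (auto intro: open_Times)
      then show "\<forall>\<^sub>F p in at (t0, x0). norm (flow c (fst p) (snd p) - flow c t0 x0) \<le>
          L * norm (snd p - x0) + C * \<bar>fst p - t0\<bar>"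
      proof eventually_elim
        case (elim p)
        then have p: "\<bar>fst p\<bar> \<le> T" "norm (snd p) \<le> r"
          using norm_triangle_ineq2[of "snd p" x0]
          by (auto simp: T_def r_def dist_norm norm_minus_commute)
        have "norm (flow c (fst p) (snd p) - flow c t0 x0) \<le>
          norm (flow c (fst p) (snd p) - flow c (fst p) x0) + norm (flow c (fst p) x0 - flow c t0 x0)"
          using norm_triangle_ineq[of "flow c (fst p) (snd p) - flow c (fst p) x0" "flow c (fst p) x0 - flow c t0 x0"] by simp
        also have "\<dots> \<le> L * norm (snd p - x0) + C * \<bar>fst p - t0\<bar>"
          by (intro add_mono L C) (use p in \<open>auto simp: r_def T_def\<close>)
        finally show ?case .
      qed
      have "((\<lambda>p. L * norm (snd p - x0) + C * \<bar>fst p - t0\<bar>) \<longlongrightarrow> L * norm (snd (t0, x0) - x0) + C * \<bar>fst (t0, x0) - t0\<bar>) (at (t0, x0))"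
        by (intro tendsto_intros)
      then show "((\<lambda>p. L * norm (snd p - x0) + C * \<bar>fst p - t0\<bar>) \<longlongrightarrow> 0) (at (t0, x0))" by simp
    qed
    then show ?thesis by (simp add: isCont_def LIM_zero_iff)
  qed
  then have "continuous_on S (\<lambda>p. flow c (fst p) (snd p))"
    by (intro continuous_at_imp_continuous_on) auto
  then show ?thesis by (simp add: case_prod_beta)
qed

lemma continuous_on_flow [continuous_intros]:
  assumes "\<bar>c\<bar> \<le> b" "continuous_on S \<tau>" "continuous_on S \<gamma>"
  shows "continuous_on S (\<lambda>s. flow c (\<tau> s) (\<gamma> s))"
  using continuous_on_compose2[OF flow_continuous[OF assms(1)] continuous_on_Pair[OF assms(2,3)]] by auto

text \<open>\<open>Z\<close> is the fundamental solution of the variational equation along the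
  trajectory of \<open>y\<close>. The rate \<open>\<epsilon>\<close>, at which \<open>Z t\<close>
  tends to the identity, is recorded because the bracket argument later has to undo
  \<open>Z t\<close> for small \<open>t\<close>.\<close>

lemma flow_derivative:
  assumes c: "\<bar>c\<bar> \<le> b"
  obtains Z \<epsilon> where "\<And>v. Z 0 v = v" "\<And>t. bounded_linear (Z t)"
    "\<And>t v. ((\<lambda>t. Z t v) has_vector_derivative 2 *\<^sub>R B (flow c t y) (Z t v)) (at t)"
    "\<And>t v. norm (Z t v - v) \<le> \<epsilon> t * norm v" "(\<epsilon> \<longlongrightarrow> 0) (at (0::real))"
    "\<And>t. 0 \<le> t \<Longrightarrow> (flow c t has_derivative Z t) (at y)"
proof -
  let ?x = "\<lambda>t. flow c t y"
  have contx: "continuous_on S ?x" for S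
    by (intro continuous_intros c)
  have "\<exists>z. z 0 = e \<and> (\<forall>t. (z has_vector_derivative 2 *\<^sub>R B (?x t) (z t)) (at t))" for e
  proof -
    obtain z where "z 0 = e" "\<And>t. (z has_vector_derivative 2 *\<^sub>R B (?x t) (z t)) (at t)"
    proof (rule picard[of "\<lambda>t z. 2 *\<^sub>R B (?x t) z" e])
      show "continuous_on UNIV (\<lambda>(t, z). 2 *\<^sub>R B (?x t) z)"
        unfolding case_prod_beta by (intro continuous_intros B.continuous_on c)
      fix T :: real
      have "bounded (?x ` {-T..T})"
        by (intro compact_imp_bounded compact_continuous_image contx compact_Icc)
      then obtain r where r: "\<forall>t\<in>{-T..T}. norm (?x t) \<le> r" by (auto simp: bounded_iff)
      have "norm (2 *\<^sub>R B (?x t) x - 2 *\<^sub>R B (?x t) y) \<le> (2 * r * KB) * norm (x - y)" if "t \<in> {-T..T}" for t x y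
      proof -
        have "norm (2 *\<^sub>R B (?x t) x - 2 *\<^sub>R B (?x t) y) = 2 * norm (B (?x t) (x - y))"
          by (simp add: B.diff_right scaleR_diff_right[symmetric])
        also have "\<dots> \<le> 2 * (norm (?x t) * norm (x - y) * KB)" using KB(2) by simp
        also have "\<dots> \<le> 2 * (r * norm (x - y) * KB)"
          using r that KB(1) by (intro mult_left_mono mult_right_mono) auto
        finally show ?thesis by (simp add: mult_ac)
      qed
      then show "\<exists>L. \<forall>t\<in>{-T..T}. \<forall>x y. norm (2 *\<^sub>R B (?x t) x - 2 *\<^sub>R B (?x t) y) \<le> L * norm (x - y)" by blast
    next
      fix z assume "z 0 = e" "\<And>t. (z has_vector_derivative 2 *\<^sub>R B (?x t) (z t)) (at t)"
      then show thesis by (rule that)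
    qed
    then show ?thesis by blast
  qed
  then obtain z where z0: "\<And>e. z e 0 = e" and z: "\<And>e t. (z e has_vector_derivative 2 *\<^sub>R B (?x t) (z e t)) (at t)"
    by metis
  define Z where "Z t v = (\<Sum>e\<in>Basis. (v \<bullet> e) *\<^sub>R z e t)" for t v
  define \<epsilon> where "\<epsilon> t = (\<Sum>e\<in>Basis. norm (z e t - e))" for t
  have Z0: "Z 0 v = v" for v by (simp add: Z_def z0 euclidean_representation)
  have Zlin: "bounded_linear (Z t)" for t
    unfolding Z_def by (intro bounded_linear_sum bounded_linear_intros)
  have Zd: "((\<lambda>t. Z t v) has_vector_derivative 2 *\<^sub>R B (?x t) (Z t v)) (at t)" for t v
  proof -
    have "((\<lambda>t. Z t v) has_vector_derivative (\<Sum>e\<in>Basis. (v \<bullet> e) *\<^sub>R (2 *\<^sub>R B (?x t) (z e t)))) (at t)"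
      unfolding Z_def
      by (intro has_vector_derivative_sum bounded_linear.has_vector_derivative[OF bounded_linear_scaleR_right] z)
    moreover have "(\<Sum>e\<in>Basis. (v \<bullet> e) *\<^sub>R (2 *\<^sub>R B (?x t) (z e t))) = 2 *\<^sub>R B (?x t) (Z t v)"
      by (simp add: Z_def B.sum_right B.scaleR_right scaleR_sum_right mult.commute)
    ultimately show ?thesis by simp
  qed
  have eps: "norm (Z t v - v) \<le> \<epsilon> t * norm v" for t v
  proof -
    have "Z t v - v = (\<Sum>e\<in>Basis. (v \<bullet> e) *\<^sub>R (z e t - e))"
      by (simp add: Z_def scaleR_diff_right sum_subtractf euclidean_representation)
    also have "norm \<dots> \<le> (\<Sum>e\<in>Basis. norm v * norm (z e t - e))"
      by (rule sum_norm_le) (auto intro!: mult_right_mono Basis_le_norm)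
    finally show ?thesis by (simp add: \<epsilon>_def sum_distrib_left mult.commute)
  qed
  have eps0: "(\<epsilon> \<longlongrightarrow> 0) (at 0)"
  proof -
    have "isCont (z e) 0" for e using z[of e 0] has_vector_derivative_continuous by blast
    then have "(z e \<longlongrightarrow> e) (at 0)" for e by (simp add: isCont_def z0)
    then have "(\<epsilon> \<longlongrightarrow> (\<Sum>e\<in>(Basis::'v set). norm (e - e))) (at 0)"
      unfolding \<epsilon>_def by (intro tendsto_intros)
    then show ?thesis by simp
  qed
  have der: "(flow c t has_derivative Z t) (at y)" if t: "0 \<le> t" for t
  proof -
    define r where "r = norm y + 1"
    obtain L where "L \<ge> 0" and L: "\<And>x' y' s. norm x' \<le> r \<Longrightarrow> norm y' \<le> r \<Longrightarrow> \<bar>s\<bar> \<le> t \<Longrightarrow>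
        norm (flow c s x' - flow c s y') \<le> L * norm (x' - y')"
      using flow_lipschitz[of r t] c by blast
    obtain \<rho> where "\<rho> > 0" and \<rho>: "\<And>x' s. norm x' \<le> r \<Longrightarrow> \<bar>s\<bar> \<le> t \<Longrightarrow> norm (flow c s x') \<le> \<rho>"
      using flow_bound[of r t] c by blast
    \<comment> \<open>The summand 1 absorbs the cross term split by
      \<open>2 * a * b \<le> a\<^sup>2 + b\<^sup>2\<close> below; \<open>C\<close> is then what
      Gronwall returns for a forcing term
      \<open>(KB * L\<^sup>2 * (norm h)\<^sup>2)\<^sup>2\<close>.\<close>
    define K where "K = 4 * \<rho> * KB + 1"
    define C where "C = sqrt ((KB * L\<^sup>2)\<^sup>2 * t * exp (K * t))"
    have main: "norm (flow c t (y + h) - flow c t y - Z t h) \<le> C * (norm h)\<^sup>2" if h: "norm h \<le> 1" for h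
    proof -
      define p where "p s = flow c s (y + h) - flow c s y - Z s h" for s
      define \<delta> where "\<delta> s = flow c s (y + h) - flow c s y" for s
      have yh: "norm (y + h) \<le> r" "norm y \<le> r"
        using norm_triangle_ineq[of y h] h by (auto simp: r_def)
      \<comment> \<open>For a quadratic drift the Taylor remainder is exactly
        \<open>B (\<delta> s) (\<delta> s)\<close>, so the linearisation error satisfies the
        variational equation with this forcing.\<close>
      have pd: "(p has_vector_derivative (2 *\<^sub>R B (?x s) (p s) + B (\<delta> s) (\<delta> s))) (at s)" for s
      proof -
        have "(p has_vector_derivative (f (flow c s (y + h)) + c *\<^sub>R g - (f (?x s) + c *\<^sub>R g) - 2 *\<^sub>R B (?x s) (Z s h))) (at s)"
          unfolding p_def by (intro has_vector_derivative_diff flow_deriv Zd)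
        moreover have "flow c s (y + h) = ?x s + \<delta> s" by (simp add: \<delta>_def)
        moreover have "p s = \<delta> s - Z s h" by (simp add: p_def \<delta>_def)
        ultimately show ?thesis
          by (simp add: f_add B.diff_right scaleR_diff_right) (simp add: f_def algebra_simps)
      qed
      have "(norm (p t))\<^sup>2 \<le> ((norm (p 0))\<^sup>2 + (KB * L\<^sup>2 * (norm h)\<^sup>2)\<^sup>2 * t) * exp (K * t)"
      proof (rule gronwall[where T = t and q = "\<lambda>s. (norm (p s))\<^sup>2"])
        fix s assume s: "0 \<le> s" "s \<le> t"
        let ?v = "2 *\<^sub>R B (?x s) (p s) + B (\<delta> s) (\<delta> s)"
        have "((\<lambda>s. p s \<bullet> p s) has_derivative (\<lambda>k. p s \<bullet> (k *\<^sub>R ?v) + (k *\<^sub>R ?v) \<bullet> p s)) (at s)"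
          using pd[of s] unfolding has_vector_derivative_def by (intro has_derivative_inner)
        then show "((\<lambda>s. (norm (p s))\<^sup>2) has_real_derivative 2 * (p s \<bullet> ?v)) (at s)"
          unfolding has_field_derivative_def power2_norm_eq_inner
          by (rule has_derivative_eq_rhs) (auto simp: inner_commute)
        have "norm (B (\<delta> s) (\<delta> s)) \<le> KB * L\<^sup>2 * (norm h)\<^sup>2"
        proof -
          have d: "norm (\<delta> s) \<le> L * norm h"
            using L[OF yh, of s] s by (simp add: \<delta>_def)
          have "norm (B (\<delta> s) (\<delta> s)) \<le> norm (\<delta> s) * norm (\<delta> s) * KB" by (rule KB)
          also have "\<dots> \<le> (L * norm h) * (L * norm h) * KB"
            using d KB(1) \<open>L \<ge> 0\<close> by (intro mult_right_mono mult_mono) auto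
          finally show ?thesis by (simp add: power2_eq_square mult_ac)
        qed
        moreover have "norm (B (?x s) (p s)) \<le> \<rho> * KB * norm (p s)"
        proof -
          have "norm (B (?x s) (p s)) \<le> norm (?x s) * norm (p s) * KB" by (rule KB)
          also have "\<dots> \<le> \<rho> * norm (p s) * KB"
            using \<rho>[OF yh(2), of s] s KB(1) by (intro mult_right_mono) auto
          finally show ?thesis by (simp add: mult_ac)
        qed
        ultimately have "norm ?v \<le> 2 * (\<rho> * KB * norm (p s)) + KB * L\<^sup>2 * (norm h)\<^sup>2"
          by (intro order_trans[OF norm_triangle_ineq]) auto
        then have "norm (p s) * norm ?v \<le> norm (p s) * (2 * (\<rho> * KB * norm (p s)) + KB * L\<^sup>2 * (norm h)\<^sup>2)"
          by (intro mult_left_mono) auto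
        moreover have "p s \<bullet> ?v \<le> norm (p s) * norm ?v" by (rule norm_cauchy_schwarz)
        ultimately have "2 * (p s \<bullet> ?v) \<le> 4 * \<rho> * KB * (norm (p s))\<^sup>2 + 2 * norm (p s) * (KB * L\<^sup>2 * (norm h)\<^sup>2)"
          by (simp add: power2_eq_square algebra_simps)
        also have "2 * norm (p s) * (KB * L\<^sup>2 * (norm h)\<^sup>2) \<le> (norm (p s))\<^sup>2 + (KB * L\<^sup>2 * (norm h)\<^sup>2)\<^sup>2"
          by (rule sum_squares_bound)
        finally show "2 * (p s \<bullet> ?v) \<le> K * (norm (p s))\<^sup>2 + (KB * L\<^sup>2 * (norm h)\<^sup>2)\<^sup>2"
          by (simp add: K_def algebra_simps)
      qed (use t \<open>\<rho> > 0\<close> KB(1) in \<open>auto simp: K_def\<close>)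
      also have "\<dots> = (C * (norm h)\<^sup>2)\<^sup>2"
        using t by (simp add: C_def p_def Z0 power_mult_distrib mult_ac)
      finally have "norm (p t) \<le> C * (norm h)\<^sup>2"
        by (rule power2_le_imp_le) (simp add: C_def t)
      then show ?thesis by (simp add: p_def)
    qed
    have "(\<lambda>h. norm (flow c t (y + h) - flow c t y - Z t h) / norm h) \<midarrow>0\<rightarrow> 0"
    proof (rule Lim_null_comparison)
      have "\<forall>\<^sub>F h in at 0. h \<in> ball (0::'v) 1 - {0}"
        by (rule eventually_at_in_open) auto
      then show "\<forall>\<^sub>F h in at 0. norm (norm (flow c t (y + h) - flow c t y - Z t h) / norm h) \<le> C * norm h"
      proof eventually_elim
        case (elim h)
        then show ?case using main[of h] by (simp add: divide_le_eq power2_eq_square mult_ac)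
      qed
      show "((\<lambda>h::'v. C * norm h) \<longlongrightarrow> 0) (at 0)"
        by (auto intro!: tendsto_eq_intros)
    qed
    then show ?thesis unfolding has_derivative_at using Zlin by blast
  qed
  show ?thesis by (rule that[OF Z0 Zlin Zd eps eps0 der])
qed

section \<open>Reachability by piecewise constant controls and free jumps\<close>

definition step :: "'v \<Rightarrow> 'v \<Rightarrow> bool"
  where "step x y \<longleftrightarrow> (\<exists>c t. \<bar>c\<bar> \<le> b \<and> 0 \<le> t \<and> y = flow c t x) \<or> y - x \<in> N"

text \<open>Jumps along \<open>N\<close> are instantaneous and not produced by any control. They are
  harmless in the application, where they alter only the symmetric part of a matrix.\<close>

definition reach :: "'v \<Rightarrow> 'v \<Rightarrow> bool"
  where "reach = step\<^sup>*\<^sup>*"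

lemma reach_refl: "reach x x" by (simp add: reach_def)

lemma reach_trans: "reach x y \<Longrightarrow> reach y z \<Longrightarrow> reach x z"
  unfolding reach_def by (rule rtranclp_trans)

lemma reach_flow: "reach x y \<Longrightarrow> \<bar>c\<bar> \<le> b \<Longrightarrow> 0 \<le> t \<Longrightarrow> reach x (flow c t y)"
  unfolding reach_def step_def by (blast intro: rtranclp.rtrancl_into_rtrancl)

lemma reach_jump: "reach x y \<Longrightarrow> n \<in> N \<Longrightarrow> reach x (y + n)"
  unfolding reach_def by (erule rtranclp.rtrancl_into_rtrancl) (simp add: step_def)

lemma reach_reverse:
  assumes "reach x y"
  shows "reach (- y) (- x)"
  using assms unfolding reach_def
proof (induction rule: rtranclp_induct)
  case (step y z)
  have "step (- z) (- y)"
    using step.hyps(2) unfolding step_def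
  proof
    assume "\<exists>c t. \<bar>c\<bar> \<le> b \<and> 0 \<le> t \<and> z = flow c t y"
    then obtain c t where ct: "\<bar>c\<bar> \<le> b" "0 \<le> t" "z = flow c t y" by blast
    then have "y = - flow c t (- z)"
      using flow_neg[of c t z] flow_inverse(1)[of c t y] by simp
    from arg_cong[OF this, of uminus] have "- y = flow c t (- z)" by simp
    then show "(\<exists>c t. \<bar>c\<bar> \<le> b \<and> 0 \<le> t \<and> - y = flow c t (- z)) \<or> - y - - z \<in> N" using ct by blast
  qed simp
  then show ?case using step.IH by (rule converse_rtranclp_into_rtranclp)
qed simp

section \<open>Polynomial vector fields and their derivatives\<close>

primrec peval :: "'v pexp \<Rightarrow> 'v \<Rightarrow> 'v" where
  "peval Ident y = y"
| "peval (Const w) y = w"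
| "peval (Plus p q) y = peval p y + peval q y"
| "peval (Scale r p) y = r *\<^sub>R peval p y"
| "peval (Prod p q) y = B (peval p y) (peval q y)"

primrec pdiff :: "'v pexp \<Rightarrow> 'v \<Rightarrow> 'v \<Rightarrow> 'v" where
  "pdiff Ident y v = v"
| "pdiff (Const w) y v = 0"
| "pdiff (Plus p q) y v = pdiff p y v + pdiff q y v"
| "pdiff (Scale r p) y v = r *\<^sub>R pdiff p y v"
| "pdiff (Prod p q) y v = B (pdiff p y v) (peval q y) + B (peval p y) (pdiff q y v)"

lemma peval_pderiv: "peval (pderiv p d) y = pdiff p y (peval d y)"
  by (induction p) auto

lemma peval_has_derivative: "(peval p has_derivative pdiff p y) (at y)"
proof (induction p)
  case Ident
  have "peval Ident = (\<lambda>y. y)" "pdiff Ident y = (\<lambda>v. v)" by auto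
  then show ?case by simp
next
  case (Const w)
  have "peval (Const w) = (\<lambda>y. w)" "pdiff (Const w) y = (\<lambda>v. 0)" by auto
  then show ?case by simp
next
  case (Plus p q)
  have "peval (Plus p q) = (\<lambda>y. peval p y + peval q y)" "pdiff (Plus p q) y = (\<lambda>v. pdiff p y v + pdiff q y v)" by auto
  then show ?case using has_derivative_add[OF Plus] by simp
next
  case (Scale r p)
  have "peval (Scale r p) = (\<lambda>y. r *\<^sub>R peval p y)" "pdiff (Scale r p) y = (\<lambda>v. r *\<^sub>R pdiff p y v)" by auto
  then show ?case using has_derivative_scaleR_right[OF Scale] by simp
next
  case (Prod p q)
  have "peval (Prod p q) = (\<lambda>y. B (peval p y) (peval q y))"
    "pdiff (Prod p q) y = (\<lambda>v. B (peval p y) (pdiff q y v) + B (pdiff p y v) (peval q y))" by (auto simp: add.commute)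
  then show ?case using B.FDERIV[OF Prod] by simp
qed

lemma pdiff_linear: "bounded_linear (pdiff p y)"
  using peval_has_derivative has_derivative_bounded_linear by blast

text \<open>Symmetry of second derivatives, with the inner direction allowed to vary.\<close>

lemma peval_pderiv_commute:
  "peval (pderiv (pderiv p d) (Const w)) y =
   peval (pderiv (pderiv p (Const w)) d) y + peval (pderiv p (pderiv d (Const w))) y"
  by (induction p) (auto simp: B.add_left B.add_right scaleR_add_right)

text \<open>Families of reachable points parametrised by the space itself, differentiable at the
  parameter 0 and continuous nearby. This is the regularity that the open mapping theorem in
  \<open>reach_interior\<close> asks for, and it survives composition with flows.\<close>

definition family :: "'v \<Rightarrow> ('v \<Rightarrow> 'v) \<Rightarrow> ('v \<Rightarrow> 'v) \<Rightarrow> bool"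
  where "family x \<gamma> \<gamma>' \<longleftrightarrow> (\<gamma> has_derivative \<gamma>') (at 0) \<and>
    (\<exists>\<delta>>0. continuous_on (ball 0 \<delta>) \<gamma> \<and> (\<forall>s\<in>ball 0 \<delta>. reach x (\<gamma> s)))"

definition tangent :: "'v \<Rightarrow> 'v \<Rightarrow> 'v set \<Rightarrow> bool"
  where "tangent x y L \<longleftrightarrow> (\<exists>\<gamma> \<gamma>'. family x \<gamma> \<gamma>' \<and> \<gamma> 0 = y \<and> range \<gamma>' = L)"

lemma tangent_subspace: "tangent x y L \<Longrightarrow> subspace L"
  unfolding tangent_def family_def by (auto intro!: linear_subspace_image dest: has_derivative_linear)

lemma tangent_refl: "tangent x x {0}"
proof -
  have "family x (\<lambda>_. x) (\<lambda>_. 0)"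
    unfolding family_def by (simp add: reach_refl) (rule exI[of _ 1], simp)
  then show ?thesis unfolding tangent_def by (intro exI[of _ "\<lambda>_. x"] exI[of _ "\<lambda>_. 0"]) simp
qed

text \<open>Letting the duration depend on the parameter as \<open>t + k \<bullet> s\<close> adds
  the field direction \<open>f (\<gamma> 0) + c *\<^sub>R g\<close> to the derivative, before
  \<open>Z\<close> transports everything. The base duration \<open>t > 0\<close> leaves room for
  negative \<open>k \<bullet> s\<close>.\<close>

lemma family_flow:
  assumes fam: "family x \<gamma> \<gamma>'" and c: "\<bar>c\<bar> \<le> b" and t: "0 < t"
    and Z: "(flow c t has_derivative Z) (at (\<gamma> 0))"
  shows "family x (\<lambda>s. flow c (t + k \<bullet> s) (\<gamma> s))
    (\<lambda>s. Z (\<gamma>' s + (k \<bullet> s) *\<^sub>R (f (\<gamma> 0) + c *\<^sub>R g)))"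
proof -
  obtain \<delta> where \<delta>: "\<delta> > 0" "continuous_on (ball 0 \<delta>) \<gamma>" "\<And>s. s \<in> ball 0 \<delta> \<Longrightarrow> reach x (\<gamma> s)"
    and d: "(\<gamma> has_derivative \<gamma>') (at 0)"
    using fam unfolding family_def by blast
  let ?F = "\<lambda>y. f y + c *\<^sub>R g"
  \<comment> \<open>The variable short duration is separated from the fixed duration
    \<open>t\<close>, whose derivative is the given \<open>Z\<close>.\<close>
  define \<psi> where "\<psi> s = flow c (k \<bullet> s) (\<gamma> s)" for s
  have "(\<psi> has_derivative (\<lambda>s. \<gamma>' s + (k \<bullet> s) *\<^sub>R ?F (\<gamma> 0))) (at 0)"
  proof -
    \<comment> \<open>The second-order estimate is uniform in the starting point, so this remainder
      is quadratic in \<open>s\<close>. Joint differentiability of the flow in time and space is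
      thereby avoided.\<close>
    define rem where "rem s = flow c (k \<bullet> s) (\<gamma> s) - \<gamma> s - (k \<bullet> s) *\<^sub>R ?F (\<gamma> s)" for s
    obtain C where C: "C \<ge> 0" "\<And>y h. norm y \<le> norm (\<gamma> 0) + 1 \<Longrightarrow> \<bar>h\<bar> \<le> 1 \<Longrightarrow>
        norm (flow c h y - y - h *\<^sub>R ?F y) \<le> C * h\<^sup>2"
      using flow_second_order[of "norm (\<gamma> 0) + 1"] c by blast
    have cont0: "(\<gamma> \<longlongrightarrow> \<gamma> 0) (at 0)"
      using has_derivative_continuous[OF d] by (simp add: isCont_def)
    have "(\<lambda>h. norm (rem (0 + h) - rem 0 - 0) / norm h) \<midarrow>0\<rightarrow> 0"
    proof (rule Lim_null_comparison)
      have "\<forall>\<^sub>F h in at 0. dist (\<gamma> h) (\<gamma> 0) < 1"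
        using cont0 by (rule tendstoD) simp
      moreover have "((\<lambda>h. \<bar>k \<bullet> h\<bar>) \<longlongrightarrow> \<bar>k \<bullet> 0\<bar>) (at 0)" by (intro tendsto_intros)
      then have "\<forall>\<^sub>F h in at 0. \<bar>k \<bullet> h\<bar> < 1" by (rule order_tendstoD) simp
      ultimately show "\<forall>\<^sub>F h in at 0. norm (norm (rem (0 + h) - rem 0 - 0) / norm h) \<le> C * (norm k)\<^sup>2 * norm h"
      proof eventually_elim
        case (elim h)
        have "norm (\<gamma> h) \<le> norm (\<gamma> 0) + 1"
          using elim(1) norm_triangle_ineq2[of "\<gamma> h" "\<gamma> 0"] by (simp add: dist_norm)
        then have "norm (rem h) \<le> C * (k \<bullet> h)\<^sup>2"
          unfolding rem_def using C(2) elim(2) by simp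
        also have "\<dots> \<le> C * (norm k * norm h)\<^sup>2"
          using C(1) Cauchy_Schwarz_ineq2[of k h] by (intro mult_left_mono) (auto simp: abs_le_square_iff[symmetric] abs_mult)
        finally show ?case
          by (cases "h = 0") (auto simp: rem_def divide_le_eq power2_eq_square mult_ac)
      qed
      show "((\<lambda>h. C * (norm k)\<^sup>2 * norm h) \<longlongrightarrow> 0) (at 0)"
        by (auto intro!: tendsto_eq_intros)
    qed
    then have "(rem has_derivative (\<lambda>s. 0)) (at 0)"
      unfolding has_derivative_at by auto
    moreover have "((\<lambda>s. \<gamma> s + (k \<bullet> s) *\<^sub>R ?F (\<gamma> s)) has_derivative
        (\<lambda>s. \<gamma>' s + ((k \<bullet> 0) *\<^sub>R (2 *\<^sub>R B (\<gamma> 0) (\<gamma>' s)) + (k \<bullet> s) *\<^sub>R ?F (\<gamma> 0)))) (at 0)"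
    proof -
      have "((\<lambda>s. ?F (\<gamma> s)) has_derivative (\<lambda>s. 2 *\<^sub>R B (\<gamma> 0) (\<gamma>' s))) (at 0)"
        using has_derivative_add[OF has_derivative_compose[OF d f_has_derivative] has_derivative_const] by simp
      moreover have "((\<lambda>s. k \<bullet> s) has_derivative (\<lambda>s. k \<bullet> s)) (at 0)"
        by (rule bounded_linear_imp_has_derivative[OF bounded_linear_inner_right])
      ultimately show ?thesis by (intro has_derivative_add d has_derivative_scaleR)
    qed
    ultimately have "((\<lambda>s. rem s + (\<gamma> s + (k \<bullet> s) *\<^sub>R ?F (\<gamma> s))) has_derivative
        (\<lambda>s. 0 + (\<gamma>' s + ((k \<bullet> 0) *\<^sub>R (2 *\<^sub>R B (\<gamma> 0) (\<gamma>' s)) + (k \<bullet> s) *\<^sub>R ?F (\<gamma> 0))))) (at 0)"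
      by (rule has_derivative_add)
    moreover have "rem s + (\<gamma> s + (k \<bullet> s) *\<^sub>R ?F (\<gamma> s)) = \<psi> s" for s by (simp add: rem_def \<psi>_def)
    ultimately show ?thesis by simp
  qed
  moreover have "(flow c t has_derivative Z) (at (\<psi> 0))" using Z by (simp add: \<psi>_def)
  ultimately have "((\<lambda>s. flow c t (\<psi> s)) has_derivative (\<lambda>s. Z (\<gamma>' s + (k \<bullet> s) *\<^sub>R ?F (\<gamma> 0)))) (at 0)"
    by (rule has_derivative_compose)
  moreover have "flow c t (\<psi> s) = flow c (t + k \<bullet> s) (\<gamma> s)" for s
    by (simp add: \<psi>_def flow_add[OF c])
  ultimately have 1: "((\<lambda>s. flow c (t + k \<bullet> s) (\<gamma> s)) has_derivative (\<lambda>s. Z (\<gamma>' s + (k \<bullet> s) *\<^sub>R ?F (\<gamma> 0)))) (at 0)"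
    by simp
  \<comment> \<open>On this ball \<open>\<bar>k \<bullet> s\<bar> \<le> t\<close>, so all durations
    are nonnegative; the added one guards against \<open>k = 0\<close>.\<close>
  define \<eta> where "\<eta> = min \<delta> (t / (norm k + 1))"
  have nk: "norm k + 1 > 0" by (simp add: add_nonneg_pos)
  have \<eta>: "\<eta> > 0" "\<eta> \<le> \<delta>" using \<delta> t nk by (auto simp: \<eta>_def)
  have 2: "reach x (flow c (t + k \<bullet> s) (\<gamma> s))" if s: "s \<in> ball 0 \<eta>" for s
  proof (rule reach_flow[OF \<delta>(3) c])
    show "s \<in> ball 0 \<delta>" using s \<eta> by auto
    have "\<bar>k \<bullet> s\<bar> \<le> norm k * norm s" by (rule Cauchy_Schwarz_ineq2)
    also have "\<dots> \<le> (norm k + 1) * (t / (norm k + 1))"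
      using s t nk by (intro mult_mono) (auto simp: \<eta>_def)
    also have "\<dots> = t" using nk by simp
    finally show "0 \<le> t + k \<bullet> s" by linarith
  qed
  have "continuous_on (ball 0 \<eta>) (\<lambda>s. flow c (t + k \<bullet> s) (\<gamma> s))"
    by (intro continuous_intros c continuous_on_subset[OF \<delta>(2)] subset_ball \<eta>)
  then show ?thesis using 1 2 \<eta> unfolding family_def by blast
qed

lemma family_jump:
  assumes fam: "family x \<gamma> \<gamma>'" and n: "n \<in> N" "n' \<in> N"
  shows "family x (\<lambda>s. \<gamma> s + (n' + (k \<bullet> s) *\<^sub>R n)) (\<lambda>s. \<gamma>' s + (k \<bullet> s) *\<^sub>R n)"
proof -
  obtain \<delta> where \<delta>: "\<delta> > 0" "continuous_on (ball 0 \<delta>) \<gamma>" "\<And>s. s \<in> ball 0 \<delta> \<Longrightarrow> reach x (\<gamma> s)"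
    and d: "(\<gamma> has_derivative \<gamma>') (at 0)"
    using fam unfolding family_def by blast
  have "reach x (\<gamma> s + (n' + (k \<bullet> s) *\<^sub>R n))" if "s \<in> ball 0 \<delta>" for s
    by (intro reach_jump \<delta> that subspace_add[OF N_sub] subspace_scale[OF N_sub] n)
  moreover have "((\<lambda>s. \<gamma> s + (n' + (k \<bullet> s) *\<^sub>R n)) has_derivative (\<lambda>s. \<gamma>' s + (0 + (k \<bullet> s) *\<^sub>R n))) (at 0)"
    by (intro has_derivative_add d has_derivative_const bounded_linear.has_derivative[OF bounded_linear_scaleR_left]
      bounded_linear_imp_has_derivative[OF bounded_linear_inner_right])
  moreover have "continuous_on (ball 0 \<delta>) (\<lambda>s. \<gamma> s + (n' + (k \<bullet> s) *\<^sub>R n))"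
    by (intro continuous_intros \<delta>)
  ultimately show ?thesis using \<delta>(1) unfolding family_def by auto
qed

lemma flow_differentiable:
  assumes c: "\<bar>c\<bar> \<le> b" and t: "0 \<le> t"
  shows "\<exists>Z. (flow c t has_derivative Z) (at y)"
  by (rule flow_derivative[OF c, of y]) (use t in blast)

text \<open>Time reversal makes \<open>y \<mapsto> - flow c t (- y)\<close> the inverse of the flow
  map, and the chain rule then gives \<open>Z\<close> a left inverse.\<close>

lemma flow_derivative_inj:
  assumes c: "\<bar>c\<bar> \<le> b" and t: "0 \<le> t" and Z: "(flow c t has_derivative Z) (at y)"
  shows "inj Z"
proof -
  obtain W where W: "(flow c t has_derivative W) (at (- flow c t y))"
    using flow_differentiable[OF c t] by blast
  have "((\<lambda>y. flow c t (- flow c t y)) has_derivative (\<lambda>v. W (- Z v))) (at y)"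
    by (rule has_derivative_compose[OF has_derivative_minus[OF Z] W])
  then have "((\<lambda>y. - flow c t (- flow c t y)) has_derivative (\<lambda>v. - W (- Z v))) (at y)"
    by (rule has_derivative_minus)
  moreover have "- flow c t (- flow c t y) = y" for y
    using flow_neg[OF c, of t "flow c t y"] flow_inverse(1)[OF c] by simp
  ultimately have "(\<lambda>v. - W (- Z v)) = (\<lambda>v. v)"
    using has_derivative_unique[OF _ has_derivative_ident] by simp
  then have "- W (- Z v) = v" for v by (rule fun_cong)
  then show ?thesis by (rule inj_on_inverseI)
qed

text \<open>The rank is maximal over all base points of families from \<open>x\<close>, not just at
  \<open>y\<close>. Hence flows and jumps, which do not lower the rank, carry maximal tangent spaces
  to maximal ones.\<close>

definition max_tangent :: "'v \<Rightarrow> 'v \<Rightarrow> 'v set \<Rightarrow> bool"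
  where "max_tangent x y L \<longleftrightarrow> tangent x y L \<and> (\<forall>y' L'. tangent x y' L' \<longrightarrow> dim L' \<le> dim L)"

lemma max_tangent_exists: "\<exists>y L. max_tangent x y L"
proof -
  have "\<exists>p. (case p of (y, L) \<Rightarrow> tangent x y L) \<and> (\<forall>q. (case q of (y, L) \<Rightarrow> tangent x y L) \<longrightarrow> dim (snd q) \<le> dim (snd p))"
    by (rule ex_has_greatest_nat[of _ "(x, {0})" _ "DIM('v) + 1"])
       (auto simp: tangent_refl dim_subset_UNIV less_Suc_eq_le)
  then show ?thesis unfolding max_tangent_def by auto
qed

lemma max_tangent_flow:
  assumes L: "max_tangent x y L" and c: "\<bar>c\<bar> \<le> b" and t: "0 < t"
    and Z: "(flow c t has_derivative Z) (at y)"
  shows "max_tangent x (flow c t y) (Z ` L)"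
proof -
  obtain \<gamma> \<gamma>' where fam: "family x \<gamma> \<gamma>'" and y: "\<gamma> 0 = y" and r: "range \<gamma>' = L"
    using L unfolding max_tangent_def tangent_def by blast
  from family_flow[OF fam c t, of Z 0] Z y
  have "tangent x (flow c t y) (Z ` L)"
    unfolding tangent_def using y r by (intro exI[of _ "\<lambda>s. flow c t (\<gamma> s)"] exI[of _ "\<lambda>s. Z (\<gamma>' s)"]) auto
  moreover have "dim (Z ` L) = dim L"
    by (rule dim_image_eq[OF has_derivative_linear[OF Z] inj_on_subset[OF flow_derivative_inj[OF c _ Z]]]) (use t in auto)
  ultimately show ?thesis using L unfolding max_tangent_def by simp
qed

lemma max_tangent_jump:
  assumes L: "max_tangent x y L" and n: "n \<in> N"
  shows "max_tangent x (y + n) L"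
proof -
  obtain \<gamma> \<gamma>' where fam: "family x \<gamma> \<gamma>'" and y: "\<gamma> 0 = y" and r: "range \<gamma>' = L"
    using L unfolding max_tangent_def tangent_def by blast
  from family_jump[OF fam n n, of 0]
  have "tangent x (y + n) L"
    unfolding tangent_def using y r by (intro exI[of _ "\<lambda>s. \<gamma> s + n"] exI[of _ \<gamma>']) auto
  then show ?thesis using L unfolding max_tangent_def by blast
qed

text \<open>Otherwise a kernel direction of the family could be spent on the duration of a further
  flow segment, and the family obtained at \<open>flow c 1 y\<close> would have larger rank.\<close>

lemma max_tangent_field:
  assumes L: "max_tangent x y L" and c: "\<bar>c\<bar> \<le> b"
  shows "f y + c *\<^sub>R g \<in> L"
proof (rule ccontr)
  assume v: "f y + c *\<^sub>R g \<notin> L"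
  obtain \<gamma> \<gamma>' where fam: "family x \<gamma> \<gamma>'" and y: "\<gamma> 0 = y" and r: "range \<gamma>' = L"
    using L unfolding max_tangent_def tangent_def by blast
  have lin: "linear \<gamma>'" using fam has_derivative_linear unfolding family_def by blast
  obtain k where k: "\<gamma>' k = 0" "dim (range (\<lambda>s. \<gamma>' s + (k \<bullet> s) *\<^sub>R (f y + c *\<^sub>R g))) > dim L"
    by (rule linear_range_insert[OF lin v[folded r]]) (rule that, simp_all add: r)
  obtain Z where Z: "(flow c 1 has_derivative Z) (at y)"
    using flow_differentiable[OF c zero_le_one] by blast
  let ?R = "range (\<lambda>s. \<gamma>' s + (k \<bullet> s) *\<^sub>R (f y + c *\<^sub>R g))"
  from family_flow[OF fam c zero_less_one, of Z k] Z y
  have "tangent x (flow c 1 y) (Z ` ?R)"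
    unfolding tangent_def
    by (intro exI[of _ "\<lambda>s. flow c (1 + k \<bullet> s) (\<gamma> s)"] exI[of _ "\<lambda>s. Z (\<gamma>' s + (k \<bullet> s) *\<^sub>R (f y + c *\<^sub>R g))"]) auto
  moreover have "dim (Z ` ?R) = dim ?R"
    by (rule dim_image_eq[OF has_derivative_linear[OF Z] inj_on_subset[OF flow_derivative_inj[OF c _ Z]]]) auto
  ultimately show False using L k(2) unfolding max_tangent_def by fastforce
qed

text \<open>The same contradiction, with the length of a jump in place of the duration of a flow
  segment.\<close>

lemma max_tangent_N:
  assumes L: "max_tangent x y L" and n: "n \<in> N"
  shows "n \<in> L"
proof (rule ccontr)
  assume v: "n \<notin> L"
  obtain \<gamma> \<gamma>' where fam: "family x \<gamma> \<gamma>'" and y: "\<gamma> 0 = y" and r: "range \<gamma>' = L"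
    using L unfolding max_tangent_def tangent_def by blast
  have lin: "linear \<gamma>'" using fam has_derivative_linear unfolding family_def by blast
  obtain k where k: "\<gamma>' k = 0" "dim (range (\<lambda>s. \<gamma>' s + (k \<bullet> s) *\<^sub>R n)) > dim L"
    by (rule linear_range_insert[OF lin v[folded r]]) (rule that, simp_all add: r)
  from family_jump[OF fam n subspace_0[OF N_sub], of k]
  have "tangent x y (range (\<lambda>s. \<gamma>' s + (k \<bullet> s) *\<^sub>R n))"
    unfolding tangent_def using y by (intro exI[of _ "\<lambda>s. \<gamma> s + (0 + (k \<bullet> s) *\<^sub>R n)"] exI[of _ "\<lambda>s. \<gamma>' s + (k \<bullet> s) *\<^sub>R n"]) auto
  then show False using L k(2) unfolding max_tangent_def by fastforce
qed

text \<open>The good expressions play the role of the Lie algebra of the system.\<close>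

definition good :: "'v \<Rightarrow> 'v pexp \<Rightarrow> bool"
  where "good x p \<longleftrightarrow> (\<forall>y L. max_tangent x y L \<longrightarrow> peval p y \<in> L)"

lemma goodI_lin:
  assumes "good x p" "good x q" "\<And>y. peval e y = r *\<^sub>R peval p y + s *\<^sub>R peval q y"
  shows "good x e"
  unfolding good_def
proof (intro allI impI)
  fix y L assume L: "max_tangent x y L"
  then have "subspace L" using tangent_subspace unfolding max_tangent_def by blast
  moreover have "peval p y \<in> L" "peval q y \<in> L" using assms(1,2) L unfolding good_def by blast+
  ultimately show "peval e y \<in> L" unfolding assms(3) by (intro subspace_add subspace_scale)
qed

text \<open>\<open>peval e\<close> is the Lie bracket of \<open>f + c *\<^sub>R g\<close> with
  \<open>peval p\<close>, the derivative at time 0 of the field pulled back along the flow. The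
  pulled-back values lie in the fixed space \<open>L\<close>, because the flow carries
  \<open>L\<close> to a maximal tangent space, and \<open>L\<close> is closed.\<close>

lemma good_bracket:
  assumes p: "good x p" and c: "\<bar>c\<bar> \<le> b"
    and e: "\<And>y. peval e y = pdiff p y (f y + c *\<^sub>R g) - 2 *\<^sub>R B y (peval p y)"
  shows "good x e"
  unfolding good_def
proof (intro allI impI)
  fix y L assume L: "max_tangent x y L"
  have sub: "subspace L" using L tangent_subspace unfolding max_tangent_def by blast
  obtain Z \<epsilon> where Z0: "\<And>v. Z 0 v = v" and Zlin: "\<And>t. bounded_linear (Z t)"
    and Zd: "\<And>t v. ((\<lambda>t. Z t v) has_vector_derivative 2 *\<^sub>R B (flow c t y) (Z t v)) (at t)"
    and eps: "\<And>t v. norm (Z t v - v) \<le> \<epsilon> t * norm v" and eps0: "(\<epsilon> \<longlongrightarrow> 0) (at (0::real))"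
    and Z: "\<And>t. 0 \<le> t \<Longrightarrow> (flow c t has_derivative Z t) (at y)"
    by (rule flow_derivative[OF c, of y]) (rule that)
  define q where "q t = peval p (flow c t y) - Z t (peval p y)" for t
  have "(q has_vector_derivative (pdiff p y (f y + c *\<^sub>R g) - 2 *\<^sub>R B y (peval p y))) (at 0)"
  proof -
    have "((\<lambda>t. peval p (flow c t y)) has_vector_derivative pdiff p (flow c 0 y) (f (flow c 0 y) + c *\<^sub>R g)) (at 0)"
      by (rule vector_derivative_diff_chain_within[unfolded o_def, OF flow_deriv has_derivative_at_withinI[OF peval_has_derivative]])
    then show ?thesis
      unfolding q_def using has_vector_derivative_diff[OF _ Zd[of "peval p y" 0]] by (simp add: Z0)
  qed
  then have "(q has_vector_derivative peval e y) (at 0 within {0<..})"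
    unfolding e by (rule has_vector_derivative_at_within)
  moreover have "q 0 = 0" by (simp add: q_def Z0)
  ultimately have qlim: "((\<lambda>t. (1 / t) *\<^sub>R q t) \<longlongrightarrow> peval e y) (at_right 0)"
    using difference_quotient_tendsto[of q "peval e y" "{0<..}"] by simp
  \<comment> \<open>Instead of inverting \<open>Z t\<close>, a preimage of the difference quotient
    is chosen inside \<open>L\<close>. It exists because \<open>Z t\<close> followed by
    \<open>L\<close> as its domain gives the maximal tangent space at \<open>flow c t y\<close>,
    which contains the value of \<open>p\<close> there.\<close>
  define l where "l t = (SOME l. l \<in> L \<and> Z t l = (1 / t) *\<^sub>R q t)" for t
  have l: "l t \<in> L \<and> Z t (l t) = (1 / t) *\<^sub>R q t" if t: "0 < t" for t
    unfolding l_def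
  proof (rule someI_ex)
    have "peval p (flow c t y) \<in> Z t ` L"
      using p max_tangent_flow[OF L c t Z] t unfolding good_def by simp
    then obtain l where "l \<in> L" "peval p (flow c t y) = Z t l" by blast
    moreover have "peval p y \<in> L" using p L unfolding good_def by blast
    ultimately have "(1 / t) *\<^sub>R (l - peval p y) \<in> L" "Z t ((1 / t) *\<^sub>R (l - peval p y)) = (1 / t) *\<^sub>R q t"
      using sub linear_simps[OF Zlin] by (auto simp: q_def subspace_scale subspace_diff)
    then show "\<exists>l. l \<in> L \<and> Z t l = (1 / t) *\<^sub>R q t" by blast
  qed
  have eps0': "(\<epsilon> \<longlongrightarrow> 0) (at_right 0)" using eps0 by (rule tendsto_within_subset) simp
  \<comment> \<open>Since \<open>Z t\<close> is within \<open>\<epsilon> t\<close> of the identity,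
    \<open>l t\<close> is bounded by twice the quotient once \<open>\<epsilon> t < 1 / 2\<close>,
    and their difference then vanishes with \<open>\<epsilon> t\<close>.\<close>
  have "((\<lambda>t. l t - (1 / t) *\<^sub>R q t) \<longlongrightarrow> 0) (at_right 0)"
  proof (rule Lim_null_comparison)
    have "\<forall>\<^sub>F t in at_right 0. \<epsilon> t < 1 / 2" by (rule order_tendstoD[OF eps0']) simp
    moreover have "\<forall>\<^sub>F t in at_right (0::real). 0 < t" by (simp add: eventually_at_right_less)
    ultimately show "\<forall>\<^sub>F t in at_right 0. norm (l t - (1 / t) *\<^sub>R q t) \<le> \<bar>\<epsilon> t\<bar> * (2 * norm ((1 / t) *\<^sub>R q t))"
    proof eventually_elim
      case (elim t)
      let ?m = "(1 / t) *\<^sub>R q t"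
      have le: "norm (l t - ?m) \<le> \<epsilon> t * norm (l t)"
        using eps[of t "l t"] l[OF elim(2)] by (simp add: norm_minus_commute)
      also have "\<dots> \<le> 1 / 2 * norm (l t)" using elim by (intro mult_right_mono) auto
      finally have "norm (l t) \<le> 2 * norm ?m"
        using norm_triangle_ineq2[of "l t" ?m] by linarith
      then have "\<bar>\<epsilon> t\<bar> * norm (l t) \<le> \<bar>\<epsilon> t\<bar> * (2 * norm ?m)" by (intro mult_left_mono) auto
      moreover have "\<epsilon> t * norm (l t) \<le> \<bar>\<epsilon> t\<bar> * norm (l t)" by (intro mult_right_mono) auto
      ultimately show ?case using le by linarith
    qed
    have "((\<lambda>t. \<bar>\<epsilon> t\<bar> * (2 * norm ((1 / t) *\<^sub>R q t))) \<longlongrightarrow> \<bar>0\<bar> * (2 * norm (peval e y))) (at_right 0)"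
      by (intro tendsto_intros eps0' qlim)
    then show "((\<lambda>t. \<bar>\<epsilon> t\<bar> * (2 * norm ((1 / t) *\<^sub>R q t))) \<longlongrightarrow> 0) (at_right 0)" by simp
  qed
  from tendsto_add[OF this qlim] have "(l \<longlongrightarrow> peval e y) (at_right 0)" by simp
  moreover have "\<forall>\<^sub>F t in at_right 0. l t \<in> L"
    using eventually_at_right_less[of "0::real"] by eventually_elim (use l in blast)
  ultimately show "peval e y \<in> L"
    by (intro Lim_in_closed_set[OF closed_subspace[OF sub]]) auto
qed

text \<open>A jump carries the tangent space \<open>L\<close> along unchanged, so all difference
  quotients in the direction \<open>n\<close> stay in one closed space.\<close>

lemma good_jump:
  assumes p: "good x p" and n: "n \<in> N"
  shows "good x (pderiv p (Const n))"
  unfolding good_def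
proof (intro allI impI)
  fix y L assume L: "max_tangent x y L"
  have sub: "subspace L" using L tangent_subspace unfolding max_tangent_def by blast
  let ?q = "\<lambda>t::real. peval p (y + t *\<^sub>R n)"
  have "((\<lambda>t::real. y + t *\<^sub>R n) has_vector_derivative n) (at 0)"
    by (auto intro!: derivative_eq_intros)
  then have "(?q has_vector_derivative pdiff p (y + 0 *\<^sub>R n) n) (at 0)"
    by (rule vector_derivative_diff_chain_within[unfolded o_def, OF _ has_derivative_at_withinI[OF peval_has_derivative]])
  then have "(?q has_vector_derivative pdiff p y n) (at 0)" by simp
  then have lim: "((\<lambda>t. (1 / t) *\<^sub>R (?q t - ?q 0)) \<longlongrightarrow> pdiff p y n) (at 0)"
    by (rule difference_quotient_tendsto)
  have "?q t \<in> L" for t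
    using max_tangent_jump[OF L subspace_scale[OF N_sub n]] p unfolding good_def by blast
  then have "(1 / t) *\<^sub>R (?q t - ?q 0) \<in> L" for t
    by (intro subspace_scale[OF sub] subspace_diff[OF sub])
  then have "pdiff p y n \<in> L"
    using Lim_in_closed_set[OF closed_subspace[OF sub] _ _ lim] by simp
  then show "peval (pderiv p (Const n)) y \<in> L" by (simp add: peval_pderiv)
qed

text \<open>The directions whose derivative preserves good expressions form a subspace that contains
  \<open>N\<close> and \<open>g\<close>. It is closed under squares because commuting the derivative
  along \<open>v\<close> twice with the bracket by the drift leaves the derivative along
  \<open>2 *\<^sub>R B v v\<close>.\<close>

lemma good_all_directions:
  assumes "good x p"
  shows "good x (pderiv p (Const w))"
proof -
  define S where "S = {v. \<forall>p. good x p \<longrightarrow> good x (pderiv p (Const v))}"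
  let ?F = "Prod Ident Ident :: 'v pexp"
  have pd: "pdiff p y (r *\<^sub>R v + s *\<^sub>R w) = r *\<^sub>R pdiff p y v + s *\<^sub>R pdiff p y w" for p y r v s w
    by (simp add: linear_add[OF bounded_linear.linear[OF pdiff_linear]] linear_scale[OF bounded_linear.linear[OF pdiff_linear]])
  have pd0: "pdiff p y 0 = 0" for p y by (rule linear_0[OF bounded_linear.linear[OF pdiff_linear]])
  have "S = UNIV"
  proof (rule generating)
    have good0: "good x (pderiv p (Const 0))" for p
      unfolding good_def max_tangent_def by (auto simp: peval_pderiv pd0 dest!: tangent_subspace subspace_0)
    show "subspace S"
    proof (rule subspaceI)
      show "0 \<in> S" using good0 by (simp add: S_def)
      fix v w :: 'v and r :: real assume v: "v \<in> S"
      show "v + w \<in> S" if w: "w \<in> S"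
        unfolding S_def
      proof (intro CollectI allI impI)
        fix p assume p: "good x p"
        show "good x (pderiv p (Const (v + w)))"
        proof (rule goodI_lin)
          show "good x (pderiv p (Const v))" "good x (pderiv p (Const w))" using v w p by (auto simp: S_def)
          show "peval (pderiv p (Const (v + w))) y = 1 *\<^sub>R peval (pderiv p (Const v)) y + 1 *\<^sub>R peval (pderiv p (Const w)) y" for y
            using pd[of p y 1 v 1 w] by (simp add: peval_pderiv)
        qed
      qed
      show "r *\<^sub>R v \<in> S"
        unfolding S_def
      proof (intro CollectI allI impI)
        fix p assume p: "good x p"
        show "good x (pderiv p (Const (r *\<^sub>R v)))"
        proof (rule goodI_lin)
          show "good x (pderiv p (Const v))" "good x (pderiv p (Const v))" using v p by (auto simp: S_def)
          show "peval (pderiv p (Const (r *\<^sub>R v))) y = r *\<^sub>R peval (pderiv p (Const v)) y + 0 *\<^sub>R peval (pderiv p (Const v)) y" for y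
            using pd[of p y r v 0 v] by (simp add: peval_pderiv)
        qed
      qed
    qed
    show "N \<subseteq> S" using good_jump by (auto simp: S_def)
    \<comment> \<open>\<open>ad c\<close> is the Lie bracket with the controlled field
      \<open>f + c *\<^sub>R g\<close>.\<close>
    define ad where "ad c p = Plus (pderiv p (Plus ?F (Const (c *\<^sub>R g)))) (Scale (- 2) (Prod Ident p))" for c p
    have ad: "good x (ad c p)" if "good x p" "\<bar>c\<bar> \<le> b" for c p
      by (rule good_bracket[OF that]) (simp add: ad_def peval_pderiv f_def)
    have ad0: "good x (ad 0 p)" if "good x p" for p using ad[OF that, of 0] b_pos by simp
    show "g \<in> S"
      unfolding S_def
    proof (intro CollectI allI impI)
      fix p assume p: "good x p"
      show "good x (pderiv p (Const g))"
      \<comment> \<open>The drift cancels in \<open>ad b p - ad 0 p\<close>, and what remains is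
        \<open>b\<close> times the derivative along \<open>g\<close>.\<close>
      proof (rule goodI_lin[of x "ad b p" "ad 0 p" _ "1 / b" "- (1 / b)"])
        show "good x (ad b p)" using ad p b_pos by simp
        show "good x (ad 0 p)" using ad0 p .
        show "peval (pderiv p (Const g)) y = (1 / b) *\<^sub>R peval (ad b p) y + (- (1 / b)) *\<^sub>R peval (ad 0 p) y" for y
          using pd[of p y 1 "B y y" b g] pd[of p y 1 "B y y" 0 g] b_pos
          by (simp add: ad_def peval_pderiv algebra_simps)
      qed
    qed
    fix v assume v: "v \<in> S"
    have vS: "good x (pderiv p (Const v))" if "good x p" for p using v that by (simp add: S_def)
    let ?G = "pderiv ?F (Const v)"
    \<comment> \<open>The commutator of the derivative along \<open>v\<close> with
      \<open>ad 0\<close>: it is the bracket with the linear field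
      \<open>y \<mapsto> 2 *\<^sub>R B y v\<close>.\<close>
    define ad1 where "ad1 p = Plus (pderiv p ?G) (Scale (- 2) (Prod (Const v) p))" for p
    have ad1: "good x (ad1 p)" if p: "good x p" for p
    proof (rule goodI_lin[of x "pderiv (ad 0 p) (Const v)" "ad 0 (pderiv p (Const v))" _ 1 "- 1"])
      show "good x (pderiv (ad 0 p) (Const v))" "good x (ad 0 (pderiv p (Const v)))"
        using p vS ad0 by blast+
      show "peval (ad1 p) y = 1 *\<^sub>R peval (pderiv (ad 0 p) (Const v)) y + - 1 *\<^sub>R peval (ad 0 (pderiv p (Const v))) y" for y
        using peval_pderiv_commute[of p "Plus ?F (Const 0)" v y] pd0
        by (simp add: ad_def ad1_def peval_pderiv algebra_simps)
    qed
    show "B v v \<in> S"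
      unfolding S_def
    proof (intro CollectI allI impI)
      fix p assume p: "good x p"
      show "good x (pderiv p (Const (B v v)))"
      \<comment> \<open>In the second commutator the product terms cancel. The derivative of the
        linear field along \<open>v\<close> is \<open>2 *\<^sub>R B v v\<close>, whence the factors
        \<open>1 / 2\<close>.\<close>
      proof (rule goodI_lin[of x "pderiv (ad1 p) (Const v)" "ad1 (pderiv p (Const v))" _ "1 / 2" "- (1 / 2)"])
        show "good x (pderiv (ad1 p) (Const v))" "good x (ad1 (pderiv p (Const v)))"
          using p vS ad1 by blast+
        have "pdiff p y (B v v + B v v) = 2 *\<^sub>R pdiff p y (B v v)" for y
          using pd[of p y 1 "B v v" 1 "B v v"] by (simp add: scaleR_2)
        then show "peval (pderiv p (Const (B v v))) y = (1 / 2) *\<^sub>R peval (pderiv (ad1 p) (Const v)) y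
            + - (1 / 2) *\<^sub>R peval (ad1 (pderiv p (Const v))) y" for y
          using peval_pderiv_commute[of p ?G v y] pd0
          by (simp add: ad1_def peval_pderiv B.zero_left B.zero_right algebra_simps)
      qed
    qed
  qed
  then show ?thesis using assms by (auto simp: S_def)
qed

text \<open>The constant fields that are always tangent form a generating subspace. For such a
  \<open>w\<close>, the bracket with the drift is \<open>- 2 *\<^sub>R B y w\<close>, and
  differentiating it along \<open>w\<close> leaves the constant
  \<open>- 2 *\<^sub>R B w w\<close>.\<close>

lemma max_tangent_UNIV:
  assumes L: "max_tangent x y L"
  shows "L = UNIV"
proof -
  have sub: "subspace L" if "max_tangent x y L" for y L
    using that tangent_subspace unfolding max_tangent_def by blast
  define S where "S = {w. good x (Const w)}"
  have "S = UNIV"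
  proof (rule generating)
    show "subspace S"
      by (rule subspaceI)
        (simp_all add: S_def good_def subspace_0[OF sub] subspace_add[OF sub] subspace_scale[OF sub])
    show "N \<subseteq> S" using max_tangent_N by (auto simp: S_def good_def)
    have "g \<in> L" if "max_tangent x y L" for y L
    proof -
      have "f y + b *\<^sub>R g \<in> L" "f y + 0 *\<^sub>R g \<in> L"
        using max_tangent_field[OF that, of b] max_tangent_field[OF that, of 0] b_pos by simp_all
      from subspace_scale[OF sub[OF that] subspace_diff[OF sub[OF that] this], of "1 / b"] show ?thesis
        using b_pos by simp
    qed
    then show "g \<in> S" by (simp add: S_def good_def)
    fix w assume w: "w \<in> S"
    have "good x (Scale (- 2) (Prod Ident (Const w)))"
      by (rule good_bracket[of x "Const w" 0]) (use w b_pos in \<open>auto simp: S_def\<close>)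
    from good_all_directions[OF this, of w] have "good x (Scale (- 2) (Const (B w w)))"
      unfolding good_def by (simp add: peval_pderiv B.zero_right)
    from goodI_lin[OF this this, of "Const (B w w)" "- 1 / 2" 0] have "good x (Const (B w w))" by simp
    then show "B w w \<in> S" by (simp add: S_def)
  qed
  then show ?thesis using L by (auto simp: S_def good_def)
qed

text \<open>A family of full rank exists, and surjectivity of its derivative at the single parameter
  0, with continuity nearby, makes its image a neighbourhood of \<open>\<gamma> 0\<close>.\<close>

lemma reach_interior: "interior {y. reach x y} \<noteq> {}"
proof -
  obtain y L where L: "max_tangent x y L" using max_tangent_exists by blast
  then obtain \<gamma> \<gamma>' where fam: "family x \<gamma> \<gamma>'" and r: "range \<gamma>' = UNIV"
    using max_tangent_UNIV[OF L] unfolding max_tangent_def tangent_def by blast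
  then obtain \<delta> where \<delta>: "\<delta> > 0" "continuous_on (ball 0 \<delta>) \<gamma>" "\<And>s. s \<in> ball 0 \<delta> \<Longrightarrow> reach x (\<gamma> s)"
    and d: "(\<gamma> has_derivative \<gamma>') (at 0)"
    unfolding family_def by blast
  obtain h where h: "linear h" "\<gamma>' \<circ> h = id"
    using linear_surjective_right_inverse[OF has_derivative_linear[OF d] r] by blast
  have "\<gamma> 0 \<in> interior (\<gamma> ` ball 0 \<delta>)"
    by (rule sussmann_open_mapping[OF open_ball \<delta>(2) _ d linear_conv_bounded_linear[THEN iffD1, OF h(1)] h(2)])
       (use \<delta>(1) in auto)
  moreover have "\<gamma> ` ball 0 \<delta> \<subseteq> {y. reach x y}" using \<delta>(3) by blast
  ultimately show ?thesis using interior_mono by blast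
qed

section \<open>Volume under the drift flow\<close>

lemma local_lipschitz_f: "local_lipschitz f"
  unfolding local_lipschitz_def
proof
  fix r
  have "norm (f x - f y) \<le> (2 * \<bar>r\<bar> * KB) * norm (x - y)" if "norm x \<le> r" "norm y \<le> r" for x y
    using f_lip[of x "\<bar>r\<bar>" y] that by simp
  then show "\<exists>L\<ge>0. \<forall>x y. norm x \<le> r \<longrightarrow> norm y \<le> r \<longrightarrow> norm (f x - f y) \<le> L * norm (x - y)"
    using KB(1) by (intro exI[of _ "2 * \<bar>r\<bar> * KB"]) auto
qed

lemma one_step_method_flow:
  assumes "\<bar>c\<bar> \<le> b"
  shows "one_step_method (flow c) (\<lambda>x. f x + c *\<^sub>R g)"
  unfolding one_step_method_def
proof
  fix r
  show "\<exists>C\<ge>0. \<exists>\<eta>>0. \<forall>x h. norm x \<le> r \<longrightarrow> \<bar>h\<bar> \<le> \<eta> \<longrightarrow> norm (flow c h x - x - h *\<^sub>R (f x + c *\<^sub>R g)) \<le> C * h\<^sup>2"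
    using flow_second_order[of r] assms zero_less_one by blast
qed

lemma one_step_method_flow0: "one_step_method (flow 0) f"
  using one_step_method_flow[of 0] b_pos by simp

text \<open>Each coordinate component of the drift generates a shear, and composing these shears is a
  volume-preserving one-step method for the drift.\<close>

definition splitting :: "'v list \<Rightarrow> real \<Rightarrow> 'v \<Rightarrow> 'v"
  where "splitting bs h = fold (\<lambda>e x. x + (h * (f x \<bullet> e)) *\<^sub>R e) bs"

lemma splitting_one_step:
  assumes "distinct bs"
  shows "one_step_method (splitting bs) (\<lambda>x. \<Sum>e\<in>set bs. (f x \<bullet> e) *\<^sub>R e)"
    and "local_lipschitz (\<lambda>x. \<Sum>e\<in>set bs. (f x \<bullet> e) *\<^sub>R e)"
  using assms
proof (induction bs rule: rev_induct)
  case Nil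
  { case 1 show ?case unfolding one_step_method_def splitting_def by (auto intro!: exI[of _ 0] exI[of _ 1]) }
  { case 2 show ?case by (simp add: local_lipschitz_const) }
next
  case (snoc e bs)
  have comp: "local_lipschitz (\<lambda>x. (f x \<bullet> e) *\<^sub>R e)"
    by (rule local_lipschitz_linear[OF local_lipschitz_f]) (intro bounded_linear_intros)
  { case 1
    have "one_step_method (\<lambda>h x. x + (h * (f x \<bullet> e)) *\<^sub>R e) (\<lambda>x. (f x \<bullet> e) *\<^sub>R e)"
      unfolding one_step_method_def by (auto intro!: exI[of _ 0] exI[of _ 1])
    from one_step_method_compose[OF snoc(1) this snoc(2) comp] 1
    show ?case by (simp add: splitting_def add.commute) }
  { case 2
    then show ?case using local_lipschitz_add[OF snoc(2) comp] by (simp add: add.commute) }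
qed

lemma splitting_volume:
  assumes "set bs \<subseteq> Basis" "compact S"
  shows "compact (splitting bs h ` S) \<and> emeasure lborel (splitting bs h ` S) = emeasure lborel S"
  using assms
proof (induction bs arbitrary: S)
  case Nil
  then show ?case by (simp add: splitting_def)
next
  case (Cons e bs)
  let ?T = "\<lambda>x. x + (h * (f x \<bullet> e)) *\<^sub>R e"
  have e: "e \<in> Basis" using Cons by simp
  have "compact (?T ` S)"
    by (intro compact_continuous_image continuous_intros continuous_on_f Cons)
  moreover have "emeasure lborel (?T ` S) = emeasure lborel S"
  proof (rule emeasure_lborel_shear_image[OF e])
    show "continuous_on UNIV (\<lambda>x. h * (f x \<bullet> e))" by (intro continuous_intros continuous_on_f)
    show "h * (f (x + s *\<^sub>R e) \<bullet> e) = h * (f x \<bullet> e)" for x s unfolding f_def shear[OF e] ..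
    show "S \<in> sets borel" by (rule borel_compact) (rule Cons)
  qed
  moreover have "splitting (e # bs) h ` S = splitting bs h ` (?T ` S)"
    by (simp add: splitting_def image_image)
  ultimately show ?case using Cons by simp
qed

text \<open>Consistency plus stability: each local error, quadratic in \<open>h\<close>, is carried
  to the final time by the exact flow, which enlarges it at most by the factor \<open>L\<close>, and
  the errors are summed.\<close>

lemma splitting_converges:
  assumes P: "one_step_method P f" and \<epsilon>: "0 < \<epsilon>" and t: "0 \<le> t"
  obtains n h where "\<And>x. norm x \<le> r \<Longrightarrow> norm ((P h ^^ n) x - flow 0 t x) \<le> \<epsilon>"
proof -
  have c0: "\<bar>0::real\<bar> \<le> b" using b_pos by simp
  \<comment> \<open>Nested radii: \<open>\<rho>\<close> contains the exact orbits, \<open>r1\<close>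
    will contain the iterates, \<open>r2\<close> one exact step from an iterate, and the added ones
    leave room for numerical errors.\<close>
  obtain \<rho> where \<rho>: "\<rho> > 0" "\<And>x s. norm x \<le> r \<Longrightarrow> \<bar>s\<bar> \<le> t \<Longrightarrow> norm (flow 0 s x) \<le> \<rho>"
    using flow_bound[of r t] c0 by blast
  obtain r1 where r1: "r1 > 0" "\<And>x s. norm x \<le> \<rho> + 1 \<Longrightarrow> \<bar>s\<bar> \<le> t \<Longrightarrow> norm (flow 0 s x) \<le> r1"
    using flow_bound[of "\<rho> + 1" t] c0 by blast
  obtain r2 where r2: "r2 > 0" "\<And>x s. norm x \<le> r1 \<Longrightarrow> \<bar>s\<bar> \<le> 1 \<Longrightarrow> norm (flow 0 s x) \<le> r2"
    using flow_bound[of r1 1] c0 by blast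
  obtain L where L: "L \<ge> 0" "\<And>x y s. norm x \<le> r2 + 1 \<Longrightarrow> norm y \<le> r2 + 1 \<Longrightarrow> \<bar>s\<bar> \<le> t \<Longrightarrow>
      norm (flow 0 s x - flow 0 s y) \<le> L * norm (x - y)"
    using flow_lipschitz[of "r2 + 1" t] c0 by blast
  obtain C1 where C1: "C1 \<ge> 0" "\<And>x h. norm x \<le> r1 \<Longrightarrow> \<bar>h\<bar> \<le> 1 \<Longrightarrow> norm (flow 0 h x - x - h *\<^sub>R (f x + 0 *\<^sub>R g)) \<le> C1 * h\<^sup>2"
    using flow_second_order[of r1] c0 by blast
  obtain C2 \<eta> where C2: "C2 \<ge> 0" "\<eta> > 0" "\<And>x h. norm x \<le> r1 \<Longrightarrow> \<bar>h\<bar> \<le> \<eta> \<Longrightarrow> norm (P h x - x - h *\<^sub>R f x) \<le> C2 * h\<^sup>2"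
    using P unfolding one_step_method_def by blast
  define C where "C = C1 + C2"
  have C: "C \<ge> 0" using C1 C2 by (simp add: C_def)
  define \<epsilon>' where "\<epsilon>' = min \<epsilon> 1"
  \<comment> \<open>The bounds make \<open>h\<close> at most 1 and at most \<open>\<eta>\<close>,
    each single-step error at most 1, and the accumulated error at most
    \<open>\<epsilon>'\<close>.\<close>
  obtain n :: nat where n: "real n > max (max t (t / \<eta>)) (max (C * t\<^sup>2 + 1) (L * C * t\<^sup>2 / \<epsilon>'))" using reals_Archimedean2 by blast
  have e': "\<epsilon>' > 0" using \<epsilon> by (simp add: \<epsilon>'_def)
  have n0: "real n > 0" using n t by linarith
  have n1: "real n \<ge> 1" using n C by (smt (verit) mult_nonneg_nonneg zero_le_power2)
  define h where "h = t / n"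
  have nh: "real n * h = t" using n0 by (simp add: h_def)
  have h: "0 \<le> h" "h \<le> 1" "h \<le> \<eta>" using n n0 t C2(2) by (auto simp: h_def field_simps)
  have small: "real n * (L * (C * h\<^sup>2)) \<le> \<epsilon>'"
  proof -
    have "real n * (L * (C * h\<^sup>2)) = L * C * t\<^sup>2 / n" using n0 by (simp add: h_def power2_eq_square)
    also have "\<dots> \<le> \<epsilon>'" using n n0 e' by (auto simp: field_simps)
    finally show ?thesis .
  qed
  have h2: "C * h\<^sup>2 \<le> 1"
  proof -
    have "C * h\<^sup>2 = C * t\<^sup>2 / (n * n)" by (simp add: h_def power2_eq_square)
    also have "\<dots> \<le> 1" using n n0 n1 mult_mono[of 1 "real n" "C * t\<^sup>2" "real n"] C by (auto simp: divide_le_eq)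
    finally show ?thesis .
  qed
  have "norm ((P h ^^ n) x - flow 0 t x) \<le> \<epsilon>" if x: "norm x \<le> r" for x
  proof -
    \<comment> \<open>The hybrid curve takes \<open>j\<close> numerical steps and then follows the
      exact flow for the remaining time; \<open>j = 0\<close> is exact and \<open>j = n\<close>
      purely numerical.\<close>
    have "norm (flow 0 (t - real j * h) ((P h ^^ j) x) - flow 0 t x) \<le> real j * (L * (C * h\<^sup>2))" if "j \<le> n" for j
      using that
    proof (induction j)
      case (Suc j)
      let ?y = "(P h ^^ j) x" and ?s = "t - real j * h"
      have jh: "real (Suc j) * h \<le> t" using Suc.prems h(1) nh mult_right_mono[of "real (Suc j)" "real n" h] by simp
      have "0 \<le> real j * h" using h(1) by simp
      then have s: "0 \<le> ?s - h" "?s \<le> t" "\<bar>?s - h\<bar> \<le> t" using jh h(1) by (auto simp: algebra_simps)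
      have IH: "norm (flow 0 ?s ?y - flow 0 t x) \<le> real j * (L * (C * h\<^sup>2))" using Suc by simp
      also have "\<dots> \<le> real n * (L * (C * h\<^sup>2))" using Suc.prems L(1) C by (intro mult_right_mono) auto
      also have "\<dots> \<le> 1" using small by (simp add: \<epsilon>'_def)
      finally have "norm (flow 0 ?s ?y) \<le> \<rho> + 1"
        using norm_triangle_ineq2[of "flow 0 ?s ?y" "flow 0 t x"] \<rho>(2)[OF x, of t] t by simp
      \<comment> \<open>The iterate is bounded by flowing back from the endpoint of the hybrid
        curve, which is already known to lie near the exact endpoint.\<close>
      from r1(2)[OF this, of "- ?s"] have y: "norm ?y \<le> r1"
        using s h(1) flow_inverse(1)[OF c0, of ?s ?y] by simp
      have F: "norm (flow 0 h ?y) \<le> r2" using r2(2)[OF y, of h] h by simp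
      have d: "norm (P h ?y - flow 0 h ?y) \<le> C * h\<^sup>2"
      proof -
        have "P h ?y - flow 0 h ?y = (P h ?y - ?y - h *\<^sub>R f ?y) - (flow 0 h ?y - ?y - h *\<^sub>R (f ?y + 0 *\<^sub>R g))" by simp
        also have "norm \<dots> \<le> C2 * h\<^sup>2 + C1 * h\<^sup>2"
          by (intro norm_triangle_le_diff add_mono C1(2) C2(3)) (use y h in auto)
        finally show ?thesis by (simp add: C_def algebra_simps)
      qed
      then have "norm (P h ?y) \<le> r2 + 1"
        using F h2 norm_triangle_ineq2[of "P h ?y" "flow 0 h ?y"] by linarith
      then have "norm (flow 0 (?s - h) (P h ?y) - flow 0 (?s - h) (flow 0 h ?y)) \<le> L * norm (P h ?y - flow 0 h ?y)"
        by (rule L(2)[OF _ _ s(3)]) (use F in auto)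
      also have "\<dots> \<le> L * (C * h\<^sup>2)" using d L(1) by (rule mult_left_mono)
      also have "flow 0 (?s - h) (flow 0 h ?y) = flow 0 ?s ?y" using flow_add[OF c0, of "?s - h" h ?y] by simp
      finally have "norm ((flow 0 (?s - h) (P h ?y) - flow 0 ?s ?y) + (flow 0 ?s ?y - flow 0 t x)) \<le> L * (C * h\<^sup>2) + real j * (L * (C * h\<^sup>2))"
        using IH by (intro norm_triangle_le add_mono)
      then show ?case by (simp add: algebra_simps)
    qed simp
    from this[of n] show ?thesis using small by (simp add: nh \<epsilon>'_def)
  qed
  then show ?thesis by (rule that)
qed

text \<open>Volume-preserving splittings map \<open>S\<close> into any given neighbourhood of its
  image under the flow, and outer regularity provides neighbourhoods of almost the same measure as
  that image.\<close>

lemma flow_volume: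
  assumes S: "compact S" and t: "0 \<le> t"
  shows "emeasure lborel S \<le> emeasure lborel (flow 0 t ` S)"
proof (rule ennreal_le_epsilon)
  fix \<epsilon> :: real assume \<epsilon>: "0 < \<epsilon>"
  have c0: "\<bar>0::real\<bar> \<le> b" using b_pos by simp
  have comp: "compact (flow 0 t ` S)"
    by (intro compact_continuous_image S continuous_intros c0)
  obtain U where U: "open U" "flow 0 t ` S \<subseteq> U" "emeasure lborel (U - flow 0 t ` S) < ennreal \<epsilon>"
    using outer_regular_lborel[of "flow 0 t ` S" \<epsilon>] comp \<epsilon> by (auto simp: compact_imp_closed)
  \<comment> \<open>A Lebesgue number of the one-element cover: points within
    \<open>\<delta>\<close> of the image remain in \<open>U\<close>.\<close>
  obtain \<delta> where \<delta>: "\<delta> > 0" "\<And>x. x \<in> flow 0 t ` S \<Longrightarrow> ball x \<delta> \<subseteq> U"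
    by (rule Heine_Borel_lemma[OF comp, of "{U}"]) (use U in auto)
  obtain r where r: "\<And>x. x \<in> S \<Longrightarrow> norm x \<le> r" using compact_imp_bounded[OF S] by (auto simp: bounded_iff)
  obtain bs :: "'v list" where bs: "set bs = Basis" "distinct bs" using finite_distinct_list[OF finite_Basis] by blast
  have "one_step_method (splitting bs) f"
    using splitting_one_step(1)[OF bs(2)] bs(1) by (simp add: euclidean_representation)
  then obtain n h where nh: "\<And>x. norm x \<le> r \<Longrightarrow> norm ((splitting bs h ^^ n) x - flow 0 t x) \<le> \<delta> / 2"
    by (rule splitting_converges[OF _ half_gt_zero[OF \<delta>(1)] t, of _ r]) (rule that)
  have "(splitting bs h ^^ n) ` S \<subseteq> U"
  proof
    fix y assume "y \<in> (splitting bs h ^^ n) ` S"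
    then obtain x where x: "x \<in> S" "y = (splitting bs h ^^ n) x" by blast
    then have "y \<in> ball (flow 0 t x) \<delta>"
      using nh[OF r[OF x(1)]] \<delta>(1) by (simp add: dist_norm norm_minus_commute)
    then show "y \<in> U" using \<delta>(2) x(1) by blast
  qed
  moreover have "compact ((splitting bs h ^^ k) ` S) \<and> emeasure lborel ((splitting bs h ^^ k) ` S) = emeasure lborel S" for k
  proof (induction k)
    case (Suc k)
    have "(splitting bs h ^^ Suc k) ` S = splitting bs h ` ((splitting bs h ^^ k) ` S)"
      by (simp add: image_image)
    then show ?case using splitting_volume[of bs "(splitting bs h ^^ k) ` S" h] Suc bs(1) by simp
  qed (simp add: S)
  ultimately have "emeasure lborel S \<le> emeasure lborel U"
    using emeasure_mono[of "(splitting bs h ^^ n) ` S" U lborel] U(1) by simp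
  also have "\<dots> = emeasure lborel (flow 0 t ` S \<union> (U - flow 0 t ` S))"
    using U(2) by (simp add: Un_absorb1)
  also have "\<dots> \<le> emeasure lborel (flow 0 t ` S) + emeasure lborel (U - flow 0 t ` S)"
    using comp U(1) by (intro emeasure_subadditive) (auto simp: compact_imp_closed)
  also have "\<dots> \<le> emeasure lborel (flow 0 t ` S) + ennreal \<epsilon>"
    using U(3) by (intro add_left_mono) auto
  finally show "emeasure lborel S \<le> emeasure lborel (flow 0 t ` S) + ennreal \<epsilon>" .
qed

section \<open>Recurrence and density of attainable sets\<close>

definition attainable :: "'v set \<Rightarrow> 'v set"
  where "attainable U = {y. \<exists>x\<in>U. reach x y}"

text \<open>Flow maps are homeomorphisms and jumps are translations, so a neighbourhood of
  attainable points can be carried along every step.\<close>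

lemma open_attainable:
  assumes U: "open U"
  shows "open (attainable U)"
proof -
  have "\<exists>V. open V \<and> y \<in> V \<and> V \<subseteq> attainable U" if "x \<in> U" "reach x y" for x y
    using that(2) unfolding reach_def
  proof (induction rule: rtranclp_induct)
    case base
    have "U \<subseteq> attainable U" using reach_refl by (auto simp: attainable_def)
    then show ?case using U that(1) by blast
  next
    case (step y z)
    then obtain V where V: "open V" "y \<in> V" "V \<subseteq> attainable U" by blast
    from step.hyps(2)[unfolded step_def] show ?case
    proof
      assume "\<exists>c t. \<bar>c\<bar> \<le> b \<and> 0 \<le> t \<and> z = flow c t y"
      then obtain c t where ct: "\<bar>c\<bar> \<le> b" "0 \<le> t" "z = flow c t y" by blast
      let ?W = "flow c (- t) -` V"
      have "open ?W"
        by (rule open_vimage[OF V(1)]) (intro continuous_intros ct)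
      moreover have "z \<in> ?W" using V(2) ct flow_inverse(1)[OF ct(1)] by simp
      moreover have "?W \<subseteq> attainable U"
      proof
        fix w assume "w \<in> ?W"
        then obtain x where "x \<in> U" "reach x (flow c (- t) w)" using V(3) by (auto simp: attainable_def)
        then show "w \<in> attainable U"
          using reach_flow[OF _ ct(1,2), of x "flow c (- t) w"] flow_inverse(2)[OF ct(1), of t w]
          by (auto simp: attainable_def)
      qed
      ultimately show ?thesis by blast
    next
      assume n: "z - y \<in> N"
      let ?W = "(+) (z - y) ` V"
      have "open ?W" using V(1) by (rule open_translation)
      moreover have "z \<in> ?W" using V(2) by (intro image_eqI[of _ _ y]) auto
      moreover have "?W \<subseteq> attainable U"
        using V(3) reach_jump[OF _ n] by (fastforce simp: attainable_def add.commute)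
      ultimately show ?thesis by blast
    qed
  qed
  then show ?thesis unfolding open_subopen[of "attainable U"] by (auto simp: attainable_def)
qed

lemma energy_flow0: "energy (flow 0 t x) \<le> energy x"
  using energy_bound_abs[of "\<lambda>t. flow 0 t x" "\<lambda>_. 1" 0 t] flow_deriv[of 0 x] by (simp add: kE_def)

lemma compact_energy_sublevel: "compact {x. energy x \<le> c}"
proof -
  have "continuous_on UNIV energy"
    unfolding energy_def by (intro continuous_intros M.continuous_on)
  then have "closed {x. energy x \<le> c}" by (intro closed_Collect_le) auto
  moreover have "bounded {x. energy x \<le> c}"
    unfolding bounded_iff
  proof (intro exI ballI)
    fix x assume "x \<in> {x. energy x \<le> c}"
    then have "(norm x)\<^sup>2 \<le> c / m" using energy_lower[of x] m_pos by (simp add: field_simps)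
    then show "norm x \<le> sqrt (c / m)" by (rule real_le_rsqrt)
  qed
  ultimately show ?thesis by (simp add: compact_eq_bounded_closed)
qed

lemma closure_attainable_forward:
  assumes "\<bar>c\<bar> \<le> b" "0 \<le> t" "x \<in> closure (attainable U)"
  shows "flow c t x \<in> closure (attainable U)"
proof -
  have "flow c t ` closure (attainable U) \<subseteq> closure (attainable U)"
  proof (rule image_closure_subset)
    show "continuous_on (closure (attainable U)) (flow c t)" by (intro continuous_intros assms)
    show "flow c t ` attainable U \<subseteq> closure (attainable U)"
      using reach_flow[OF _ assms(1,2)] closure_subset by (fastforce simp: attainable_def)
  qed simp
  then show ?thesis using assms(3) by blast
qed

text \<open>The drift preserves volume and maps compact energy sublevels of the closed set into themselves, hence
  onto a subset of full measure; since the closed set is the closure of an open set, nothing is missed.\<close>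

lemma closure_attainable_backward:
  assumes U: "open U" and t: "0 \<le> t" and x: "x \<in> closure (attainable U)"
  shows "flow 0 (- t) x \<in> closure (attainable U)"
proof -
  have c0: "\<bar>0::real\<bar> \<le> b" using b_pos by simp
  let ?O = "attainable U" and ?K = "closure (attainable U)"
  have "flow 0 (- t) p \<in> ?K" if p: "p \<in> ?O" for p
  proof (rule ccontr)
    assume np: "flow 0 (- t) p \<notin> ?K"
    \<comment> \<open>The margin 1, non-strict in \<open>S\<close> and strict in \<open>W\<close>,
      makes \<open>W\<close> an open set around \<open>p\<close> inside the compact set
      \<open>S\<close>.\<close>
    define S where "S = ?K \<inter> {x. energy x \<le> energy p + 1}"
    define W where "W = ?O \<inter> {x. energy x < energy p + 1} \<inter> flow 0 (- t) -` (- ?K)"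
    have S: "compact S" unfolding S_def by (intro closed_Int_compact compact_energy_sublevel) simp
    have "continuous_on UNIV energy"
      unfolding energy_def by (intro continuous_intros M.continuous_on)
    then have W: "open W"
      unfolding W_def
      by (intro open_Int open_attainable U open_Collect_less open_vimage open_Compl closed_closure continuous_intros c0) auto
    have img: "flow 0 t ` S \<subseteq> S"
      unfolding S_def using closure_attainable_forward[OF c0 t] energy_flow0 order_trans by blast
    have WS: "W \<subseteq> S" unfolding W_def S_def using closure_subset by fastforce
    \<comment> \<open>A point of \<open>W\<close> flowed backwards leaves the closure, whereas a
      point of the image of \<open>S\<close> flows back into \<open>S\<close>.\<close>
    have disj: "flow 0 t ` S \<inter> W = {}"
      unfolding W_def S_def using flow_inverse(1)[OF c0] by auto
    have comp: "compact (flow 0 t ` S)"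
      by (intro compact_continuous_image S continuous_intros c0)
    have fin: "emeasure lborel (flow 0 t ` S) \<noteq> \<infinity>"
      using emeasure_bounded_finite[OF compact_imp_bounded[OF comp]] by simp
    have "emeasure lborel (flow 0 t ` S) + emeasure lborel W = emeasure lborel (flow 0 t ` S \<union> W)"
      using comp W disj by (intro plus_emeasure) (auto simp: compact_imp_closed)
    also have "\<dots> \<le> emeasure lborel S"
      using img WS S by (intro emeasure_mono) (auto simp: compact_imp_closed)
    also have "\<dots> \<le> emeasure lborel (flow 0 t ` S)" by (rule flow_volume[OF S t])
    finally have "emeasure lborel (flow 0 t ` S) + emeasure lborel W \<le> emeasure lborel (flow 0 t ` S) + 0" by simp
    then have "emeasure lborel W \<le> 0" using fin unfolding ennreal_add_left_cancel_le by blast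
    then have "W \<in> null_sets lborel" using W by (intro null_setsI) auto
    then have "negligible W" unfolding negligible_iff_null_sets by (rule null_sets_completionI)
    moreover have "p \<in> W" using p np by (simp add: W_def)
    ultimately show False using open_not_negligible[OF W] by blast
  qed
  then have "flow 0 (- t) ` ?K \<subseteq> ?K"
    by (intro image_closure_subset continuous_intros c0) auto
  then show ?thesis using x by blast
qed

text \<open>The closure is mapped into itself by the drift flow in both time directions. It
  therefore admits compositions of flows whose first-order parts cancel down to a constant field,
  and being closed it then admits the corresponding translations.\<close>

lemma attainable_dense:
  assumes U: "open U" "U \<noteq> {}"
  shows "closure (attainable U) = UNIV"
proof -
  let ?K = "closure (attainable U)"
  have c0: "\<bar>0::real\<bar> \<le> b" using b_pos by simp
  have flow0: "flow 0 t x \<in> ?K" if "x \<in> ?K" for t x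
    using closure_attainable_forward[OF c0 _ that, of t] closure_attainable_backward[OF U(1) _ that, of "- t"]
    by (cases "0 \<le> t") auto
  define S where "S = {w. \<forall>x\<in>?K. \<forall>s. x + s *\<^sub>R w \<in> ?K}"
  \<comment> \<open>One method for each sign of \<open>w\<close>, since
    \<open>closed_invariant_translation\<close> moves forwards only.\<close>
  have S_I: "w \<in> S" if P: "one_step_method P (\<lambda>_. w)" "\<And>h x. 0 \<le> h \<Longrightarrow> x \<in> ?K \<Longrightarrow> P h x \<in> ?K"
    and Q: "one_step_method Q (\<lambda>_. - w)" "\<And>h x. 0 \<le> h \<Longrightarrow> x \<in> ?K \<Longrightarrow> Q h x \<in> ?K" for w P Q
    unfolding S_def
  proof (intro CollectI ballI allI)
    fix x s assume x: "x \<in> ?K"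
    show "x + s *\<^sub>R w \<in> ?K"
    proof (cases "0 \<le> s")
      case True
      then show ?thesis using closed_invariant_translation[OF P(1) closed_closure P(2) x] by simp
    next
      case False
      then show ?thesis using closed_invariant_translation[OF Q(1) closed_closure Q(2) x, of "- s"] by simp
    qed
  qed
  have "S = UNIV"
  proof (rule generating)
    show "subspace S"
    proof (rule subspaceI)
      show "0 \<in> S" by (simp add: S_def)
      show "v + w \<in> S" if "v \<in> S" "w \<in> S" for v w
        using that by (simp add: S_def scaleR_add_right add.assoc[symmetric])
      show "r *\<^sub>R v \<in> S" if "v \<in> S" for r v using that by (simp add: S_def)
    qed
    show "N \<subseteq> S"
    proof
      fix n assume n: "n \<in> N"
      have "x + s *\<^sub>R n \<in> ?K" if "x \<in> ?K" for x s
      proof -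
        have "(\<lambda>x. x + s *\<^sub>R n) ` ?K \<subseteq> ?K"
        proof (rule image_closure_subset)
          show "continuous_on ?K (\<lambda>x. x + s *\<^sub>R n)" by (intro continuous_intros)
          show "(\<lambda>x. x + s *\<^sub>R n) ` attainable U \<subseteq> ?K"
            using reach_jump[OF _ subspace_scale[OF N_sub n]] closure_subset by (fastforce simp: attainable_def)
        qed simp
        then show ?thesis using that by blast
      qed
      then show "n \<in> S" by (simp add: S_def)
    qed
    have lf: "local_lipschitz (\<lambda>x. f x + w)" for w by (intro local_lipschitz_add local_lipschitz_f local_lipschitz_const)
    have lm: "local_lipschitz (\<lambda>x. a *\<^sub>R f x)" for a
      by (rule local_lipschitz_linear[OF local_lipschitz_f bounded_linear_scaleR_right])
    \<comment> \<open>A backward drift step followed by a controlled step cancels the drift to first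
      order and leaves the field \<open>c *\<^sub>R g\<close>. The values \<open>b\<close> and
      \<open>- b\<close> serve the two directions.\<close>
    have control: "one_step_method (\<lambda>h x. flow c h (flow 0 (- 1 * h) x)) (\<lambda>_. c *\<^sub>R g)" if c: "\<bar>c\<bar> \<le> b" for c
      using one_step_method_compose[OF one_step_method_rescale[OF one_step_method_flow0] one_step_method_flow[OF c] lm lf, of "- 1"]
      by simp
    have "b *\<^sub>R g \<in> S"
    proof (rule S_I[OF control[of b]])
      show "one_step_method (\<lambda>h x. flow (- b) h (flow 0 (- 1 * h) x)) (\<lambda>_. - (b *\<^sub>R g))"
        using control[of "- b"] b_pos by simp
    qed (use b_pos flow0 closure_attainable_forward in auto)
    then have "(1 / b) *\<^sub>R (b *\<^sub>R g) \<in> S" using subspace_scale[OF \<open>subspace S\<close>] by blast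
    then show "g \<in> S" using b_pos by simp
    fix w assume w: "w \<in> S"
    have wK: "x + w \<in> ?K" "x - w \<in> ?K" if "x \<in> ?K" for x
    proof -
      have "x + s *\<^sub>R w \<in> ?K" for s using w that unfolding S_def by blast
      from this[of 1] this[of "- 1"] show "x + w \<in> ?K" "x - w \<in> ?K" by simp_all
    qed
    \<comment> \<open>A second difference: drift steps conjugated by translation with
      \<open>w\<close> and \<open>- w\<close>, then twice the drift backwards. Since
      \<open>f (x + w) + f (x - w) - 2 *\<^sub>R f x = 2 *\<^sub>R B w w\<close>, the values
      \<open>1 / 2\<close> and \<open>- 1 / 2\<close> of \<open>a\<close> produce
      \<open>B w w\<close> and its negative.\<close>
    define T where "T a h x = flow 0 (- 2 * a * h) (flow 0 (a * h) (flow 0 (a * h) (x + w) - w - w) + w)" for a h x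
    have T: "one_step_method (T a) (\<lambda>_. (2 * a) *\<^sub>R B w w)" for a
    proof -
      have m1: "one_step_method (\<lambda>h x. flow 0 (a * h) (x + w) - w) (\<lambda>x. a *\<^sub>R f (x + w))"
        by (rule one_step_method_translate[OF one_step_method_rescale[OF one_step_method_flow0]])
      have m2: "one_step_method (\<lambda>h x. flow 0 (a * h) (x + - w) - - w) (\<lambda>x. a *\<^sub>R f (x + - w))"
        by (rule one_step_method_translate[OF one_step_method_rescale[OF one_step_method_flow0]])
      have m3: "one_step_method (\<lambda>h. flow 0 (- 2 * a * h)) (\<lambda>x. (- 2 * a) *\<^sub>R f x)"
        by (rule one_step_method_rescale[OF one_step_method_flow0])
      have l: "local_lipschitz (\<lambda>x. a *\<^sub>R f (x + w))" for w by (rule local_lipschitz_translate[OF lm])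
      have "one_step_method (\<lambda>h x. flow 0 (- 2 * a * h) (flow 0 (a * h) (flow 0 (a * h) (x + w) - w + - w) - - w))
         (\<lambda>x. a *\<^sub>R f (x + w) + a *\<^sub>R f (x + - w) + (- 2 * a) *\<^sub>R f x)"
        by (rule one_step_method_compose[OF one_step_method_compose[OF m1 m2 l l] m3 local_lipschitz_add[OF l l] lm])
      moreover have "a *\<^sub>R f (x + w) + a *\<^sub>R f (x + - w) + (- 2 * a) *\<^sub>R f x = (2 * a) *\<^sub>R B w w" for x
        unfolding f_add f_minus by (simp add: B.minus_right f_def algebra_simps flip: scaleR_add_left)
      ultimately show ?thesis by (simp add: T_def[abs_def])
    qed
    have TK: "T a h x \<in> ?K" if "x \<in> ?K" for a h x
      unfolding T_def by (intro flow0 wK that)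
    show "B w w \<in> S"
    proof (rule S_I[of "T (1 / 2)" "B w w" "T (- 1 / 2)"])
      show "one_step_method (T (1 / 2)) (\<lambda>_. B w w)" using T[of "1 / 2"] by simp
      show "one_step_method (T (- 1 / 2)) (\<lambda>_. - B w w)" using T[of "- 1 / 2"] by simp
    qed (rule TK, assumption)+
  qed
  then have tr: "x + s *\<^sub>R w \<in> ?K" if "x \<in> ?K" for x s w using that unfolding S_def by blast
  obtain u where "u \<in> U" using U(2) by blast
  then have "u \<in> ?K" using closure_subset reach_refl by (fastforce simp: attainable_def)
  then have "y \<in> ?K" for y using tr[of u 1 "y - u"] by simp
  then show ?thesis by blast
qed

theorem reach_all: "reach x y"
proof -
  \<comment> \<open>By \<open>reach_reverse\<close>, every point of \<open>?V\<close> can be steered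
    to \<open>y\<close>.\<close>
  let ?U = "interior {z. reach x z}" and ?V = "uminus ` interior {z. reach (- y) z}"
  have "open ?U" "?U \<noteq> {}" using reach_interior by auto
  then have dense: "closure (attainable ?U) = UNIV" by (rule attainable_dense)
  have "open ?V" "?V \<noteq> {}" using reach_interior by (auto simp: open_negations)
  then obtain z where z: "z \<in> ?V" "z \<in> attainable ?U"
    using dense open_Int_closure_eq_empty[of ?V "attainable ?U"] by blast
  obtain u where "u \<in> ?U" "reach u z" using z(2) by (auto simp: attainable_def)
  then have "reach x z" using reach_trans interior_subset by blast
  moreover obtain v where "v \<in> interior {z. reach (- y) z}" "z = - v" using z(1) by blast
  then have "reach (- y) (- z)" using interior_subset by auto
  then have "reach z y" using reach_reverse by fastforce
  ultimately show ?thesis by (rule reach_trans)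
qed

end

section \<open>Generic generation of all directions\<close>

text \<open>Applying \<open>R\<close> minus \<open>a j\<close> times the identity removes the
  component \<open>x j\<close> and multiplies the others by nonzero factors, so induction recovers
  them first and \<open>x j\<close> by subtraction.\<close>

lemma eigenvector_components_in_subspace:
  fixes x :: "'i \<Rightarrow> 'a::real_vector"
  assumes "finite I" "inj_on a I" and S: "subspace S" and R: "linear R" "\<And>y. y \<in> S \<Longrightarrow> R y \<in> S"
    and "\<And>i. i \<in> I \<Longrightarrow> R (x i) = a i *\<^sub>R x i" "(\<Sum>i\<in>I. x i) \<in> S" "i \<in> I"
  shows "x i \<in> S"
  using assms(1,2,6,7,8)
proof (induction I arbitrary: x i rule: finite_induct)
  case (insert j I)
  let ?y = "\<Sum>i\<in>insert j I. x i"
  have "R ?y - a j *\<^sub>R ?y = (\<Sum>i\<in>insert j I. (a i - a j) *\<^sub>R x i)"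
    using insert.prems(2)
    by (simp add: linear_sum[OF R(1)] scaleR_sum_right sum_subtractf[symmetric] scaleR_diff_left del: sum.insert)
  then have "(\<Sum>i\<in>I. (a i - a j) *\<^sub>R x i) = R ?y - a j *\<^sub>R ?y"
    using insert.hyps by simp
  also have "\<dots> \<in> S" by (intro subspace_diff S R(2) subspace_scale insert.prems)
  finally have sum: "(\<Sum>i\<in>I. (a i - a j) *\<^sub>R x i) \<in> S" .
  have I: "x i \<in> S" if i: "i \<in> I" for i
  proof -
    have "(a i - a j) *\<^sub>R x i \<in> S"
      by (rule insert.IH[of "\<lambda>i. (a i - a j) *\<^sub>R x i", OF _ _ sum i])
         (use insert.prems in \<open>auto simp: linear_scale[OF R(1)] inj_on_insert\<close>)
    moreover have "a i \<noteq> a j" using insert.prems(1) i insert.hyps(2) by (auto simp: inj_on_def)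
    ultimately show ?thesis using subspace_scale[OF S, of "(a i - a j) *\<^sub>R x i" "1 / (a i - a j)"] by simp
  qed
  have "x j = ?y - (\<Sum>i\<in>I. x i)" using insert.hyps by simp
  also have "\<dots> \<in> S" by (intro subspace_diff S subspace_sum insert.prems I)
  finally show ?case using I insert.prems(4) by auto
qed simp

section \<open>Spanning as a determinant condition\<close>

definition polynomial_matrix :: "(real \<Rightarrow> real ^ 'n ^ 'm) \<Rightarrow> bool"
  where "polynomial_matrix p \<longleftrightarrow> (\<forall>i j. real_polynomial_function (\<lambda>t. p t $ i $ j))"

lemma polynomial_matrix_line: "polynomial_matrix (\<lambda>t. X + t *\<^sub>R Y)"
  unfolding polynomial_matrix_def vector_add_component vector_scaleR_component real_scaleR_def
  by (rule allI)+ (rule real_polynomial_function.intros(3)[OF real_polynomial_function.intros(2)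
      real_polynomial_function.intros(4)[OF real_polynomial_function.intros(1)[OF bounded_linear_ident]
        real_polynomial_function.intros(2)]])

lemma real_polynomial_function_finite_roots:
  fixes p :: "real \<Rightarrow> real"
  assumes "real_polynomial_function p" "p t0 \<noteq> 0"
  shows "finite {t. p t = 0}"
proof -
  obtain a n where p: "p = (\<lambda>x. \<Sum>i\<le>n. a i * x ^ i)"
    using assms(1) real_polynomial_function_iff_sum by blast
  have "\<exists>i\<le>n. a i \<noteq> 0"
  proof (rule ccontr)
    assume "\<not> (\<exists>i\<le>n. a i \<noteq> 0)"
    then have "p t0 = 0" by (simp add: p)
    then show False using assms(2) by simp
  qed
  then show ?thesis unfolding p polyfun_finite_roots .
qed

lemma real_polynomial_function_det:
  assumes "polynomial_matrix A"
  shows "real_polynomial_function (\<lambda>t. det (A t :: real ^ 'n ^ 'n))"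
proof -
  have "real_polynomial_function (\<lambda>t. of_int (sign p) * (\<Prod>i\<in>UNIV. A t $ i $ p i))" for p
    using assms unfolding polynomial_matrix_def
    by (intro real_polynomial_function.intros(4) real_polynomial_function.intros(2) real_polynomial_function_prod) auto
  then show ?thesis unfolding det_def by (intro real_polynomial_function_sum) (auto simp: finite_permutations)
qed

text \<open>With matrices read as vectors indexed by pairs, a family of matrices that is itself
  indexed by pairs becomes a square matrix and has a determinant.\<close>

definition flatten :: "real ^ 'm ^ 'n \<Rightarrow> real ^ ('n \<times> 'm)"
  where "flatten X = (\<chi> k. X $ fst k $ snd k)"

lemma linear_flatten: "linear flatten"
  by (intro linearI) (simp_all add: flatten_def vec_eq_iff)

lemma inj_flatten: "inj flatten"
proof (rule injI)
  fix X Y :: "real ^ 'm ^ 'n" assume eq: "flatten X = flatten Y"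
  have "X $ i $ j = Y $ i $ j" for i j
    using arg_cong[OF eq, of "\<lambda>v. v $ (i, j)"] by (simp add: flatten_def)
  then show "X = Y" by (simp add: vec_eq_iff)
qed

lemma surj_flatten: "surj flatten"
proof (rule surjI)
  show "flatten (\<chi> i j. v $ (i, j)) = v" for v :: "real ^ ('n::finite \<times> 'm::finite)"
    by (simp add: flatten_def vec_eq_iff)
qed

lemma span_family_iff_det:
  fixes a :: "'n \<times> 'm \<Rightarrow> real ^ 'm ^ 'n"
  shows "span (range a) = UNIV \<longleftrightarrow> det (\<chi> k. flatten (a k)) \<noteq> 0"
proof -
  let ?A = "\<chi> k. flatten (a k)"
  have "rows ?A = flatten ` range a"
    by (auto simp: rows_def row_def vec_lambda_eta)
  then have "span (rows ?A) = flatten ` span (range a)" by (simp add: linear_span_image[OF linear_flatten])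
  then have "span (rows ?A) = UNIV \<longleftrightarrow> span (range a) = UNIV"
    using inj_image_eq_iff[OF inj_flatten, of "span (range a)" UNIV] unfolding surj_flatten by simp
  then show ?thesis using matrix_left_invertible_span_rows[of ?A] invertible_det_nz[of ?A] invertible_left_inverse[of ?A] by simp
qed

text \<open>A finite certificate: functions whose values at \<open>x0\<close> form a basis are fixed
  once, and their determinant decides at every other \<open>x\<close>. Spanning thereby becomes a
  question about zeros of one function.\<close>

lemma span_witness:
  fixes P :: "('p \<Rightarrow> real ^ 'm ^ 'n) set"
  assumes "span {p x0 |p. p \<in> P} = UNIV"
  obtains a where "\<And>k. a k \<in> P" "det (\<chi> k. flatten (a k x0)) \<noteq> 0"
    "\<And>x. det (\<chi> k. flatten (a k x)) \<noteq> 0 \<Longrightarrow> span {p x |p. p \<in> P} = UNIV"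
proof -
  let ?V = "{p x0 |p. p \<in> P}"
  obtain Bs where Bs: "Bs \<subseteq> ?V" "independent Bs" "?V \<subseteq> span Bs" "card Bs = dim ?V"
    using basis_exists by blast
  have spB: "span Bs = UNIV" using span_minimal[OF Bs(3) subspace_span] unfolding assms by blast
  have "dim ?V = CARD('n \<times> 'm)"
    using dim_span[of ?V] unfolding assms by simp
  then have "card Bs = card (UNIV :: ('n \<times> 'm) set)" using Bs(4) by simp
  moreover have "finite Bs" using Bs(2) independent_imp_finite by blast
  ultimately obtain \<phi> where \<phi>: "bij_betw \<phi> (UNIV :: ('n \<times> 'm) set) Bs"
    using finite_same_card_bij[of "UNIV :: ('n \<times> 'm) set" Bs] by auto
  have "\<forall>k. \<exists>p. p \<in> P \<and> p x0 = \<phi> k"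
  proof
    fix k
    have "\<phi> k \<in> ?V" using Bs(1) bij_betw_apply[OF \<phi>, of k] by blast
    then show "\<exists>p. p \<in> P \<and> p x0 = \<phi> k"
      unfolding mem_Collect_eq by (elim exE conjE) (intro exI conjI, assumption, rule sym)
  qed
  from choice[OF this] obtain a where "\<forall>k. a k \<in> P \<and> a k x0 = \<phi> k" by (rule exE)
  then have a: "\<And>k. a k \<in> P" "\<And>k. a k x0 = \<phi> k" by blast+
  have "span (range (\<lambda>k. a k x0)) = UNIV" using spB bij_betw_imp_surj_on[OF \<phi>] by (simp add: a(2))
  then have "det (\<chi> k. flatten (a k x0)) \<noteq> 0" by (simp add: span_family_iff_det)
  moreover have "span {p x |p. p \<in> P} = UNIV" if "det (\<chi> k. flatten (a k x)) \<noteq> 0" for x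
  proof -
    have "range (\<lambda>k. a k x) \<subseteq> {p x |p. p \<in> P}" using a(1) by auto
    from span_mono[OF this] show ?thesis using that span_family_iff_det[of "\<lambda>k. a k x"] by auto
  qed
  ultimately show ?thesis by (rule that[OF a(1)])
qed

lemma span_polynomial_family:
  fixes P :: "(real \<Rightarrow> real ^ 'm ^ 'n) set"
  assumes P: "\<And>p. p \<in> P \<Longrightarrow> polynomial_matrix p" and "span {p t0 |p. p \<in> P} = UNIV"
  shows "finite {t. span {p t |p. p \<in> P} \<noteq> UNIV}"
proof -
  obtain a where a: "\<And>k. a k \<in> P" "det (\<chi> k. flatten (a k t0)) \<noteq> 0"
    "\<And>x. det (\<chi> k. flatten (a k x)) \<noteq> 0 \<Longrightarrow> span {p x |p. p \<in> P} = UNIV"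
    by (rule span_witness[OF assms(2)]) (rule that)
  have "polynomial_matrix (\<lambda>t. \<chi> k. flatten (a k t))"
    using P[OF a(1)] by (simp add: polynomial_matrix_def flatten_def)
  from real_polynomial_function_finite_roots[OF real_polynomial_function_det[OF this], of t0] a(2)
  have "finite {t. det (\<chi> k. flatten (a k t)) = 0}" by simp
  then show ?thesis by (rule rev_finite_subset) (use a(3) in auto)
qed

section \<open>The skew product and its structure constants\<close>

definition skew_part :: "real ^ 'n ^ 'n \<Rightarrow> real ^ 'n ^ 'n"
  where "skew_part X = (1 / 2) *\<^sub>R (X - transpose X)"

text \<open>On entry \<open>(i, j)\<close> the commutator with the diagonal matrix of
  \<open>c\<close> multiplies by \<open>c $ i - c $ j\<close> and the inertia operator by
  \<open>c $ i + c $ j\<close>; the Euler field applies the quotient to the squared matrix.\<close>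

definition rb_coeff :: "real ^ 'n \<Rightarrow> 'n \<Rightarrow> 'n \<Rightarrow> real"
  where "rb_coeff c i j = (c $ i - c $ j) / (c $ i + c $ j)"

text \<open>The polarisation of the Euler field for \<open>diag c\<close>, extended to all matrices so that symmetric parts
  are ignored.\<close>

definition rb :: "real ^ 'n \<Rightarrow> real ^ 'n ^ 'n \<Rightarrow> real ^ 'n ^ 'n \<Rightarrow> real ^ 'n ^ 'n"
  where "rb c X Y = (\<chi> i j. rb_coeff c i j / 2 *
    (skew_part X ** skew_part Y + skew_part Y ** skew_part X) $ i $ j)"

definition sym_matrices :: "(real ^ 'n ^ 'n) set"
  where "sym_matrices = {X. transpose X = X}"

lemma skew_part_component: "skew_part X $ i $ j = (X $ i $ j - X $ j $ i) / 2"
  by (simp add: skew_part_def transpose_def)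

lemma rb_component: "rb c X Y $ i $ j = rb_coeff c i j / 2 *
   (\<Sum>k\<in>UNIV. skew_part X $ i $ k * skew_part Y $ k $ j + skew_part Y $ i $ k * skew_part X $ k $ j)"
  by (simp add: rb_def matrix_matrix_mult_def sum.distrib)

lemma rb_sym: "rb c X Y = rb c Y X"
  by (simp add: rb_def add.commute)

lemma bilinear_rb: "bilinear (rb c)"
proof -
  have add: "skew_part (X + Y) $ i $ j = skew_part X $ i $ j + skew_part Y $ i $ j"
    and scale: "skew_part (r *\<^sub>R X) $ i $ j = r * skew_part X $ i $ j" for X Y :: "real ^ 'a ^ 'a" and r i j
    by (simp_all add: skew_part_component field_simps)
  have "linear (rb c X)" for X
  proof (rule linearI)
    show "rb c X (Y + Z) = rb c X Y + rb c X Z" for Y Z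
      by (simp add: vec_eq_iff rb_component add sum.distrib algebra_simps)
    show "rb c X (r *\<^sub>R Y) = r *\<^sub>R rb c X Y" for r Y
      by (simp add: vec_eq_iff rb_component scale sum_distrib_left algebra_simps)
  qed
  moreover have "(\<lambda>X. rb c X Y) = rb c Y" for Y by (rule ext) (rule rb_sym)
  ultimately show ?thesis unfolding bilinear_def by simp
qed

lemma bounded_bilinear_rb: "bounded_bilinear (rb c)"
  using bilinear_rb unfolding bilinear_conv_bounded_bilinear .

lemma subspace_sym_matrices: "subspace (sym_matrices :: (real ^ 'n ^ 'n) set)"
  unfolding subspace_def sym_matrices_def by (simp add: transpose_plus transpose_scaleR) (simp add: transpose_def vec_eq_iff)

definition skew_unit :: "'n::finite \<Rightarrow> 'n \<Rightarrow> real ^ 'n ^ 'n"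
  where "skew_unit i j = (\<chi> a b. (if a = i \<and> b = j then 1 else 0) - (if a = j \<and> b = i then 1 else 0))"

lemma skew_unit_component: "skew_unit i j $ a $ b = (if a = i \<and> b = j then 1 else 0) - (if a = j \<and> b = i then 1 else 0)"
  by (simp add: skew_unit_def)

lemma skew_unit_antisym: "skew_unit i j $ b $ a = - skew_unit i j $ a $ b"
  unfolding skew_unit_component by (simp only: conj_commute minus_diff_eq)

lemma skew_part_skew_unit: "skew_part (skew_unit i j) = skew_unit i j"
proof -
  have "skew_part (skew_unit i j) $ a $ b = skew_unit i j $ a $ b" for a b
    unfolding skew_part_component skew_unit_antisym[of i j b a] by simp
  then show ?thesis unfolding vec_eq_iff by blast
qed

lemma skew_unit_swap: "skew_unit j i = - skew_unit i j"
  by (simp only: vec_eq_iff skew_unit_component vector_uminus_component minus_diff_eq simp_thms)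

lemma skew_unit_in_so: "skew_unit i j \<in> so"
  unfolding so_def mem_Collect_eq vec_eq_iff transpose_def vec_lambda_beta vector_uminus_component
  by (intro allI skew_unit_antisym)

lemma skew_unit_mult:
  assumes "i \<noteq> j" "j \<noteq> k" "i \<noteq> k"
  shows "(\<Sum>m\<in>UNIV. skew_unit i j $ a $ m * skew_unit j k $ m $ b) = (if a = i \<and> b = k then 1 else 0)"
proof -
  have "skew_unit i j $ a $ m * skew_unit j k $ m $ b = (if m = j then (if a = i \<and> b = k then 1 else 0) else 0)" for m
    using assms by (cases "m = j"; cases "a = i"; cases "b = k"; simp add: skew_unit_component)
  then show ?thesis by simp
qed

text \<open>These structure constants carry the whole generation argument: units sharing one index
  contract to the unit of the other two, up to a factor that vanishes only for equal
  moments.\<close>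

lemma rb_skew_unit:
  assumes "i \<noteq> j" "j \<noteq> k" "i \<noteq> k"
  shows "rb c (skew_unit i j) (skew_unit j k) = (rb_coeff c i k / 2) *\<^sub>R skew_unit i k"
proof -
  have swap: "skew_unit j k $ a $ m * skew_unit i j $ m $ b = skew_unit k j $ a $ m * skew_unit j i $ m $ b" for a m b
    unfolding skew_unit_swap[of k j] skew_unit_swap[of j i] by simp
  have comp: "rb c (skew_unit i j) (skew_unit j k) $ a $ b =
      rb_coeff c a b / 2 * ((if a = i \<and> b = k then 1 else 0) + (if a = k \<and> b = i then 1 else 0))" for a b
    unfolding rb_component skew_part_skew_unit sum.distrib swap
    using assms by (simp only: skew_unit_mult[of i j k] skew_unit_mult[of k j i] not_sym not_False_eq_True simp_thms)
  have anti: "rb_coeff c k i = - rb_coeff c i k"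
    using minus_divide_left[of "c $ i - c $ k" "c $ i + c $ k"] by (simp add: rb_coeff_def add.commute)
  have "rb c (skew_unit i j) (skew_unit j k) $ a $ b = ((rb_coeff c i k / 2) *\<^sub>R skew_unit i k) $ a $ b" for a b
    unfolding comp using assms anti
    by (cases "a = i \<and> b = k"; cases "a = k \<and> b = i"; simp add: skew_unit_component)
  then show ?thesis unfolding vec_eq_iff by blast
qed

text \<open>The square of a skew unit is diagonal, and \<open>rb_coeff\<close> vanishes on the
  diagonal: rotation in one principal plane is a steady motion.\<close>

lemma rb_skew_unit_self: "rb c (skew_unit i j) (skew_unit i j) = 0"
proof -
  have "(\<Sum>m\<in>UNIV. skew_unit i j $ a $ m * skew_unit i j $ m $ b) = 0" if "a \<noteq> b" for a b
  proof (rule sum.neutral, rule ballI)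
    fix m
    have zero: "skew_unit i j $ a $ b = 0" if "\<not> (a = i \<and> b = j \<or> a = j \<and> b = i)" for a b
    proof -
      have "\<not> (a = i \<and> b = j)" "\<not> (a = j \<and> b = i)" using that by auto
      then show ?thesis unfolding skew_unit_component by (simp only: if_False diff_self)
    qed
    have "\<not> (a = i \<and> m = j \<or> a = j \<and> m = i) \<or> \<not> (m = i \<and> b = j \<or> m = j \<and> b = i)"
      using \<open>a \<noteq> b\<close> by auto
    then consider "\<not> (a = i \<and> m = j \<or> a = j \<and> m = i)" | "\<not> (m = i \<and> b = j \<or> m = j \<and> b = i)"
      by (elim disjE)
    then show "skew_unit i j $ a $ m * skew_unit i j $ m $ b = 0"
    proof cases
      case 1 then show ?thesis unfolding zero[OF 1] by simp
    next
      case 2 then show ?thesis unfolding zero[OF 2] by simp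
    qed
  qed
  then have "rb_coeff c a b / 2 * ((\<Sum>m\<in>UNIV. skew_unit i j $ a $ m * skew_unit i j $ m $ b)
      + (\<Sum>m\<in>UNIV. skew_unit i j $ a $ m * skew_unit i j $ m $ b)) = 0" for a b
    by (cases "a = b") (simp_all add: rb_coeff_def)
  then have "rb c (skew_unit i j) (skew_unit i j) $ a $ b = 0" for a b
    unfolding rb_component skew_part_skew_unit sum.distrib .
  then show ?thesis unfolding vec_eq_iff by simp
qed

lemma skew_units_generate:
  fixes S :: "(real ^ 'n ^ 'n) set"
  assumes S: "subspace S" "sym_matrices \<subseteq> S" "\<And>i j. i \<noteq> j \<Longrightarrow> skew_unit i j \<in> S"
  shows "S = UNIV"
proof -
  have "X \<in> S" for X :: "real ^ 'n ^ 'n"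
  proof -
    \<comment> \<open>Every unordered pair of indices occurs twice in the double sum, hence the
      factor \<open>1 / 2\<close>.\<close>
    have "skew_part X = (1 / 2) *\<^sub>R (\<Sum>i\<in>UNIV. \<Sum>j\<in>UNIV. (skew_part X $ i $ j) *\<^sub>R skew_unit i j)"
    proof -
      have sum: "(\<Sum>i\<in>UNIV. \<Sum>j\<in>UNIV. skew_part X $ i $ j * skew_unit i j $ a $ b) = skew_part X $ a $ b - skew_part X $ b $ a" for a b
      proof -
        have "(\<Sum>j\<in>UNIV. skew_part X $ i $ j * skew_unit i j $ a $ b) =
          (if a = i then skew_part X $ i $ b else 0) - (if b = i then skew_part X $ i $ a else 0)" for i
        proof -
          have ifs: "x * (if P \<and> Q then 1 else 0) = (if Q then if P then x else 0 else 0)"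
            "x * (if Q \<and> P then 1 else 0) = (if Q then if P then x else 0 else 0)" for x :: real and P Q
            by simp_all
          have "skew_part X $ i $ j * skew_unit i j $ a $ b =
            (if b = j then (if a = i then skew_part X $ i $ j else 0) else 0) -
            (if a = j then (if b = i then skew_part X $ i $ j else 0) else 0)" for j
            unfolding skew_unit_component right_diff_distrib
              ifs(1)[of _ "a = i" "b = j"] ifs(2)[of _ "a = j" "b = i"] ..
          then show ?thesis by (simp add: sum_subtractf)
        qed
        then have "(\<Sum>i\<in>UNIV. \<Sum>j\<in>UNIV. skew_part X $ i $ j * skew_unit i j $ a $ b) =
          (\<Sum>i\<in>UNIV. if a = i then skew_part X $ i $ b else 0) - (\<Sum>i\<in>UNIV. if b = i then skew_part X $ i $ a else 0)"
          by (simp only: sum_subtractf)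
        then show ?thesis by simp
      qed
      have anti: "skew_part X $ b $ a = - skew_part X $ a $ b" for a b
        using minus_divide_left[of "X $ a $ b - X $ b $ a" 2] by (simp add: skew_part_component)
      have "skew_part X $ a $ b = ((1 / 2) *\<^sub>R (\<Sum>i\<in>UNIV. \<Sum>j\<in>UNIV. (skew_part X $ i $ j) *\<^sub>R skew_unit i j)) $ a $ b" for a b
        unfolding vector_scaleR_component sum_component real_scaleR_def sum[of a b] anti[of b a] by simp
      then show ?thesis unfolding vec_eq_iff by blast
    qed
    also have "\<dots> \<in> S"
    proof (intro subspace_scale S(1) subspace_sum)
      show "skew_unit i j \<in> S" for i j
      proof (cases "i = j")
        case True
        then have "skew_unit i j = 0" by (simp add: vec_eq_iff skew_unit_component)
        then show ?thesis using subspace_0[OF S(1)] by simp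
      qed (rule S(3))
    qed
    finally have "skew_part X \<in> S" .
    moreover have "X - skew_part X \<in> S"
    proof -
      have "X - skew_part X = (1 / 2) *\<^sub>R (X + transpose X)"
        by (simp add: vec_eq_iff skew_part_component transpose_def field_simps)
      then have "transpose (X - skew_part X) = X - skew_part X"
        by (simp only: transpose_scaleR transpose_plus transpose_transpose add.commute)
      then show ?thesis using S(2) unfolding sym_matrices_def by blast
    qed
    ultimately have "skew_part X + (X - skew_part X) \<in> S" by (rule subspace_add[OF S(1)])
    then show ?thesis by simp
  qed
  then show ?thesis by blast
qed

locale distinct_inertia =
  fixes c :: "real ^ 'n"
  assumes pos: "\<And>i. 0 < c $ i" and distinct: "inj (($) c)" and dim3: "CARD('n) \<ge> 3"
begin

lemma coeff_nonzero: "i \<noteq> j \<Longrightarrow> rb_coeff c i j \<noteq> 0"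
  using pos[of i] pos[of j] injD[OF distinct, of i j] by (auto simp: rb_coeff_def)

lemma two_smallest:
  obtains p q where "p \<noteq> q" "c $ p < c $ q" "\<And>k. k \<noteq> p \<Longrightarrow> k \<noteq> q \<Longrightarrow> c $ q < c $ k"
proof -
  obtain p where p: "\<And>k. c $ p \<le> c $ k"
    using ex_min_if_finite[of "range (($) c)"] by (force simp: not_less)
  have ne: "UNIV - {p} \<noteq> {}" using dim3 card_mono[of "{p}" UNIV] by auto
  obtain q where q: "q \<in> UNIV - {p}" "\<And>k. k \<in> UNIV - {p} \<Longrightarrow> c $ q \<le> c $ k"
    using ex_min_if_finite[of "($) c ` (UNIV - {p})"] ne by (force simp: not_less)
  have lt: "c $ i < c $ j" if "c $ i \<le> c $ j" "i \<noteq> j" for i j using that injD[OF distinct, of i j] by fastforce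
  show ?thesis using that[of p q] p q lt by auto
qed

text \<open>On the span of the \<open>skew_unit p k\<close> the square of the product with \<open>skew_unit p q\<close> is diagonal; its
  eigenvalues are distinct because \<open>p\<close> and \<open>q\<close> carry the two smallest moments.\<close>

lemma generation:
  assumes pq: "p \<noteq> q" "c $ p < c $ q" "\<And>k. k \<noteq> p \<Longrightarrow> k \<noteq> q \<Longrightarrow> c $ q < c $ k"
    and S: "subspace S" "sym_matrices \<subseteq> S" "\<And>X Y. X \<in> S \<Longrightarrow> Y \<in> S \<Longrightarrow> rb c X Y \<in> S"
    and e: "skew_unit p q \<in> S" and v: "(\<Sum>k\<in>UNIV - {p, q}. rb_coeff c p k *\<^sub>R skew_unit p k) \<in> S"
  shows "S = UNIV"
proof -
  interpret rb: bounded_bilinear "rb c" by (rule bounded_bilinear_rb)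
  \<comment> \<open>The factor 2 cancels the \<open>1 / 2\<close> in
    \<open>rb_skew_unit\<close>.\<close>
  define T where "T X = 2 *\<^sub>R rb c (skew_unit p q) X" for X
  have linT: "linear T" unfolding T_def
    by (intro bounded_linear.linear bounded_linear_intros rb.bounded_linear_right)
  have TS: "T X \<in> S" if "X \<in> S" for X unfolding T_def by (intro subspace_scale S e that)
  have Tp: "T (skew_unit p k) = - (rb_coeff c q k *\<^sub>R skew_unit q k)" if "k \<noteq> p" "k \<noteq> q" for k
    unfolding T_def skew_unit_swap[of p q]
    using rb_skew_unit[of q p k c] that pq(1) by (simp add: rb.minus_left)
  have Tq: "T (skew_unit q k) = rb_coeff c p k *\<^sub>R skew_unit p k" if "k \<noteq> p" "k \<noteq> q" for k
    unfolding T_def using rb_skew_unit[of p q k c] that pq(1) by simp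
  define a where "a k = - (rb_coeff c q k * rb_coeff c p k)" for k
  have TT: "T (T (skew_unit p k)) = a k *\<^sub>R skew_unit p k" if "k \<noteq> p" "k \<noteq> q" for k
    using that by (simp add: Tp Tq linear_neg[OF linT] linear_scale[OF linT] a_def)
  have inj: "inj_on a (UNIV - {p, q})"
  proof (rule inj_onI)
    fix k l assume k: "k \<in> UNIV - {p, q}" and l: "l \<in> UNIV - {p, q}" and eq: "a k = a l"
    define x y P Q where "x = c $ k" and "y = c $ l" and "P = c $ p" and "Q = c $ q"
    have xy: "0 < P" "P < Q" "Q < x" "Q < y" using k l pq pos by (auto simp: x_def y_def P_def Q_def)
    have "(Q - x) / (Q + x) * ((P - x) / (P + x)) = (Q - y) / (Q + y) * ((P - y) / (P + y))"
      using eq by (simp add: a_def rb_coeff_def x_def y_def P_def Q_def)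
    then have "(Q - x) * (P - x) * ((Q + y) * (P + y)) = (Q - y) * (P - y) * ((Q + x) * (P + x))"
      using xy by (simp add: frac_eq_eq)
    \<comment> \<open>Cross-multiplied, the equality of eigenvalues factors. Since \<open>P\<close>
      and \<open>Q\<close> are the two smallest moments, \<open>x * y - P * Q\<close> is positive,
      which leaves \<open>x = y\<close>.\<close>
    then have "2 * (P + Q) * ((x - y) * (x * y - P * Q)) = 0" by (simp add: algebra_simps)
    moreover have "P * Q < x * y" using xy by (intro mult_strict_mono) auto
    ultimately have "x = y" using xy by auto
    then show "k = l" using injD[OF distinct] by (simp add: x_def y_def)
  qed
  have Sp: "skew_unit p k \<in> S" if k: "k \<noteq> p" "k \<noteq> q" for k
  proof -
    have "rb_coeff c p k *\<^sub>R skew_unit p k \<in> S"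
    proof (rule eigenvector_components_in_subspace[of "UNIV - {p, q}" a S "T \<circ> T"])
      show "linear (T \<circ> T)" by (rule linear_compose[OF linT linT])
      show "(T \<circ> T) (rb_coeff c p i *\<^sub>R skew_unit p i) = a i *\<^sub>R rb_coeff c p i *\<^sub>R skew_unit p i"
        if "i \<in> UNIV - {p, q}" for i
        using that by (simp add: linear_scale[OF linT] TT)
    qed (use inj S TS v k in auto)
    from subspace_scale[OF S(1) this, of "1 / rb_coeff c p k"] show ?thesis using coeff_nonzero[of p k] k by auto
  qed
  \<comment> \<open>The remaining units follow from those containing \<open>p\<close>:
    \<open>T\<close> turns the index \<open>p\<close> into \<open>q\<close>, and products contracted
    over \<open>p\<close> yield the units with neither index.\<close>
  have Sq: "skew_unit q k \<in> S" if k: "k \<noteq> p" "k \<noteq> q" for k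
    using subspace_scale[OF S(1) TS[OF Sp[OF k]], of "- 1 / rb_coeff c q k"] coeff_nonzero[of q k] k
    by (simp add: Tp)
  have neg: "skew_unit j i \<in> S" if "skew_unit i j \<in> S" for i j
    using subspace_neg[OF S(1) that] by (simp add: skew_unit_swap[of j i])
  have Skl: "skew_unit k l \<in> S" if "k \<noteq> p" "k \<noteq> q" "l \<noteq> p" "l \<noteq> q" "k \<noteq> l" for k l
  proof -
    have "rb c (skew_unit k p) (skew_unit p l) \<in> S" using that by (intro S Sp neg[OF Sp])
    then have "(rb_coeff c k l / 2) *\<^sub>R skew_unit k l \<in> S" using that rb_skew_unit[of k p l c] by simp
    from subspace_scale[OF S(1) this, of "2 / rb_coeff c k l"] show ?thesis using coeff_nonzero[of k l] that by simp
  qed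
  show ?thesis
  proof (rule skew_units_generate[OF S(1,2)])
    fix i j :: 'n assume "i \<noteq> j"
    then consider "i = p" "j = q" | "i = q" "j = p" | "i = p" "j \<noteq> p" "j \<noteq> q" | "i = q" "j \<noteq> p" "j \<noteq> q"
      | "j = p" "i \<noteq> p" "i \<noteq> q" | "j = q" "i \<noteq> p" "i \<noteq> q" | "i \<noteq> p" "i \<noteq> q" "j \<noteq> p" "j \<noteq> q" by blast
    then show "skew_unit i j \<in> S"
      by cases (use e neg Sp Sq Skl \<open>i \<noteq> j\<close> in auto)
  qed
qed

text \<open>Monomials are functions of a parameter rather than matrices, so a spanning choice at one
  parameter value can be tested at all others. Symmetric matrices enter as constants.\<close>

inductive_set monomials :: "('p \<Rightarrow> real ^ 'n ^ 'n) set \<Rightarrow> ('p \<Rightarrow> real ^ 'n ^ 'n) set" for A where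
  base: "p \<in> A \<Longrightarrow> p \<in> monomials A"
| sym: "n \<in> sym_matrices \<Longrightarrow> (\<lambda>_. n) \<in> monomials A"
| prod: "p \<in> monomials A \<Longrightarrow> q \<in> monomials A \<Longrightarrow> (\<lambda>x. rb c (p x) (q x)) \<in> monomials A"

definition generated :: "('p \<Rightarrow> real ^ 'n ^ 'n) set \<Rightarrow> 'p \<Rightarrow> (real ^ 'n ^ 'n) set"
  where "generated A x = span {p x |p. p \<in> monomials A}"

lemma generated_monomial: "p \<in> monomials A \<Longrightarrow> p x \<in> generated A x"
  unfolding generated_def by (rule span_base) blast

lemma generated_subspace: "subspace (generated A x)"
  by (simp add: generated_def subspace_span)

lemma generated_prod:
  assumes "X \<in> generated A x" "Y \<in> generated A x"
  shows "rb c X Y \<in> generated A x"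
proof -
  interpret rb: bounded_bilinear "rb c" by (rule bounded_bilinear_rb)
  have 1: "rb c (p x) Y \<in> generated A x" if p: "p \<in> monomials A" and Y: "Y \<in> generated A x" for p Y
    using Y unfolding generated_def
  proof (induction rule: span_induct)
    case base
    show ?case by (rule linear_subspace_vimage[OF bounded_linear.linear[OF rb.bounded_linear_right] subspace_span, unfolded vimage_def])
  next
    case (step z)
    then obtain q where "q \<in> monomials A" "z = q x" by blast
    then show ?case using generated_monomial[OF monomials.prod[OF p], of q x] by (simp add: generated_def)
  qed
  show ?thesis
    using assms(1) unfolding generated_def
  proof (induction rule: span_induct)
    case base
    show ?case by (rule linear_subspace_vimage[OF bounded_linear.linear[OF rb.bounded_linear_left] subspace_span, unfolded vimage_def])
  next
    case (step z)
    then obtain p where "p \<in> monomials A" "z = p x" by blast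
    then show ?case using 1[OF _ assms(2), of p] by (simp add: generated_def)
  qed
qed

lemma generated_sym: "sym_matrices \<subseteq> generated A x"
  by (rule subsetI) (rule generated_monomial[OF monomials.sym])

lemma generated_minimal:
  assumes S: "subspace S" "sym_matrices \<subseteq> S" "\<And>X Y. X \<in> S \<Longrightarrow> Y \<in> S \<Longrightarrow> rb c X Y \<in> S"
    and A: "\<And>p. p \<in> A \<Longrightarrow> p x \<in> S"
  shows "generated A x \<subseteq> S"
proof -
  have "p x \<in> S" if "p \<in> monomials A" for p
    using that by induction (use A S in auto)
  then show ?thesis unfolding generated_def using S(1) by (intro span_minimal) auto
qed

lemma polynomial_monomials:
  assumes "\<And>p. p \<in> A \<Longrightarrow> polynomial_matrix p" "p \<in> monomials A"
  shows "polynomial_matrix p"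
  using assms(2)
proof induction
  case (prod p q)
  have s: "real_polynomial_function (\<lambda>x. skew_part (p x) $ i $ j)" if "polynomial_matrix p" for p :: "real \<Rightarrow> real ^ 'n ^ 'n" and i j
    using that unfolding skew_part_component polynomial_matrix_def divide_inverse
    by (intro real_polynomial_function.intros(4) real_polynomial_function.intros(2) real_polynomial_function_diff) auto
  show ?case
    unfolding polynomial_matrix_def rb_component
    by (intro allI real_polynomial_function.intros(4) real_polynomial_function.intros(3) real_polynomial_function.intros(2)
        real_polynomial_function_sum s prod finite)
qed (use assms(1) in \<open>auto simp: polynomial_matrix_def\<close>)

lemma generated_finite_exceptions:
  assumes "\<And>p. p \<in> A \<Longrightarrow> polynomial_matrix p" "generated A t0 = UNIV"
  shows "finite {t. generated A t \<noteq> UNIV}"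
  unfolding generated_def
proof (rule span_polynomial_family)
  show "polynomial_matrix p" if "p \<in> monomials A" for p using polynomial_monomials[OF assms(1) that] .
  show "span {p t0 |p. p \<in> monomials A} = UNIV" using assms(2) unfolding generated_def .
qed

definition generic :: "(real ^ 'n ^ 'n) set"
  where "generic = {G \<in> so. generated {\<lambda>x. x} G = UNIV}"

text \<open>Closure under squares is closure under products, by polarisation.\<close>

lemma generic_generating:
  assumes "G \<in> generic" "subspace S" "sym_matrices \<subseteq> S" "G \<in> S" "\<And>w. w \<in> S \<Longrightarrow> rb c w w \<in> S"
  shows "S = UNIV"
proof -
  interpret rb: bounded_bilinear "rb c" by (rule bounded_bilinear_rb)
  have "rb c X Y \<in> S" if "X \<in> S" "Y \<in> S" for X Y
  proof -
    have "rb c (X + Y) (X + Y) - rb c X X - rb c Y Y \<in> S"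
      by (intro subspace_diff subspace_add that assms(2,5))
    moreover have "rb c (X + Y) (X + Y) - rb c X X - rb c Y Y = 2 *\<^sub>R rb c X Y"
      by (simp add: rb.add_left rb.add_right rb_sym[of c Y X] scaleR_2)
    ultimately have "(1 / 2) *\<^sub>R (2 *\<^sub>R rb c X Y) \<in> S" by (rule subspace_scale[OF assms(2), OF back_subst[of "\<lambda>x. x \<in> S"]])
    then show ?thesis by simp
  qed
  then have "generated {\<lambda>x. x} G \<subseteq> S" using assms by (intro generated_minimal) auto
  then show ?thesis using assms(1) by (auto simp: generic_def)
qed

text \<open>Take \<open>G\<close> to be a skew unit \<open>e\<close> plus \<open>t\<close> times
  \<open>H\<close>. Because \<open>rb c e e = 0\<close>, the square of \<open>G\<close> is divisible
  by \<open>t\<close>, and the quotient is again polynomial in \<open>t\<close>. At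
  \<open>t = 0\<close>, \<open>G\<close> and this quotient become the two generators required by
  \<open>generation\<close>, so they generate for all but finitely many \<open>t\<close>.\<close>

lemma generic_exists: "generic \<noteq> {}"
proof -
  interpret rb: bounded_bilinear "rb c" by (rule bounded_bilinear_rb)
  obtain p q where pq: "p \<noteq> q" "c $ p < c $ q" "\<And>k. k \<noteq> p \<Longrightarrow> k \<noteq> q \<Longrightarrow> c $ q < c $ k"
    using two_smallest by blast
  let ?e = "skew_unit p q"
  \<comment> \<open>Units with index \<open>q\<close> are chosen because their products with
    \<open>?e\<close> lie along the units \<open>skew_unit p k\<close>, with coefficients
    \<open>rb_coeff c p k\<close>.\<close>
  define H where "H = (\<Sum>k\<in>UNIV - {p, q}. skew_unit q k)"
  define A where "A = {\<lambda>t::real. ?e + t *\<^sub>R H, \<lambda>t. 2 *\<^sub>R rb c ?e H + t *\<^sub>R rb c H H}"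
  have poly: "polynomial_matrix r" if "r \<in> A" for r
    using that by (auto simp: A_def intro: polynomial_matrix_line)
  have v: "2 *\<^sub>R rb c ?e H = (\<Sum>k\<in>UNIV - {p, q}. rb_coeff c p k *\<^sub>R skew_unit p k)"
    unfolding H_def rb.sum_right scaleR_sum_right
    using rb_skew_unit[of p q _ c] pq(1) by (intro sum.cong) auto
  have "generated A 0 = UNIV"
  proof (rule generation[OF pq generated_subspace generated_sym generated_prod])
    have "(\<lambda>t. ?e + t *\<^sub>R H) \<in> monomials A" by (rule monomials.base) (simp add: A_def)
    from generated_monomial[OF this, of 0] show "?e \<in> generated A 0" by simp
    have "(\<lambda>t. 2 *\<^sub>R rb c ?e H + t *\<^sub>R rb c H H) \<in> monomials A" by (rule monomials.base) (simp add: A_def)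
    from generated_monomial[OF this, of 0] v
    show "(\<Sum>k\<in>UNIV - {p, q}. rb_coeff c p k *\<^sub>R skew_unit p k) \<in> generated A 0" by simp
  qed
  from generated_finite_exceptions[OF poly this]
  \<comment> \<open>The value 0 is excluded too, since recovering the quotient from the square of
    \<open>G\<close> divides by \<open>t\<close>.\<close>
  have "finite (insert 0 {t. generated A t \<noteq> UNIV})" by simp
  then obtain t where t: "t \<noteq> 0" "generated A t = UNIV"
    using ex_new_if_finite[OF infinite_UNIV_char_0] by blast
  define G where "G = ?e + t *\<^sub>R H"
  have "generated A t \<subseteq> generated {\<lambda>x. x} G"
  proof (rule generated_minimal[OF generated_subspace generated_sym generated_prod])
    fix r assume "r \<in> A"
    have G: "G \<in> generated {\<lambda>x. x} G"
      using generated_monomial[OF monomials.base, of "\<lambda>x. x" "{\<lambda>x. x}" G] by simp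
    have "rb c G G = t *\<^sub>R (2 *\<^sub>R rb c ?e H + t *\<^sub>R rb c H H)"
      by (simp add: G_def rb.add_left rb.add_right rb.scaleR_left rb.scaleR_right rb_skew_unit_self
          rb_sym[of c H ?e] scaleR_2 scaleR_add_right)
    then have "2 *\<^sub>R rb c ?e H + t *\<^sub>R rb c H H = (1 / t) *\<^sub>R rb c G G" using t(1) by simp
    also have "\<dots> \<in> generated {\<lambda>x. x} G"
      by (intro subspace_scale generated_subspace generated_prod G)
    finally have "2 *\<^sub>R rb c ?e H + t *\<^sub>R rb c H H \<in> generated {\<lambda>x. x} G" .
    then show "r t \<in> generated {\<lambda>x. x} G"
      using \<open>r \<in> A\<close> G unfolding A_def G_def[symmetric] insert_iff empty_iff by (elim disjE) (simp_all flip: G_def)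
  qed
  moreover have "G \<in> so"
    unfolding G_def H_def by (intro subspace_add subspace_scale subspace_sum subspace_so skew_unit_in_so)
  ultimately show ?thesis using t(2) by (auto simp: generic_def)
qed

text \<open>On the line from \<open>G1\<close> to a generic \<open>G0\<close> only finitely many
  parameters are exceptional, so arbitrarily small positive ones are generic.\<close>

lemma generic_dense: "so \<subseteq> closure generic"
proof
  fix G1 :: "real ^ 'n ^ 'n" assume G1: "G1 \<in> so"
  obtain G0 where G0: "G0 \<in> so" "generated {\<lambda>x. x} G0 = UNIV" using generic_exists by (auto simp: generic_def)
  let ?\<gamma> = "\<lambda>t::real. G1 + t *\<^sub>R (G0 - G1)"
  \<comment> \<open>Two views of the same subspace: monomials in \<open>G\<close> evaluated at a
    point of the line, and monomials in the parameter \<open>t\<close>, which are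
    polynomial.\<close>
  have sub: "generated {\<lambda>x. x} (?\<gamma> t) = generated {?\<gamma>} t" for t
  proof
    show "generated {\<lambda>x. x} (?\<gamma> t) \<subseteq> generated {?\<gamma>} t"
      by (rule generated_minimal[OF generated_subspace generated_sym generated_prod])
         (use generated_monomial[OF monomials.base, of ?\<gamma> "{?\<gamma>}" t] in auto)
    show "generated {?\<gamma>} t \<subseteq> generated {\<lambda>x. x} (?\<gamma> t)"
      by (rule generated_minimal[OF generated_subspace generated_sym generated_prod])
         (use generated_monomial[OF monomials.base, of "\<lambda>x. x" "{\<lambda>x. x}" "?\<gamma> t"] in auto)
  qed
  have "polynomial_matrix ?\<gamma>"
    by (rule polynomial_matrix_line)
  then have fin: "finite {t. generated {?\<gamma>} t \<noteq> UNIV}"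
    using generated_finite_exceptions[of "{?\<gamma>}" 1] G0 sub[of 1] by auto
  show "G1 \<in> closure generic"
    unfolding closure_approachable
  proof (intro allI impI)
    fix \<epsilon> :: real assume \<epsilon>: "\<epsilon> > 0"
    define d where "d = \<epsilon> / (norm (G0 - G1) + 1)"
    have n1: "norm (G0 - G1) + 1 > 0" by (simp add: add_nonneg_pos)
    then have d: "d > 0" using \<epsilon> by (simp add: d_def)
    then have "infinite {0<..<d}" by simp
    then have "\<not> {0<..<d} \<subseteq> {t. generated {?\<gamma>} t \<noteq> UNIV}"
      using finite_subset[OF _ fin, of "{0<..<d}"] by blast
    then obtain t where t: "t \<in> {0<..<d}" "generated {?\<gamma>} t = UNIV" unfolding subset_iff by blast
    have "?\<gamma> t \<in> generic"
      using t(2) sub[of t] G1 G0(1) by (auto simp: generic_def intro!: subspace_add subspace_scale subspace_diff subspace_so)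
    moreover have "dist (?\<gamma> t) G1 < \<epsilon>"
    proof -
      have "dist (?\<gamma> t) G1 = t * norm (G0 - G1)" using t(1) by (simp add: dist_norm)
      also have "\<dots> \<le> t * (norm (G0 - G1) + 1)" using t(1) by (intro mult_left_mono) auto
      also have "\<dots> < d * (norm (G0 - G1) + 1)" using t(1) n1 by (intro mult_strict_right_mono) auto
      also have "\<dots> = \<epsilon>" using n1 by (simp add: d_def)
      finally show ?thesis .
    qed
    ultimately show "\<exists>y\<in>generic. dist y G1 < \<epsilon>" by blast
  qed
qed

lemma continuous_on_monomials:
  assumes "r \<in> monomials {\<lambda>x. x}"
  shows "continuous_on UNIV r"
  using assms
proof induction
  case (prod p q)
  then show ?case by (intro bounded_bilinear.continuous_on[OF bounded_bilinear_rb])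
qed auto

text \<open>The determinant that certifies generation at \<open>G\<close> is continuous, so it stays
  nonzero and certifies generation nearby.\<close>

lemma generic_open: "openin (top_of_set so) generic"
proof (subst openin_subopen, intro ballI)
  fix G assume "G \<in> generic"
  then have G: "G \<in> so" "span {p G |p. p \<in> monomials {\<lambda>x. x}} = UNIV" by (auto simp: generic_def generated_def)
  obtain a where a: "\<And>k. a k \<in> monomials {\<lambda>x. x}" "det (\<chi> k. flatten (a k G)) \<noteq> 0"
    "\<And>x. det (\<chi> k. flatten (a k x)) \<noteq> 0 \<Longrightarrow> span {p x |p. p \<in> monomials {\<lambda>x. x}} = UNIV"
    by (rule span_witness[OF G(2)]) (rule that)
  have "continuous_on UNIV (\<lambda>x. det (\<chi> k. flatten (a k x)))"
    unfolding det_def flatten_def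
    by (intro continuous_intros) (use continuous_on_monomials[OF a(1)] in \<open>auto intro!: continuous_intros\<close>)
  then have "open {x. det (\<chi> k. flatten (a k x)) \<noteq> 0}"
    by (intro open_Collect_neq continuous_intros)
  then have "openin (top_of_set so) (so \<inter> {x. det (\<chi> k. flatten (a k x)) \<noteq> 0})"
    by (rule openin_open_Int)
  then show "\<exists>T. openin (top_of_set so) T \<and> G \<in> T \<and> T \<subseteq> generic"
    using G(1) a(2,3) by (intro exI[of _ "so \<inter> {x. det (\<chi> k. flatten (a k x)) \<noteq> 0}"])
      (auto simp: generic_def generated_def)
qed

end

section \<open>Diagonalisation and measurable controls\<close>

definition diag_matrix :: "real ^ 'n \<Rightarrow> real ^ 'n ^ 'n"
  where "diag_matrix c = (\<chi> i j. if i = j then c $ i else 0)"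

lemma diag_matrix_mult:
  "(diag_matrix c ** X) $ i $ j = c $ i * X $ i $ j" "(X ** diag_matrix c) $ i $ j = X $ i $ j * c $ j"
proof -
  have "(diag_matrix c ** X) $ i $ j = (\<Sum>k\<in>UNIV. if i = k then c $ i * X $ k $ j else 0)"
    unfolding matrix_matrix_mult_def diag_matrix_def by (simp add: if_distrib if_distribR cong: if_cong)
  then show "(diag_matrix c ** X) $ i $ j = c $ i * X $ i $ j" by simp
  have "(X ** diag_matrix c) $ i $ j = (\<Sum>k\<in>UNIV. if k = j then X $ i $ k * c $ k else 0)"
    unfolding matrix_matrix_mult_def diag_matrix_def by (simp add: if_distrib if_distribR cong: if_cong)
  then show "(X ** diag_matrix c) $ i $ j = X $ i $ j * c $ j" by simp
qed

lemma inertia_diag: "inertia (diag_matrix c) X $ i $ j = (c $ i + c $ j) * X $ i $ j"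
  by (simp add: inertia_def diag_matrix_mult algebra_simps)

lemma so_component:
  assumes "X \<in> so"
  shows "X $ j $ i = - X $ i $ j"
proof -
  have "transpose X $ i $ j = (- X) $ i $ j" using assms by (simp add: so_def)
  then show ?thesis by (simp add: transpose_def)
qed

lemma skew_part_so:
  assumes "X \<in> so"
  shows "skew_part X = X"
proof -
  have "transpose X = - X" using assms by (simp add: so_def)
  then show ?thesis by (simp add: skew_part_def scaleR_2[symmetric])
qed

lemma skew_part_in_so: "skew_part X \<in> so"
  by (simp add: so_def skew_part_def transpose_scaleR transpose_minus scaleR_diff_right)

lemma linear_skew_part: "linear skew_part"
  by (rule linearI) (simp_all add: vec_eq_iff skew_part_component field_simps)

lemma skew_part_eq_0: "skew_part Z = 0 \<longleftrightarrow> Z \<in> sym_matrices"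
  by (simp add: skew_part_def sym_matrices_def eq_commute[of Z])

lemma rb_skew_part: "rb c (skew_part X) (skew_part Y) = rb c X Y"
  by (simp add: rb_def skew_part_so[OF skew_part_in_so])

lemma rb_coeff_antisym: "rb_coeff c j i = - rb_coeff c i j"
  using minus_divide_left[of "c $ i - c $ j" "c $ i + c $ j"] by (simp add: rb_coeff_def add.commute)

lemma rb_in_so: "rb c X Y \<in> so"
proof -
  have swap: "skew_part Z $ j $ i = - skew_part Z $ i $ j" for Z i j by (rule so_component[OF skew_part_in_so])
  have anti: "rb c X Y $ j $ i = - rb c X Y $ i $ j" for i j
  proof -
    have "(\<Sum>k\<in>UNIV. skew_part X $ j $ k * skew_part Y $ k $ i + skew_part Y $ j $ k * skew_part X $ k $ i) =
      (\<Sum>k\<in>UNIV. skew_part X $ i $ k * skew_part Y $ k $ j + skew_part Y $ i $ k * skew_part X $ k $ j)"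
    proof (rule sum.cong[OF refl])
      fix k
      have s: "skew_part X $ j $ k = - skew_part X $ k $ j" "skew_part Y $ k $ i = - skew_part Y $ i $ k"
        "skew_part Y $ j $ k = - skew_part Y $ k $ j" "skew_part X $ k $ i = - skew_part X $ i $ k"
        by (rule swap)+
      show "skew_part X $ j $ k * skew_part Y $ k $ i + skew_part Y $ j $ k * skew_part X $ k $ i =
        skew_part X $ i $ k * skew_part Y $ k $ j + skew_part Y $ i $ k * skew_part X $ k $ j"
        unfolding s by simp
    qed
    then show ?thesis unfolding rb_component rb_coeff_antisym[of c j i] by simp
  qed
  show ?thesis
    unfolding so_def mem_Collect_eq vec_eq_iff transpose_def vec_lambda_beta vector_uminus_component
    by (intro allI anti)
qed

context distinct_inertia begin

lemma sym_posdef_diag: "sym_posdef (diag_matrix c)"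
  unfolding sym_posdef_def
proof (intro conjI allI impI)
  show "transpose (diag_matrix c) = diag_matrix c"
    by (simp add: transpose_def diag_matrix_def vec_eq_iff)
  fix x :: "real ^ 'n" assume "x \<noteq> 0"
  then obtain k where k: "x $ k \<noteq> 0" by (auto simp: vec_eq_iff)
  have "(diag_matrix c *v x) $ i = c $ i * x $ i" for i
    unfolding matrix_vector_mult_def diag_matrix_def by (simp add: if_distrib if_distribR cong: if_cong)
  then have "x \<bullet> (diag_matrix c *v x) = (\<Sum>i\<in>UNIV. c $ i * (x $ i)\<^sup>2)"
    by (simp add: inner_vec_def power2_eq_square mult_ac)
  also have "\<dots> > 0"
  proof (rule sum_pos2[of UNIV k])
    show "0 < c $ k * (x $ k)\<^sup>2" using pos[of k] k by simp
    show "0 \<le> c $ i * (x $ i)\<^sup>2" for i using pos[of i] by simp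
  qed auto
  finally show "0 < x \<bullet> (diag_matrix c *v x)" .
qed

lemma euler_field_diag:
  assumes "W \<in> so"
  shows "euler_field (diag_matrix c) W = rb c W W"
proof -
  have "inertia (diag_matrix c) (rb c W W) $ i $ j = commutator (diag_matrix c) (W ** W) $ i $ j" for i j
  proof -
    have "(c $ i + c $ j) * rb_coeff c i j = c $ i - c $ j" using pos[of i] pos[of j] by (simp add: rb_coeff_def)
    moreover have "(c $ i + c $ j) * (rb_coeff c i j / 2 * ((W ** W) $ i $ j + (W ** W) $ i $ j)) =
        ((c $ i + c $ j) * rb_coeff c i j) * (W ** W) $ i $ j" by simp
    moreover have "(c $ i - c $ j) * (W ** W) $ i $ j = c $ i * (W ** W) $ i $ j - (W ** W) $ i $ j * c $ j"
      by (simp add: algebra_simps)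
    ultimately show ?thesis
      unfolding inertia_diag rb_def commutator_def vector_minus_component diag_matrix_mult skew_part_so[OF assms]
        vec_lambda_beta vector_add_component by metis
  qed
  then have "inertia (diag_matrix c) (rb c W W) = commutator (diag_matrix c) (W ** W)" by (simp add: vec_eq_iff)
  then show ?thesis
    unfolding euler_field_def inertia_inv_def
    by (rule inv_into_f_eq[OF bij_betw_imp_inj_on[OF inertia_bij[OF sym_posdef_diag]] rb_in_so])
qed

text \<open>The inertia factor turns \<open>rb_coeff\<close> back into \<open>c $ i - c $ j\<close>.
  With \<open>K\<close> the skew part and \<open>Q\<close> its square, the sum reduces to moments
  times diagonal entries of the cube of \<open>K\<close>, which vanish because the cube is
  skew.\<close>

lemma rb_conserved: "inertia (diag_matrix c) X \<bullet> rb c X X = 0"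
proof -
  define K where "K = skew_part X"
  define Q where "Q = K ** K"
  have K: "K $ j $ i = - K $ i $ j" for i j unfolding K_def by (rule so_component[OF skew_part_in_so])
  have Q: "Q $ j $ i = Q $ i $ j" for i j
  proof -
    have s: "K $ j $ k = - K $ k $ j" "K $ k $ i = - K $ i $ k" for k by (rule K)+
    have "K $ j $ k * K $ k $ i = K $ i $ k * K $ k $ j" for k unfolding s by simp
    then show ?thesis unfolding Q_def matrix_matrix_mult_def by simp
  qed
  have "inertia (diag_matrix c) X \<bullet> rb c X X = (\<Sum>i\<in>UNIV. \<Sum>j\<in>UNIV. (c $ i - c $ j) * (X $ i $ j * Q $ i $ j))"
    unfolding inner_vec_def inner_real_def
  proof (intro sum.cong refl)
    fix i j
    have "(c $ i + c $ j) * rb_coeff c i j = c $ i - c $ j" using pos[of i] pos[of j] by (simp add: rb_coeff_def)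
    moreover have "rb c X X $ i $ j = rb_coeff c i j * Q $ i $ j" by (simp add: rb_def K_def Q_def)
    ultimately show "inertia (diag_matrix c) X $ i $ j * rb c X X $ i $ j = (c $ i - c $ j) * (X $ i $ j * Q $ i $ j)"
      by (simp add: inertia_diag mult_ac)
  qed
  also have "\<dots> = (\<Sum>i\<in>UNIV. \<Sum>j\<in>UNIV. (c $ i - c $ j) * (K $ i $ j * Q $ i $ j))"
  proof -
    let ?s = "\<lambda>Z :: real ^ 'n ^ 'n. \<Sum>i\<in>UNIV. \<Sum>j\<in>UNIV. (c $ i - c $ j) * (Z $ i $ j * Q $ i $ j)"
    \<comment> \<open>The weights \<open>(c $ i - c $ j) * Q $ i $ j\<close> are antisymmetric, so
      only the skew part of \<open>X\<close> contributes.\<close>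
    have "?s X = - (\<Sum>i\<in>UNIV. \<Sum>j\<in>UNIV. (c $ i - c $ j) * (X $ j $ i * Q $ i $ j))"
      unfolding sum_negf[symmetric]
      by (subst sum.swap) (intro sum.cong refl, simp add: Q algebra_simps)
    then have "2 * ?s X = ?s X - (\<Sum>i\<in>UNIV. \<Sum>j\<in>UNIV. (c $ i - c $ j) * (X $ j $ i * Q $ i $ j))" by simp
    also have "\<dots> = (\<Sum>i\<in>UNIV. \<Sum>j\<in>UNIV. 2 * ((c $ i - c $ j) * (K $ i $ j * Q $ i $ j)))"
      unfolding sum_subtractf[symmetric]
      by (intro sum.cong refl) (simp add: K_def skew_part_component algebra_simps)
    finally show ?thesis by (simp add: sum_distrib_left[symmetric])
  qed
  also have "\<dots> = 0"
  proof -
    have KQ: "(\<Sum>j\<in>UNIV. K $ i $ j * Q $ i $ j) = 0" for i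
    proof -
      have skew: "transpose K = - K" unfolding K_def using skew_part_in_so by (simp add: so_def)
      have "transpose (K ** Q) = - (K ** Q)"
        by (simp add: Q_def matrix_transpose_mul skew matrix_uminus_left matrix_uminus_right matrix_mul_assoc)
      then have "transpose (K ** Q) $ i $ i = (- (K ** Q)) $ i $ i" by simp
      then have "(K ** Q) $ i $ i = 0" by (simp add: transpose_def)
      then show ?thesis by (simp add: matrix_matrix_mult_def Q[of _ i])
    qed
    have 1: "(\<Sum>i\<in>UNIV. \<Sum>j\<in>UNIV. c $ i * (K $ i $ j * Q $ i $ j)) = 0"
      by (simp add: sum_distrib_left[symmetric] KQ)
    have "(\<Sum>i\<in>UNIV. \<Sum>j\<in>UNIV. c $ j * (K $ i $ j * Q $ i $ j)) =
        - (\<Sum>j\<in>UNIV. \<Sum>i\<in>UNIV. c $ j * (K $ j $ i * Q $ j $ i))"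
      unfolding sum_negf[symmetric]
    proof (subst sum.swap, intro sum.cong refl)
      fix i j
      have "K $ i $ j = - K $ j $ i" "Q $ i $ j = Q $ j $ i" by (rule K, rule Q)
      then show "c $ j * (K $ i $ j * Q $ i $ j) = - (c $ j * (K $ j $ i * Q $ j $ i))" by simp
    qed
    then have 2: "(\<Sum>i\<in>UNIV. \<Sum>j\<in>UNIV. c $ j * (K $ i $ j * Q $ i $ j)) = 0" using 1 by simp
    show ?thesis using 1 2 by (simp add: left_diff_distrib sum_subtractf)
  qed
  finally show ?thesis .
qed

lemma quadratic_system_rb:
  assumes G: "G \<in> generic" and b: "0 < b"
  obtains m where "quadratic_system (rb c) (inertia (diag_matrix c)) m sym_matrices G b"
proof -
  \<comment> \<open>Inertia multiplies entry \<open>(i, j)\<close> by \<open>c $ i + c $ j\<close>,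
    which is at least twice the smallest moment.\<close>
  define m where "m = 2 * Min (range (($) c))"
  have Min: "Min (range (($) c)) \<le> c $ i" for i by (rule Min_le) auto
  have m: "m \<le> c $ i + c $ j" for i j
    using Min[of i] Min[of j] unfolding m_def by linarith
  have "quadratic_system (rb c) (inertia (diag_matrix c)) m sym_matrices G b"
  proof (rule quadratic_system.intro)
    show "bounded_bilinear (rb c)" by (rule bounded_bilinear_rb)
    show "rb c X Y = rb c Y X" for X Y by (rule rb_sym)
    show "bounded_linear (inertia (diag_matrix c))" using linear_inertia linear_conv_bounded_linear by blast
    show "X \<bullet> inertia (diag_matrix c) Y = inertia (diag_matrix c) X \<bullet> Y" for X Y
      by (simp add: inner_vec_def inertia_diag mult_ac)
    show "0 < m" using pos by (simp add: m_def)
    show "m * (X \<bullet> X) \<le> X \<bullet> inertia (diag_matrix c) X" for X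
    proof -
      have "m * (X \<bullet> X) = (\<Sum>i\<in>UNIV. \<Sum>j\<in>UNIV. m * (X $ i $ j * X $ i $ j))"
        by (simp add: inner_vec_def sum_distrib_left)
      also have "\<dots> \<le> (\<Sum>i\<in>UNIV. \<Sum>j\<in>UNIV. (c $ i + c $ j) * (X $ i $ j * X $ i $ j))"
        by (intro sum_mono mult_right_mono m) simp
      also have "\<dots> = X \<bullet> inertia (diag_matrix c) X"
        by (simp add: inner_vec_def inertia_diag mult_ac)
      finally show ?thesis .
    qed
    show "inertia (diag_matrix c) X \<bullet> rb c X X = 0" for X by (rule rb_conserved)
    show "rb c (X + s *\<^sub>R e) (X + s *\<^sub>R e) \<bullet> e = rb c X X \<bullet> e" if e: "e \<in> Basis" for e X s
    proof -
      obtain i j where ij: "e = axis i (axis j 1)" using e by (auto simp: Basis_vec_def)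
      have comp: "Z \<bullet> e = Z $ i $ j" for Z by (simp add: ij inner_axis)
      have ek: "e $ k $ l = (if k = i \<and> l = j then 1 else 0)" for k l by (simp add: ij axis_def)
      show ?thesis
      proof (cases "i = j")
        case True
        then show ?thesis unfolding comp by (simp add: rb_component rb_coeff_def)
      next
        case False
        have diag: "skew_part Z $ k $ k = 0" for Z :: "real ^ 'n ^ 'n" and k by (simp add: skew_part_component)
        \<comment> \<open>In an off-diagonal entry \<open>(i, j)\<close> of a squared skew matrix,
          the entry \<open>(i, j)\<close> itself is multiplied by diagonal entries only, and these
          are zero.\<close>
        have "skew_part (X + s *\<^sub>R e) $ i $ k * skew_part (X + s *\<^sub>R e) $ k $ j = skew_part X $ i $ k * skew_part X $ k $ j" for k
        proof -
          consider "k = i" | "k = j" | "k \<noteq> i" "k \<noteq> j" by blast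
          then show ?thesis
          proof cases
            case 3
            then have "e $ i $ k = 0" "e $ k $ i = 0" "e $ k $ j = 0" "e $ j $ k = 0"
              using False by (simp_all add: ek)
            then show ?thesis by (simp add: skew_part_component)
          qed (simp_all add: diag)
        qed
        then show ?thesis unfolding comp rb_component by simp
      qed
    qed
    show "subspace (sym_matrices :: (real ^ 'n ^ 'n) set)" by (rule subspace_sym_matrices)
    show "S = UNIV" if "subspace S" "sym_matrices \<subseteq> S" "G \<in> S" "\<And>w. w \<in> S \<Longrightarrow> rb c w w \<in> S" for S
      using generic_generating[OF G that] .
  qed (rule b)
  then show ?thesis by (rule that)
qed

end

text \<open>Controls are Borel on the whole line and bounded everywhere, so that pieces can be
  concatenated; admissibility on \<open>{0..T}\<close> follows at the end.\<close>

definition steerable :: "real ^ 'n ^ 'n \<Rightarrow> real ^ 'n ^ 'n \<Rightarrow> real \<Rightarrow> real ^ 'n ^ 'n \<Rightarrow> real ^ 'n ^ 'n \<Rightarrow> bool"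
  where "steerable C G b X Y \<longleftrightarrow> (\<exists>T\<ge>0. \<exists>u W. u \<in> borel_measurable borel \<and> (\<forall>t. \<bar>u t\<bar> \<le> b) \<and>
    solution C G T u W \<and> W 0 = X \<and> W T = Y)"

lemma steerable_refl:
  assumes "0 \<le> b" "X \<in> so"
  shows "steerable C G b X X"
proof -
  have "solution C G 0 (\<lambda>_. 0) (\<lambda>_. X)" using assms by (auto simp: solution_def)
  then show ?thesis
    unfolding steerable_def using assms by (intro exI[of _ 0] conjI exI[of _ "\<lambda>_. 0"] exI[of _ "\<lambda>_. X"]) auto
qed

lemma steerable_append_constant:
  assumes st: "steerable C G b X Y" and c: "\<bar>c\<bar> \<le> b" and S: "0 \<le> S"
    and V: "\<And>s. (V has_vector_derivative (euler_field C (V s) + c *\<^sub>R G)) (at s)" "\<And>s. V s \<in> so" "V 0 = Y"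
  shows "steerable C G b X (V S)"
proof -
  obtain T u W where T: "0 \<le> T" and u: "u \<in> borel_measurable borel" "\<And>t. \<bar>u t\<bar> \<le> b"
    and W: "solution C G T u W" "W 0 = X" "W T = Y"
    using st unfolding steerable_def by blast
  define u' where "u' t = (if t \<le> T then u t else c)" for t
  define W' where "W' t = (if t \<le> T then W t else V (t - T))" for t
  have VT: "((\<lambda>t. V (t - T)) has_vector_derivative (euler_field C (V (t - T)) + c *\<^sub>R G)) (at t within A)" for t A
  proof -
    have "((V \<circ> (\<lambda>t. t - T)) has_vector_derivative 1 *\<^sub>R (euler_field C (V (t - T)) + c *\<^sub>R G)) (at t)"
    proof (rule vector_diff_chain_at)
      show "((\<lambda>t. t - T) has_vector_derivative 1) (at t)" by (auto intro!: derivative_eq_intros)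
    qed (rule V)
    then show ?thesis by (simp add: o_def has_vector_derivative_at_within)
  qed
  have W'_late: "W' t = V (t - T)" if "T \<le> t" for t using that W(3) V(3) by (cases "t = T") (auto simp: W'_def)
  have "solution C G (T + S) u' W'"
    unfolding solution_def
  proof (intro conjI ballI)
    have "{0..T + S} = {0..T} \<union> {T..T + S}" using T S by auto
    moreover have "continuous_on {0..T} W'"
    proof (rule continuous_on_eq)
      show "continuous_on {0..T} W" using W(1) unfolding solution_def by blast
    qed (simp add: W'_def)
    moreover have "continuous_on {T..T + S} W'"
    proof -
      have "continuous_on {T..T + S} (\<lambda>t. V (t - T))"
        unfolding continuous_on_eq_continuous_within by (intro ballI has_vector_derivative_continuous[OF VT])
      then show ?thesis by (rule continuous_on_eq) (simp add: W'_late)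
    qed
    ultimately show "continuous_on {0..T + S} W'" by (simp add: continuous_on_closed_Un)
    fix t assume t: "t \<in> {0..T + S}"
    show "W' t \<in> so" using W(1) t V(2) by (auto simp: W'_def solution_def)
    have early: "((\<lambda>s. euler_field C (W' s) + u' s *\<^sub>R G) has_integral (W' r - W' 0)) {0..r}" if r: "0 \<le> r" "r \<le> T" for r
    proof -
      have "((\<lambda>s. euler_field C (W s) + u s *\<^sub>R G) has_integral (W r - W 0)) {0..r}"
        using W(1) r by (auto simp: solution_def)
      then have "((\<lambda>s. euler_field C (W' s) + u' s *\<^sub>R G) has_integral (W r - W 0)) {0..r}"
        by (rule has_integral_eq[rotated]) (use r in \<open>auto simp: W'_def u'_def\<close>)
      then show ?thesis using r T by (simp add: W'_def)
    qed
    show "((\<lambda>s. euler_field C (W' s) + u' s *\<^sub>R G) has_integral (W' t - W' 0)) {0..t}"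
    proof (cases "t \<le> T")
      case True
      then show ?thesis using early t by auto
    next
      case False
      have "((\<lambda>s. euler_field C (V (s - T)) + c *\<^sub>R G) has_integral (V (t - T) - V (T - T))) {T..t}"
        by (rule fundamental_theorem_of_calculus[OF _ VT]) (use False in simp)
      then have "((\<lambda>s. euler_field C (W' s) + u' s *\<^sub>R G) has_integral (V (t - T) - V (T - T))) {T..t}"
        \<comment> \<open>At the switching time \<open>T\<close> the control still has its old
          value; one point does not affect the integral.\<close>
        by (rule has_integral_spike_finite[of "{T}", rotated 2]) (auto simp: W'_late u'_def)
      then have "((\<lambda>s. euler_field C (W' s) + u' s *\<^sub>R G) has_integral (W' t - W' T)) {T..t}"
        using False by (simp add: W'_late)
      from has_integral_combine[OF T _ early[OF T order_refl] this] False
      show ?thesis by simp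
    qed
  qed
  moreover have "u' \<in> borel_measurable borel"
    unfolding u'_def[abs_def] using u(1) by measurable
  moreover have "\<bar>u' t\<bar> \<le> b" for t using u(2) c by (simp add: u'_def)
  moreover have "W' 0 = X" "W' (T + S) = V S" using T S W(2) W'_late[of "T + S"] by (simp_all add: W'_def)
  ultimately show ?thesis
    unfolding steerable_def using T S by (intro exI[of _ "T + S"] conjI exI[of _ u'] exI[of _ W']) auto
qed

lemma globally_controllable_steerable:
  assumes "\<And>X Y. X \<in> so \<Longrightarrow> Y \<in> so \<Longrightarrow> steerable C G b X Y" "{-b..b} \<subseteq> U"
  shows "globally_controllable C G U"
  unfolding globally_controllable_def
proof (intro ballI)
  fix X Y :: "real ^ 'a ^ 'a" assume "X \<in> so" "Y \<in> so"
  from assms(1)[OF this] obtain T u W where *: "0 \<le> T" "u \<in> borel_measurable borel" "\<And>t. \<bar>u t\<bar> \<le> b"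
    "solution C G T u W" "W 0 = X" "W T = Y"
    unfolding steerable_def by blast
  have "u \<in> borel_measurable (lebesgue_on {0..T})"
    using *(2) by (intro measurable_restrict_space1 measurable_completion) simp
  moreover have "u t \<in> U" for t
  proof -
    have "u t \<in> {-b..b}" using *(3)[of t] by (auto simp: abs_le_iff)
    then show ?thesis using assms(2) by blast
  qed
  ultimately have "admissible_control U T u"
    unfolding admissible_control_def using *(3) by auto
  then show "\<exists>T\<ge>0. \<exists>u W. admissible_control U T u \<and> solution C G T u W \<and> W 0 = X \<and> W T = Y"
    using * by blast
qed

context distinct_inertia begin

text \<open>The skew part of an extended path is a genuine path: \<open>rb\<close> sees only skew
  parts and takes values in \<open>so\<close>, so flow segments project to solutions, while jumps
  along symmetric matrices project to no motion at all.\<close>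

lemma steerable_diag:
  assumes G: "G \<in> generic" and b: "0 < b" and XY: "X \<in> so" "Y \<in> so"
  shows "steerable (diag_matrix c) G b X Y"
proof -
  obtain m where "quadratic_system (rb c) (inertia (diag_matrix c)) m sym_matrices G b"
    by (rule quadratic_system_rb[OF G b]) (rule that)
  then interpret Q: quadratic_system "rb c" "inertia (diag_matrix c)" m sym_matrices G b .
  have bl: "bounded_linear skew_part" using linear_skew_part linear_conv_bounded_linear by blast
  have GG: "skew_part G = G" using G skew_part_so by (auto simp: generic_def)
  have "steerable (diag_matrix c) G b (skew_part X) (skew_part Y)" if "Q.reach X Y" for X Y
    using that unfolding Q.reach_def
  proof (induction rule: rtranclp_induct)
    case base
    show ?case by (rule steerable_refl[OF less_imp_le[OF b] skew_part_in_so])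
  next
    case (step Y Z)
    from step.hyps(2)[unfolded Q.step_def] show ?case
    proof
      assume "\<exists>d t. \<bar>d\<bar> \<le> b \<and> 0 \<le> t \<and> Z = Q.flow d t Y"
      then obtain d t where d: "\<bar>d\<bar> \<le> b" "0 \<le> t" "Z = Q.flow d t Y" by blast
      have "((\<lambda>s. skew_part (Q.flow d s Y)) has_vector_derivative
        euler_field (diag_matrix c) (skew_part (Q.flow d s Y)) + d *\<^sub>R G) (at s)" for s
      proof -
        have "((\<lambda>s. skew_part (Q.flow d s Y)) has_vector_derivative
          skew_part (Q.f (Q.flow d s Y) + d *\<^sub>R G)) (at s)"
          by (rule bounded_linear.has_vector_derivative[OF bl Q.flow_deriv])
        moreover have "skew_part (Q.f Z + d *\<^sub>R G) = euler_field (diag_matrix c) (skew_part Z) + d *\<^sub>R G" for Z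
          by (simp add: linear_add[OF linear_skew_part] linear_scale[OF linear_skew_part] GG Q.f_def
              skew_part_so[OF rb_in_so] euler_field_diag[OF skew_part_in_so] rb_skew_part)
        ultimately show ?thesis by simp
      qed
      from steerable_append_constant[OF step.IH d(1,2) this] d(3)
      show ?thesis by (simp add: skew_part_in_so)
    next
      assume "Z - Y \<in> sym_matrices"
      then have "skew_part Z = skew_part Y"
        using skew_part_eq_0[of "Z - Y"] by (simp add: linear_diff[OF linear_skew_part])
      then show ?thesis using step.IH by simp
    qed
  qed
  from this[OF Q.reach_all, of X Y] show ?thesis using XY by (simp add: skew_part_so)
qed

end

text \<open>There are as many eigenvalues as dimensions, so they can be indexed by
  \<open>'n\<close>. One unit eigenvector for each gives an orthonormal basis, as symmetry makes
  eigenvectors of different eigenvalues orthogonal.\<close>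

lemma diagonalization:
  fixes C :: "real ^ 'n ^ 'n"
  assumes C: "sym_posdef C" and d: "distinct_eigenvalues C"
  obtains P :: "real ^ 'n ^ 'n" and c :: "real ^ 'n" where "transpose P ** P = mat 1" "P ** transpose P = mat 1"
    "C = P ** diag_matrix c ** transpose P" "\<And>i. 0 < c $ i" "inj (($) c)"
proof -
  have sym: "transpose C = C" using C by (simp add: sym_posdef_def)
  have "finite (eigenvalues C)"
    using d unfolding distinct_eigenvalues_def by (metis card.infinite zero_less_card_finite less_irrefl)
  then obtain e where e: "bij_betw e (UNIV :: 'n set) (eigenvalues C)"
    using finite_same_card_bij[of "UNIV :: 'n set" "eigenvalues C"] d by (auto simp: distinct_eigenvalues_def)
  have "\<forall>i. \<exists>v. norm v = 1 \<and> C *v v = e i *\<^sub>R v"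
  proof
    fix i
    have "e i \<in> eigenvalues C" using bij_betw_apply[OF e] by simp
    then obtain v where v: "v \<noteq> 0" "C *v v = e i *\<^sub>R v" by (auto simp: eigenvalues_def)
    have "C *v ((1 / norm v) *\<^sub>R v) = e i *\<^sub>R ((1 / norm v) *\<^sub>R v)"
      using v(2) by (simp add: scaleR_matrix_vector_assoc[symmetric] matrix_vector_mult_scaleR)
    then show "\<exists>v. norm v = 1 \<and> C *v v = e i *\<^sub>R v" using v(1) by (intro exI[of _ "(1 / norm v) *\<^sub>R v"]) auto
  qed
  from choice[OF this] obtain v where "\<forall>i. norm (v i) = 1 \<and> C *v v i = e i *\<^sub>R v i" by (rule exE)
  then have v: "\<And>i. norm (v i) = 1" "\<And>i. C *v v i = e i *\<^sub>R v i" by blast+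
  have ortho: "v i \<bullet> v j = (if i = j then 1 else 0)" for i j
  proof (cases "i = j")
    case True
    then show ?thesis using v(1)[of j] by (simp add: norm_eq_1)
  next
    case False
    then have ne: "e i \<noteq> e j" using e by (auto simp: bij_betw_def inj_on_def)
    have "e i * (v i \<bullet> v j) = (C *v v i) \<bullet> v j" by (simp add: v)
    also have "C *v v i = v i v* C" using transpose_matrix_vector[of C "v i"] sym by simp
    also have "(v i v* C) \<bullet> v j = v i \<bullet> (C *v v j)" by (rule dot_lmul_matrix)
    also have "\<dots> = e j * (v i \<bullet> v j)" by (simp add: v)
    finally show ?thesis using ne False by simp
  qed
  define P where "P = (\<chi> a i. v i $ a)"
  define c where "c = (\<chi> i. e i)"
  have PP: "transpose P ** P = mat 1"
  proof -
    have "(transpose P ** P) $ i $ j = v i \<bullet> v j" for i j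
      by (simp add: matrix_matrix_mult_def transpose_def P_def inner_vec_def)
    then show ?thesis by (simp add: vec_eq_iff ortho mat_def)
  qed
  then have PP': "P ** transpose P = mat 1" using matrix_left_right_inverse by blast
  have "C ** P = P ** diag_matrix c"
  proof -
    have "(C ** P) $ a $ i = (C *v v i) $ a" for a i
      by (simp add: matrix_matrix_mult_def matrix_vector_mult_def P_def)
    then show ?thesis by (simp add: vec_eq_iff diag_matrix_mult v P_def c_def mult.commute)
  qed
  then have "C ** P ** transpose P = P ** diag_matrix c ** transpose P" by simp
  then have eq: "C = P ** diag_matrix c ** transpose P"
    by (simp add: matrix_mul_assoc[symmetric] PP')
  have "0 < c $ i" for i
  proof -
    have "v i \<noteq> 0" using v(1)[of i] by auto
    then have "0 < v i \<bullet> (C *v v i)" using C unfolding sym_posdef_def by blast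
    then show ?thesis using ortho[of i i] by (simp add: v c_def)
  qed
  moreover have "inj (($) c)" using e by (simp add: c_def inj_on_def bij_betw_def)
  ultimately show ?thesis by (rule that[OF PP PP' eq])
qed

section \<open>Orthogonal change of basis\<close>

definition conj_by :: "real ^ 'n ^ 'n \<Rightarrow> real ^ 'n ^ 'n \<Rightarrow> real ^ 'n ^ 'n"
  where "conj_by P X = P ** X ** transpose P"

lemma linear_conj_by: "linear (conj_by P)"
proof (rule linearI)
  show "conj_by P (X + Y) = conj_by P X + conj_by P Y" for X Y
    by (simp add: conj_by_def matrix_add_ldistrib)
      (simp add: matrix_matrix_mult_def vec_eq_iff sum.distrib distrib_right)
  show "conj_by P (r *\<^sub>R X) = r *\<^sub>R conj_by P X" for r X
    by (simp add: conj_by_def matrix_matrix_mult_def vec_eq_iff sum_distrib_left sum_distrib_right mult_ac)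
qed

lemma conj_by_so: "X \<in> so \<Longrightarrow> conj_by P X \<in> so"
  by (simp add: so_def conj_by_def matrix_transpose_mul matrix_uminus_left matrix_uminus_right matrix_mul_assoc)

lemma conj_by_inverse:
  assumes "Q ** P = mat 1" "transpose P ** transpose Q = mat 1"
  shows "conj_by Q (conj_by P X) = X"
proof -
  have "conj_by Q (conj_by P X) = (Q ** P) ** X ** (transpose P ** transpose Q)"
    by (simp add: conj_by_def matrix_mul_assoc)
  then show ?thesis by (simp add: assms)
qed

lemma conj_by_mult:
  assumes "transpose P ** P = mat 1"
  shows "conj_by P X ** conj_by P Y = conj_by P (X ** Y)"
proof -
  have "conj_by P X ** conj_by P Y = P ** X ** (transpose P ** P) ** Y ** transpose P"
    by (simp add: conj_by_def matrix_mul_assoc)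
  then show ?thesis by (simp add: assms conj_by_def matrix_mul_assoc)
qed

text \<open>Conjugation by an orthogonal matrix is multiplicative, so it intertwines the inertia
  operators and commutators; injectivity of the conjugated inertia operator on \<open>so\<close>
  identifies the preimage.\<close>

lemma euler_field_conj:
  assumes P: "transpose P ** P = mat 1" and W: "W \<in> so"
    and C: "sym_posdef C" "sym_posdef (conj_by P C)"
  shows "euler_field (conj_by P C) (conj_by P W) = conj_by P (euler_field C W)"
proof -
  have bij: "bij_betw (inertia C) so so" "bij_betw (inertia (conj_by P C)) so so" using inertia_bij C by blast+
  have "commutator C (W ** W) \<in> so" using commutator_square_so C(1) W by (auto simp: sym_posdef_def)
  then have E: "euler_field C W \<in> so" "inertia C (euler_field C W) = commutator C (W ** W)"
    unfolding euler_field_def inertia_inv_def using bij(1)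
    by (auto simp: bij_betw_def intro: inv_into_into f_inv_into_f)
  have "inertia (conj_by P C) (conj_by P (euler_field C W)) = conj_by P (inertia C (euler_field C W))"
    by (simp add: inertia_def conj_by_mult[OF P] linear_add[OF linear_conj_by])
  also have "\<dots> = commutator (conj_by P C) (conj_by P W ** conj_by P W)"
    by (simp add: E(2) commutator_def conj_by_mult[OF P] linear_diff[OF linear_conj_by])
  finally have "inertia (conj_by P C) (conj_by P (euler_field C W)) = commutator (conj_by P C) (conj_by P W ** conj_by P W)" .
  then show ?thesis
    unfolding euler_field_def[of "conj_by P C"] inertia_inv_def
    using bij(2) conj_by_so[OF E(1)] by (intro inv_into_f_eq) (auto simp: bij_betw_def)
qed

lemma steerable_conj:
  assumes P: "transpose P ** P = mat 1" and C: "sym_posdef C" "sym_posdef (conj_by P C)"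
    and st: "steerable C G b X Y"
  shows "steerable (conj_by P C) (conj_by P G) b (conj_by P X) (conj_by P Y)"
proof -
  obtain T u W where *: "0 \<le> T" "u \<in> borel_measurable borel" "\<forall>t. \<bar>u t\<bar> \<le> b"
    "solution C G T u W" "W 0 = X" "W T = Y"
    using st unfolding steerable_def by blast
  have bl: "bounded_linear (conj_by P)" using linear_conj_by linear_conv_bounded_linear by blast
  have "solution (conj_by P C) (conj_by P G) T u (\<lambda>t. conj_by P (W t))"
    unfolding solution_def
  proof (intro conjI ballI)
    show "continuous_on {0..T} (\<lambda>t. conj_by P (W t))"
      using *(4) bounded_linear.continuous_on[OF bl] unfolding solution_def by blast
    fix t assume t: "t \<in> {0..T}"
    show "conj_by P (W t) \<in> so" using *(4) t conj_by_so unfolding solution_def by blast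
    have "((\<lambda>s. euler_field C (W s) + u s *\<^sub>R G) has_integral (W t - W 0)) {0..t}"
      using *(4) t unfolding solution_def by blast
    from has_integral_linear[OF this bl]
    have "((\<lambda>s. conj_by P (euler_field C (W s) + u s *\<^sub>R G)) has_integral (conj_by P (W t) - conj_by P (W 0))) {0..t}"
      by (simp add: o_def linear_diff[OF linear_conj_by])
    then show "((\<lambda>s. euler_field (conj_by P C) (conj_by P (W s)) + u s *\<^sub>R conj_by P G)
        has_integral (conj_by P (W t) - conj_by P (W 0))) {0..t}"
    proof (rule has_integral_eq[rotated])
      fix s assume "s \<in> {0..t}"
      then have "W s \<in> so" using *(4) t unfolding solution_def by auto
      then show "conj_by P (euler_field C (W s) + u s *\<^sub>R G) = euler_field (conj_by P C) (conj_by P (W s)) + u s *\<^sub>R conj_by P G"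
        by (simp add: linear_add[OF linear_conj_by] linear_scale[OF linear_conj_by] euler_field_conj[OF P _ C])
    qed
  qed
  then show ?thesis
    unfolding steerable_def using * by (intro exI[of _ T] conjI exI[of _ u] exI[of _ "\<lambda>t. conj_by P (W t)"]) auto
qed

theorem theorem3p2:
  fixes C :: "real ^ 'n ^ 'n"
  assumes "CARD('n) \<ge> 3"
    and "sym_posdef C"
    and "distinct_eigenvalues C"
  shows "\<exists>D. openin (top_of_set so) D \<and> so \<subseteq> closure D \<and>
    (\<forall>G\<in>D. globally_controllable C G UNIV \<and>
            (\<forall>b>0. globally_controllable C G {-b..b}))"
proof -
  obtain P :: "real ^ 'n ^ 'n" and c :: "real ^ 'n" where P: "transpose P ** P = mat 1" "P ** transpose P = mat 1"
    and C: "C = P ** diag_matrix c ** transpose P" and c: "\<And>i. 0 < c $ i" "inj (($) c)"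
    by (rule diagonalization[OF assms(2,3)]) (rule that)
  interpret distinct_inertia c by unfold_locales (use c assms(1) in auto)
  let ?\<psi> = "conj_by P" and ?\<phi> = "conj_by (transpose P)"
  have inv: "?\<phi> (?\<psi> X) = X" "?\<psi> (?\<phi> X) = X" for X
    by (rule conj_by_inverse; simp add: P)+
  have cont: "continuous_on S (conj_by Q)" for S and Q :: "real ^ 'n ^ 'n"
    by (rule linear_continuous_on) (use linear_conj_by linear_conv_bounded_linear in blast)
  have CP: "C = ?\<psi> (diag_matrix c)" using C by (simp add: conj_by_def)
  have st: "steerable C G b X Y" if G: "?\<phi> G \<in> generic" and b: "0 < b" and XY: "X \<in> so" "Y \<in> so" for G b X Y
  proof -
    have "steerable (diag_matrix c) (?\<phi> G) b (?\<phi> X) (?\<phi> Y)"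
      by (rule steerable_diag[OF G b]) (rule conj_by_so XY)+
    from steerable_conj[OF P(1) sym_posdef_diag _ this] show ?thesis using assms(2) by (simp add: CP[symmetric] inv)
  qed
  let ?D = "?\<psi> ` generic"
  have "openin (top_of_set so) ?D"
  proof -
    obtain O' where O': "open O'" "generic = so \<inter> O'" using generic_open unfolding openin_open by blast
    have "?D = so \<inter> ?\<phi> -` O'"
    proof (intro equalityI subsetI)
      fix X assume "X \<in> so \<inter> ?\<phi> -` O'"
      then have "?\<phi> X \<in> generic" using O'(2) conj_by_so by auto
      then show "X \<in> ?D" by (intro image_eqI[of _ _ "?\<phi> X"]) (simp add: inv)
    qed (use O'(2) conj_by_so inv in auto)
    moreover have "open (?\<phi> -` O')" by (rule open_vimage[OF O'(1) cont])
    ultimately show ?thesis by (simp add: openin_open_Int)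
  qed
  moreover have "so \<subseteq> closure ?D"
  proof
    fix X :: "real ^ 'n ^ 'n" assume "X \<in> so"
    then have "?\<phi> X \<in> closure generic" using generic_dense conj_by_so by blast
    moreover have "?\<psi> ` closure generic \<subseteq> closure ?D"
      by (rule image_closure_subset[OF cont]) (auto simp: closure_subset[THEN subsetD])
    ultimately have "?\<psi> (?\<phi> X) \<in> closure ?D" by blast
    then show "X \<in> closure ?D" by (simp add: inv)
  qed
  moreover have "globally_controllable C G UNIV \<and> (\<forall>b>0. globally_controllable C G {-b..b})" if "G \<in> ?D" for G
  proof -
    have G: "?\<phi> G \<in> generic" using that inv by auto
    show ?thesis
    proof (intro conjI allI impI)
      show "globally_controllable C G UNIV"
        \<comment> \<open>Unrestricted controllability is already achieved with controls bounded by
          1.\<close>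
        by (rule globally_controllable_steerable[OF st[OF G zero_less_one]]) auto
      show "globally_controllable C G {-b..b}" if "0 < b" for b
        by (rule globally_controllable_steerable[OF st[OF G that]]) auto
    qed
  qed
  ultimately show ?thesis by (intro exI[of _ ?D]) blast
qed

end
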